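(* Let $G$ be a finitely generated pro-$p$ group with minimal presentation $1\to R\to S\to G\to1$, where $S$ is the free pro-$p$ group on $x_1,\dots,x_d$ and $R\subseteq S_{(2)}$, and assume $H^\bullet(G,\mathbb{F}_p)=T_\bullet(V)/(\Omega)$ is quadratic, with $V=H^1(G,\mathbb{F}_p)$ and $\Omega\subseteq V\otimes V$. Then, under the identification of $S_{(2)}/S_{(3)}$ with a subspace of $(V\otimes V)^*=V^*\otimes V^*$ described below, $\Omega^\perp=RS_{(3)}/S_{(3)}$. In particular, with $X=\{X_1,\dots,X_d\}$, there is an isomorphism of quadratic $\mathbb{F}_p$-algebras $H^\bullet(G,\mathbb{F}_p)^!\cong\mathbb{F}_p\langle X\rangle/\mathcal{R}$, where $\mathcal{R}$ is the two-sided ideal generated by the initial forms of the defining relations of $G$.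
   Context: $S_{(n)}$ is the $p$-Zassenhaus filtration ($S_{(1)}=S$, $S_{(n)}=S_{(\lceil n/p\rceil)}^p\prod_{i+j=n}[S_{(i)},S_{(j)}]$). The Magnus map $x_i\mapsto1+X_i$ gives an isomorphism $\mathbb{F}_p[\![S]\!]\cong\mathbb{F}_p\langle\!\langle X\rangle\!\rangle$ and an embedding $L(S)=\bigoplus_nS_{(n)}/S_{(n+1)}\hookrightarrow\mathbb{F}_p\langle X\rangle$ (free noncommutative polynomials), with $S_{(n)}/S_{(n+1)}$ landing in degree $n$. Identify $\mathbb{F}_p\langle X\rangle=T_\bullet(V^* )$ with $X_i$ the basis of $V^*\cong S/S_{(2)}$ dual to the basis $\chi_1,\dots,\chi_d$ of $V=H^1(G,\mathbb{F}_p)=H^1(S,\mathbb{F}_p)$ with $\chi_i(x_j)=\delta_{ij}$, and pair $V^*\otimes V^*$ with $V\otimes V$ by $(f\otimes g,u\otimes v)\mapsto -f(u)g(v)$; thus $S_{(2)}/S_{(3)}$ and its subspace $RS_{(3)}/S_{(3)}$ lie in $(V\otimes V)^*$. The quadratic dual of $T_\bullet(V)/(\Omega)$ is $T_\bullet(V^* )/(\Omega^\perp)$. Defining relations: a minimal subset of $R$ generating it as closed normal subgroup; the initial form of $r$ is its image in $S_{(n)}/S_{(n+1)}$ for the largest $n$ with $r\in S_{(n)}$, viewed in $\mathbb{F}_p\langle X\rangle$. *)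

theory Defs
  imports
    "HOL-Analysis.Analysis"
    "Berlekamp_Zassenhaus.Finite_Field"
    "HOL-Algebra.Algebra"
begin

text \<open>The field \<open>F\<^sub>p\<close> is the type \<open>'p mod_ring\<close> with \<open>'p :: prime_card\<close>, so that \<open>p = CARD('p)\<close>.
  A topological group is a pair of a group \<open>G\<close> and a topology \<open>T\<close>.\<close>

section \<open>Pro-\<open>p\<close> groups\<close>

definition topological_group :: "'g monoid \<Rightarrow> 'g topology \<Rightarrow> bool" where
  "topological_group G T \<longleftrightarrow>
     group G \<and> topspace T = carrier G \<and>
     continuous_map (prod_topology T T) T (\<lambda>(a, b). a \<otimes>\<^bsub>G\<^esub> b) \<and>
     continuous_map T T (\<lambda>a. inv\<^bsub>G\<^esub> a)"

definition pro_p_group :: "nat \<Rightarrow> 'g monoid \<Rightarrow> 'g topology \<Rightarrow> bool" where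
  "pro_p_group p G T \<longleftrightarrow>
     topological_group G T \<and> compact_space T \<and> Hausdorff_space T \<and>
     (\<forall>U. openin T U \<and> \<one>\<^bsub>G\<^esub> \<in> U \<longrightarrow>
        (\<exists>N k. N \<lhd> G \<and> openin T N \<and> N \<subseteq> U \<and> order (G Mod N) = p ^ k))"

definition topologically_fg :: "'g monoid \<Rightarrow> 'g topology \<Rightarrow> bool" where
  "topologically_fg G T \<longleftrightarrow>
     (\<exists>A. finite A \<and> A \<subseteq> carrier G \<and> T closure_of (generate G A) = carrier G)"

definition continuous_hom ::
    "'g monoid \<Rightarrow> 'g topology \<Rightarrow> 'h monoid \<Rightarrow> 'h topology \<Rightarrow> ('g \<Rightarrow> 'h) set" where
  "continuous_hom G T H U = {\<phi> \<in> hom G H. continuous_map T U \<phi>}"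

text \<open>The free pro-\<open>p\<close> group on \<open>x 0, \<dots>, x (d - 1)\<close>, by its universal property. The test groups \<open>H\<close>
  have their elements in the type \<open>nat \<Rightarrow> nat\<close>. This loses nothing: the image of \<open>\<phi>\<close> is the closed
  subgroup generated by the finitely many \<open>y i\<close>, and a topologically finitely generated
  pro-\<open>p\<close> group has at most continuum many elements.\<close>

definition free_pro_p_group ::
    "nat \<Rightarrow> 's monoid \<Rightarrow> 's topology \<Rightarrow> nat \<Rightarrow> (nat \<Rightarrow> 's) \<Rightarrow> bool" where
  "free_pro_p_group p S T d x \<longleftrightarrow>
     pro_p_group p S T \<and> (\<forall>i<d. x i \<in> carrier S) \<and>
     (\<forall>(H :: (nat \<Rightarrow> nat) monoid) U y.
        pro_p_group p H U \<and> (\<forall>i<d. y i \<in> carrier H) \<longrightarrow>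
        (\<exists>!\<phi>. \<phi> \<in> extensional (carrier S) \<and> \<phi> \<in> continuous_hom S T H U \<and>
              (\<forall>i<d. \<phi> (x i) = y i)))"

text \<open>As usual for profinite groups, products, powers and commutators of subgroups in the
  recursion stand for the closed subgroups they generate. The degrees are \<open>n \<ge> 1\<close>; the values for
  \<open>n = 0\<close> or \<open>p \<le> 1\<close> are dummies.\<close>

function zassenhaus :: "nat \<Rightarrow> 's monoid \<Rightarrow> 's topology \<Rightarrow> nat \<Rightarrow> 's set" where
  "zassenhaus p S T n =
     (if n \<le> 1 \<or> p \<le> 1 then carrier S
      else T closure_of (generate S
        ((\<lambda>a. a [^]\<^bsub>S\<^esub> p) ` zassenhaus p S T (nat \<lceil>real n / real p\<rceil>) \<union>
         (\<Union>i\<in>{1..<n}. \<Union>a\<in>zassenhaus p S T i. \<Union>b\<in>zassenhaus p S T (n - i).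
            {a \<otimes>\<^bsub>S\<^esub> b \<otimes>\<^bsub>S\<^esub> inv\<^bsub>S\<^esub> a \<otimes>\<^bsub>S\<^esub> inv\<^bsub>S\<^esub> b}))))"
  by pat_completeness auto
termination
proof (relation "Wellfounded.measure (\<lambda>(p, S, T, n). n)", goal_cases)
  case (2 p S T n)
  then have "real n / real p \<le> real n / 2"
    by (intro divide_left_mono) auto
  moreover have "real n / 2 \<le> real (n - 1)"
    using 2 by (simp add: of_nat_diff)
  ultimately have "real n / real p \<le> real (n - 1)"
    by (rule order_trans)
  then have "\<lceil>real n / real p\<rceil> \<le> int (n - 1)"
    by (simp only: ceiling_le_iff of_int_of_nat_eq)
  then show ?case
    using 2 by (simp; linarith)
qed auto

declare zassenhaus.simps [simp del]

definition closed_normal_closure :: "'s monoid \<Rightarrow> 's topology \<Rightarrow> 's set \<Rightarrow> 's set" where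
  "closed_normal_closure S T A = \<Inter>{N. N \<lhd> S \<and> closedin T N \<and> A \<subseteq> N}"

definition defining_relations :: "'s monoid \<Rightarrow> 's topology \<Rightarrow> 's set \<Rightarrow> 's set \<Rightarrow> bool" where
  "defining_relations S T R Rel \<longleftrightarrow>
     Rel \<subseteq> R \<and> closed_normal_closure S T Rel = R \<and>
     (\<forall>A. A \<subset> Rel \<longrightarrow> closed_normal_closure S T A \<noteq> R)"


section \<open>Rings of functions on words\<close>

text \<open>The product on functions on words that underlies both noncommutative polynomials and power
  series (words in the variables; the value is the coefficient) and the cup product of
  inhomogeneous cochains with trivial coefficients (words in the group).\<close>

definition word_times :: "('a list \<Rightarrow> 'k::comm_ring_1) \<Rightarrow> ('a list \<Rightarrow> 'k) \<Rightarrow> 'a list \<Rightarrow> 'k" where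
  "word_times f g = (\<lambda>w. \<Sum>i\<le>length w. f (take i w) * g (drop i w))"

definition word_ring :: "('a list \<Rightarrow> 'k::comm_ring_1) set \<Rightarrow> ('a list \<Rightarrow> 'k) ring" where
  "word_ring C = \<lparr>carrier = C, mult = word_times, one = (\<lambda>w. if w = [] then 1 else 0),
     ring.zero = (\<lambda>w. 0), add = (\<lambda>f g w. f w + g w)\<rparr>"

definition homogeneous :: "nat \<Rightarrow> ('a list \<Rightarrow> 'k::comm_ring_1) set" where
  "homogeneous n = {f. \<forall>w. f w \<noteq> 0 \<longrightarrow> length w = n}"

definition homogeneous_part :: "nat \<Rightarrow> ('a list \<Rightarrow> 'k::comm_ring_1) \<Rightarrow> 'a list \<Rightarrow> 'k" where
  "homogeneous_part n f = (\<lambda>w. if length w = n then f w else 0)"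

definition ncvar :: "nat \<Rightarrow> nat list \<Rightarrow> 'k::comm_ring_1" where
  "ncvar i = (\<lambda>w. if w = [i] then 1 else 0)"

definition ncseries :: "nat \<Rightarrow> (nat list \<Rightarrow> 'k::comm_ring_1) ring" where
  "ncseries d = word_ring {f. \<forall>w. f w \<noteq> 0 \<longrightarrow> set w \<subseteq> {..<d}}"

text \<open>\<open>ncpoly d\<close> is the tensor algebra of a vector space with a basis of \<open>d\<close> elements: the
  word \<open>[i\<^sub>1, \<dots>, i\<^sub>n]\<close> is the tensor product of the basis elements with these indices.\<close>

definition ncpoly :: "nat \<Rightarrow> (nat list \<Rightarrow> 'k::comm_ring_1) ring" where
  "ncpoly d = word_ring {f. finite {w. f w \<noteq> 0} \<and> (\<forall>w. f w \<noteq> 0 \<longrightarrow> set w \<subseteq> {..<d})}"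

definition ncpoly_deg :: "nat \<Rightarrow> nat \<Rightarrow> (nat list \<Rightarrow> 'k::comm_ring_1) set" where
  "ncpoly_deg d n = carrier (ncpoly d) \<inter> homogeneous n"

definition ncpoly_quot_deg ::
    "nat \<Rightarrow> (nat list \<Rightarrow> 'k::comm_ring_1) set \<Rightarrow> nat \<Rightarrow> (nat list \<Rightarrow> 'k) set set" where
  "ncpoly_quot_deg d I n = (\<lambda>f. I +>\<^bsub>ncpoly d\<^esub> f) ` ncpoly_deg d n"

text \<open>Isomorphisms of graded rings, the gradings being given by the sets of homogeneous
  elements of each degree. A (unital) ring isomorphism of \<open>F\<^sub>p\<close>-algebras is automatically
  \<open>F\<^sub>p\<close>-linear, and ideals and additive subgroups are automatically \<open>F\<^sub>p\<close>-subspaces.\<close>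

definition graded_ring_iso ::
    "'a ring \<Rightarrow> (nat \<Rightarrow> 'a set) \<Rightarrow> 'b ring \<Rightarrow> (nat \<Rightarrow> 'b set) \<Rightarrow> ('a \<Rightarrow> 'b) set" where
  "graded_ring_iso A grA B grB = {\<phi> \<in> ring_iso A B. \<forall>n. \<phi> ` grA n = grB n}"


section \<open>Continuous cohomology with trivial coefficients\<close>

text \<open>The total complex \<open>\<Oplus>\<^sub>n C\<^sup>n(G, k)\<close> of continuous inhomogeneous cochains, \<open>k\<close> being discrete. The
  component in \<open>C\<^sup>n\<close> of a cochain is its restriction to words of length \<open>n\<close>.\<close>

definition cochains :: "'g monoid \<Rightarrow> 'g topology \<Rightarrow> ('g list \<Rightarrow> 'k::comm_ring_1) set" where
  "cochains G T =
     {f. (\<forall>gs. f gs \<noteq> 0 \<longrightarrow> set gs \<subseteq> carrier G) \<and>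
         (\<exists>N. \<forall>gs. f gs \<noteq> 0 \<longrightarrow> length gs \<le> N) \<and>
         (\<forall>n. continuous_map (product_topology (\<lambda>_. T) {..<n}) (discrete_topology UNIV)
                (\<lambda>u. f (map u [0..<n])))}"

definition coboundary :: "'g monoid \<Rightarrow> ('g list \<Rightarrow> 'k::comm_ring_1) \<Rightarrow> 'g list \<Rightarrow> 'k" where
  "coboundary G f = (\<lambda>gs.
     if gs = [] \<or> \<not> set gs \<subseteq> carrier G then 0
     else f (tl gs)
       + (\<Sum>i<length gs - 1. (-1) ^ (i + 1) *
            f (take i gs @ [gs ! i \<otimes>\<^bsub>G\<^esub> gs ! (i + 1)] @ drop (i + 2) gs))
       + (-1) ^ length gs * f (butlast gs))"

definition cocycles :: "'g monoid \<Rightarrow> 'g topology \<Rightarrow> ('g list \<Rightarrow> 'k::comm_ring_1) set" where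
  "cocycles G T = {f \<in> cochains G T. coboundary G f = (\<lambda>_. 0)}"

definition coboundaries :: "'g monoid \<Rightarrow> 'g topology \<Rightarrow> ('g list \<Rightarrow> 'k::comm_ring_1) set" where
  "coboundaries G T = coboundary G ` cochains G T"

definition cohomology_ring ::
    "'g monoid \<Rightarrow> 'g topology \<Rightarrow> ('g list \<Rightarrow> 'k::comm_ring_1) set ring" where
  "cohomology_ring G T = word_ring (cocycles G T) Quot coboundaries G T"

definition cohomology_class ::
    "'g monoid \<Rightarrow> 'g topology \<Rightarrow> ('g list \<Rightarrow> 'k::comm_ring_1) \<Rightarrow> ('g list \<Rightarrow> 'k) set" where
  "cohomology_class G T f = coboundaries G T +>\<^bsub>word_ring (cocycles G T)\<^esub> f"


section \<open>Quadratic algebras and quadratic duals\<close>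

text \<open>\<open>A = T(V)/(\<Omega>)\<close>, where \<open>V\<close> is the degree 1 part of \<open>A\<close> with basis \<open>v 0, \<dots>, v (d - 1)\<close> and
  \<open>\<Omega>\<close> is a subspace of \<open>V \<otimes> V\<close>: the homomorphism from \<open>T(V)\<close> (in this basis) to \<open>A\<close> that is
  the identity on \<open>V\<close> is onto, with kernel the two-sided ideal generated by \<open>\<Omega>\<close>.\<close>

definition quadratic_presentation ::
    "'a ring \<Rightarrow> nat \<Rightarrow> (nat \<Rightarrow> 'a) \<Rightarrow> (nat list \<Rightarrow> 'p::prime_card mod_ring) set \<Rightarrow> bool" where
  "quadratic_presentation A d v \<Omega> \<longleftrightarrow>
     \<Omega> \<subseteq> ncpoly_deg d 2 \<and> additive_subgroup \<Omega> (ncpoly d) \<and>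
     (\<exists>\<phi> \<in> Ring.ring_hom (ncpoly d) A.
        (\<forall>i<d. \<phi> (ncvar i) = v i) \<and>
        \<phi> ` carrier (ncpoly d) = carrier A \<and>
        a_kernel (ncpoly d) A \<phi> = Idl\<^bsub>ncpoly d\<^esub> \<Omega>)"

text \<open>The pairing of \<open>V\<^sup>* \<otimes> V\<^sup>*\<close> with \<open>V \<otimes> V\<close>, \<open>(f \<otimes> g, u \<otimes> v) \<mapsto> - f(u) g(v)\<close>, in dual bases.\<close>

definition tensor_pairing ::
    "nat \<Rightarrow> (nat list \<Rightarrow> 'k::comm_ring_1) \<Rightarrow> (nat list \<Rightarrow> 'k) \<Rightarrow> 'k" where
  "tensor_pairing d F W = - (\<Sum>i<d. \<Sum>j<d. F [i, j] * W [i, j])"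

definition annihilator ::
    "nat \<Rightarrow> (nat list \<Rightarrow> 'k::comm_ring_1) set \<Rightarrow> (nat list \<Rightarrow> 'k) set" where
  "annihilator d \<Omega> = {F \<in> ncpoly_deg d 2. \<forall>W\<in>\<Omega>. tensor_pairing d F W = 0}"

definition quadratic_dual ::
    "nat \<Rightarrow> (nat list \<Rightarrow> 'k::comm_ring_1) set \<Rightarrow> (nat list \<Rightarrow> 'k) set ring" where
  "quadratic_dual d \<Omega> = ncpoly d Quot (Idl\<^bsub>ncpoly d\<^esub> (annihilator d \<Omega>))"

definition quadratic_dual_deg ::
    "nat \<Rightarrow> (nat list \<Rightarrow> 'k::comm_ring_1) set \<Rightarrow> nat \<Rightarrow> (nat list \<Rightarrow> 'k) set set" where
  "quadratic_dual_deg d \<Omega> = ncpoly_quot_deg d (Idl\<^bsub>ncpoly d\<^esub> (annihilator d \<Omega>))"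


section \<open>The Magnus map and initial forms\<close>

text \<open>The continuous homomorphism \<open>x i \<mapsto> 1 + X\<^sub>i\<close> from the free pro-\<open>p\<close> group to the units of the
  power series ring, whose topology is that of coefficientwise convergence.\<close>

definition magnus ::
    "'s monoid \<Rightarrow> 's topology \<Rightarrow> nat \<Rightarrow> (nat \<Rightarrow> 's) \<Rightarrow> 's \<Rightarrow> nat list \<Rightarrow> 'k::comm_ring_1" where
  "magnus S T d x = (THE \<mu>.
     \<mu> \<in> extensional (carrier S) \<and>
     \<mu> \<in> hom S (units_of (ncseries d)) \<and>
     continuous_map T (product_topology (\<lambda>_. discrete_topology UNIV) UNIV) \<mu> \<and>
     (\<forall>i<d. \<mu> (x i) = \<one>\<^bsub>ncseries d\<^esub> \<oplus>\<^bsub>ncseries d\<^esub> ncvar i))"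

text \<open>The embedding of \<open>S\<^sub>(\<^sub>n\<^sub>)/S\<^sub>(\<^sub>n\<^sub>+\<^sub>1\<^sub>)\<close>, \<open>n \<ge> 1\<close>, into the polynomials of degree \<open>n\<close>: the
  coset of \<open>r\<close> is sent to the degree \<open>n\<close> part of \<open>\<mu>(r) - 1\<close>, which depends on the coset only.\<close>

definition magnus_graded ::
    "'s monoid \<Rightarrow> 's topology \<Rightarrow> nat \<Rightarrow> (nat \<Rightarrow> 's) \<Rightarrow> nat \<Rightarrow> 's set \<Rightarrow>
     nat list \<Rightarrow> 'k::comm_ring_1" where
  "magnus_graded S T d x n C = the_elem ((\<lambda>r. homogeneous_part n (magnus S T d x r)) ` C)"

definition initial_form ::
    "'s monoid \<Rightarrow> 's topology \<Rightarrow> nat \<Rightarrow> (nat \<Rightarrow> 's) \<Rightarrow> 's \<Rightarrow>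
     nat list \<Rightarrow> 'p::prime_card mod_ring" where
  "initial_form S T d x r =
     (let n = (GREATEST n. r \<in> zassenhaus CARD('p) S T n)
      in magnus_graded S T d x n (zassenhaus CARD('p) S T (n + 1) #>\<^bsub>S\<^esub> r))"

end

theory Submission
  imports Defs
begin

text \<open>Write the Magnus map as \<open>1 + \<Sum> a\<^sub>i(s) X\<^sub>i + \<Sum> b\<^sub>i\<^sub>j(s) X\<^sub>i X\<^sub>j + \<dots>\<close>. The \<open>a\<^sub>i\<close> are the inflations of the
  \<open>\<chi>\<^sub>i\<close>, and \<open>b\<^sub>i\<^sub>j(s t) = b\<^sub>i\<^sub>j(s) + b\<^sub>i\<^sub>j(t) + a\<^sub>i(s) a\<^sub>j(t)\<close> says that \<open>- b\<^sub>i\<^sub>j\<close> bounds the inflation of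
  \<open>\<chi>\<^sub>i \<union> \<chi>\<^sub>j\<close>. Homomorphisms from \<open>S\<close> to \<open>F\<^sub>p\<close> vanish on \<open>R \<subseteq> S\<^sub>(\<^sub>2\<^sub>)\<close>; hence for \<open>W = (w\<^sub>i\<^sub>j)\<close> the cochain
  \<open>\<beta>\<^sub>W = \<Sum> w\<^sub>i\<^sub>j b\<^sub>i\<^sub>j\<close> is zero on \<open>R\<close> (and then descends to \<open>G\<close>) if and only if \<open>\<Sum> w\<^sub>i\<^sub>j \<chi>\<^sub>i \<union> \<chi>\<^sub>j\<close> is a coboundary
  on \<open>G\<close>, that is \<open>W \<in> \<Omega>\<close>. Double annihilators over \<open>F\<^sub>p\<close> give \<open>\<Omega>\<^sup>\<bottom>\<close>.

  For the presentation of the dual, a defining relation \<open>r\<close> must not lie in \<open>S\<^sub>(\<^sub>3\<^sub>)\<close>. Minimality yields a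
  nonzero \<open>S\<close>-invariant continuous \<open>f : R \<rightarrow> F\<^sub>p\<close> that vanishes on all other relations. Its
  transgression is a class of degree 2 of \<open>G\<close>, hence a sum of cup products since the cohomology
  is quadratic; so \<open>f\<close> is some \<open>\<beta>\<^sub>W\<close> on \<open>R\<close> and would vanish at \<open>r \<in> S\<^sub>(\<^sub>3\<^sub>)\<close> as well.\<close>

section \<open>Maps to discrete spaces and topological groups\<close>

text \<open>The overview pushes functions on \<open>S\<close> down to cochains on \<open>G\<close>,
  and continuity is the obstacle there. No continuous section of \<open>\<pi>\<close> is
  constructed: a continuous surjection from a compact space to a Hausdorff space is a quotient map,
  so a function on \<open>G\<close> is continuous as soon as its pullback to \<open>S\<close> is.
  The Magnus map is specified with values in all units, a group that is in general not
  pro-\<open>p\<close>. The universal property is applied to the series with constant coefficient 1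
  instead, coded into the type of the test groups. Double annihilators need neither dual spaces nor
  dimensions: an additive subgroup over a prime field is a subspace, so it suffices to separate a
  vector from an additive subgroup by elimination in coordinates. The function \<open>f\<close> that
  minimality provides comes from a finite quotient: the closed normal closure of the other relations
  is smaller than \<open>R\<close>, some finite \<open>p\<close>-group quotient of \<open>S\<close>
  sees the difference, and there a nontrivial normal subgroup meets the centre. The two ideals of
  the second claim turn out to be equal, so the isomorphism is the identity.\<close>

abbreviation discrete :: "'a topology" where
  "discrete \<equiv> discrete_topology UNIV"

lemma continuous_map_discrete_iff:
  "continuous_map T discrete f \<longleftrightarrow> (\<forall>v. openin T {a \<in> topspace T. f a = v})"
proof
  assume "continuous_map T discrete f"
  then show "\<forall>v. openin T {a \<in> topspace T. f a = v}"
    using openin_continuous_map_preimage[of T discrete f "{v}" for v] by auto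
next
  assume *: "\<forall>v. openin T {a \<in> topspace T. f a = v}"
  have "openin T {a \<in> topspace T. f a \<in> V}" for V
  proof -
    have "{a \<in> topspace T. f a \<in> V} = (\<Union>v\<in>V. {a \<in> topspace T. f a = v})" by auto
    then show ?thesis using * by auto
  qed
  then show "continuous_map T discrete f" by (simp add: continuous_map_def)
qed

lemma continuous_map_discrete_local:
  assumes "\<And>a. a \<in> topspace T \<Longrightarrow> \<exists>U. openin T U \<and> a \<in> U \<and> (\<forall>b\<in>U. f b = f a)"
  shows "continuous_map T discrete f"
  unfolding continuous_map_discrete_iff
proof
  fix v
  show "openin T {a \<in> topspace T. f a = v}"
  proof (subst openin_subopen, clarify)
    fix a assume "a \<in> topspace T"
    then obtain U where "openin T U" "a \<in> U" "\<forall>b\<in>U. f b = f a" using assms by blast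
    then show "\<exists>U. openin T U \<and> a \<in> U \<and> U \<subseteq> {b \<in> topspace T. f b = f a}"
      using openin_subset by blast
  qed
qed

lemma continuous_map_discrete_binop:
  assumes "continuous_map T discrete f" "continuous_map T discrete g"
  shows "continuous_map T discrete (\<lambda>a. h (f a) (g a))"
proof (rule continuous_map_discrete_local)
  fix a assume a: "a \<in> topspace T"
  let ?U = "{b \<in> topspace T. f b = f a} \<inter> {b \<in> topspace T. g b = g a}"
  have "openin T ?U"
    using assms unfolding continuous_map_discrete_iff by blast
  then show "\<exists>U. openin T U \<and> a \<in> U \<and> (\<forall>b\<in>U. h (f b) (g b) = h (f a) (g a))"
    using a by (intro exI[of _ ?U]) auto
qed

lemma continuous_map_discrete_op:
  assumes "continuous_map T discrete f"
  shows "continuous_map T discrete (\<lambda>a. h (f a))"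
  using continuous_map_discrete_binop[OF assms assms, of "\<lambda>u _. h u"] .

lemma continuous_map_discrete_sum:
  fixes f :: "'i \<Rightarrow> 'a \<Rightarrow> 'b::comm_monoid_add"
  assumes "\<And>i. i \<in> A \<Longrightarrow> continuous_map T discrete (f i)"
  shows "continuous_map T discrete (\<lambda>a. \<Sum>i\<in>A. f i a)"
  using assms
proof (induction A rule: infinite_finite_induct)
  case (insert i A)
  have "continuous_map T discrete (\<lambda>a. f i a + (\<Sum>i\<in>A. f i a))"
    by (rule continuous_map_discrete_binop) (use insert in auto)
  then show ?case using insert.hyps by simp
qed auto

lemma closedin_discrete_vimage:
  assumes "continuous_map T discrete f"
  shows "closedin T {a \<in> topspace T. f a \<in> V}"
  using closedin_continuous_map_preimage[OF assms, of V] by simp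

lemma topological_groupD:
  assumes "topological_group G T"
  shows "group G" "topspace T = carrier G"
    "continuous_map (prod_topology T T) T (\<lambda>(a, b). a \<otimes>\<^bsub>G\<^esub> b)"
    "continuous_map T T (\<lambda>a. inv\<^bsub>G\<^esub> a)"
  using assms by (auto simp: topological_group_def)

lemma continuous_map_left_translation:
  assumes "topological_group G T" "c \<in> carrier G"
  shows "continuous_map T T (\<lambda>a. c \<otimes>\<^bsub>G\<^esub> a)"
proof -
  have "continuous_map T (prod_topology T T) (\<lambda>a. (c, a))"
    using assms by (simp add: continuous_map_pairwise o_def topological_groupD)
  from continuous_map_compose[OF this topological_groupD(3)[OF assms(1)]]
  show ?thesis by (simp add: o_def)
qed

lemma continuous_map_right_translation:
  assumes "topological_group G T" "c \<in> carrier G"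
  shows "continuous_map T T (\<lambda>a. a \<otimes>\<^bsub>G\<^esub> c)"
proof -
  have "continuous_map T (prod_topology T T) (\<lambda>a. (a, c))"
    using assms by (simp add: continuous_map_pairwise o_def topological_groupD)
  from continuous_map_compose[OF this topological_groupD(3)[OF assms(1)]]
  show ?thesis by (simp add: o_def)
qed

lemma openin_left_translate:
  assumes "topological_group G T" "c \<in> carrier G" "openin T U"
  shows "openin T {a \<in> carrier G. c \<otimes>\<^bsub>G\<^esub> a \<in> U}"
  using openin_continuous_map_preimage[OF continuous_map_left_translation[OF assms(1,2)] assms(3)]
    topological_groupD(2)[OF assms(1)] by simp

lemma pro_p_groupD:
  assumes "pro_p_group p G T"
  shows "topological_group G T" "compact_space T" "Hausdorff_space T"
    "group G" "topspace T = carrier G"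
  using assms by (auto simp: pro_p_group_def topological_group_def)

lemma pro_p_group_nhd:
  assumes "pro_p_group p G T" "openin T U" "\<one>\<^bsub>G\<^esub> \<in> U"
  obtains N k where "N \<lhd> G" "openin T N" "N \<subseteq> U" "order (G Mod N) = p ^ k"
  using assms unfolding pro_p_group_def by metis

lemma (in group) quotient_pow_card_mem:
  assumes "N \<lhd> G" "a \<in> carrier G" "order (G Mod N) = n"
  shows "a [^] n \<in> N"
proof -
  interpret N: normal N G by fact
  interpret Q: group "G Mod N" by (rule N.factorgroup_is_group)
  have "(N #> a) [^]\<^bsub>G Mod N\<^esub> order (G Mod N) = \<one>\<^bsub>G Mod N\<^esub>"
    by (rule Q.pow_order_eq_1) (use assms in \<open>auto simp: FactGroup_def RCOSETS_def\<close>)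
  then have "N #> (a [^] n) = N"
    using N.FactGroup_pow[OF assms(2), of n] assms(3) by simp
  then show ?thesis
    using assms(2) N.subgroup_axioms coset_join1 nat_pow_closed by blast
qed

section \<open>Rings of functions on words\<close>

lemma word_times_Nil [simp]: "word_times f g [] = f [] * g []"
  by (simp add: word_times_def)

text \<open>Splitting off the first letter turns the convolution into a recursion on the word in
  which the left factor is replaced by a shift of itself. This is why inductions with this rule
  generalise over the left factor.\<close>

lemma word_times_Cons:
  "word_times f g (a # w) = f [] * g (a # w) + word_times (\<lambda>u. f (a # u)) g w"
  by (simp add: word_times_def sum.atMost_Suc_shift del: sum.atMost_Suc)

lemma word_times_add_left: "word_times (\<lambda>w. f w + g w) h = (\<lambda>w. word_times f h w + word_times g h w)"
  by (simp add: word_times_def distrib_right sum.distrib)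

lemma word_times_add_right: "word_times h (\<lambda>w. f w + g w) = (\<lambda>w. word_times h f w + word_times h g w)"
  by (simp add: word_times_def distrib_left sum.distrib)

lemma word_times_scale_left: "word_times (\<lambda>w. c * f w) h = (\<lambda>w. c * word_times f h w)"
  by (simp add: word_times_def sum_distrib_left mult.assoc)

lemma word_times_assoc:
  "word_times (word_times f g) h = word_times f (word_times g h)"
proof
  fix w
  show "word_times (word_times f g) h w = word_times f (word_times g h) w"
    by (induction w arbitrary: f)
      (simp_all add: word_times_Cons word_times_add_left word_times_scale_left algebra_simps)
qed

lemma word_times_one_left [simp]: "word_times (\<lambda>w. if w = [] then 1 else 0) f = f"
proof
  fix w show "word_times (\<lambda>w. if w = [] then 1 else 0) f w = f w"
  proof (cases w)
    case (Cons a u)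
    then show ?thesis by (simp add: word_times_Cons) (simp add: word_times_def)
  qed simp
qed

lemma word_times_one_right [simp]: "word_times f (\<lambda>w. if w = [] then 1 else 0) = f"
proof
  fix w show "word_times f (\<lambda>w. if w = [] then 1 else 0) w = f w"
    by (induction w arbitrary: f) (simp_all add: word_times_Cons)
qed

lemma word_times_nonzeroE:
  assumes "word_times f g w \<noteq> 0"
  obtains u v where "w = u @ v" "f u \<noteq> 0" "g v \<noteq> 0"
proof -
  have "\<exists>i\<le>length w. f (take i w) * g (drop i w) \<noteq> 0"
    using assms unfolding word_times_def by (metis (mono_tags, lifting) atMost_iff sum.neutral)
  then obtain i where "f (take i w) * g (drop i w) \<noteq> 0" by blast
  then have "f (take i w) \<noteq> 0" "g (drop i w) \<noteq> 0" by (metis mult_not_zero)+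
  then show ?thesis using that[of "take i w" "drop i w"] by simp
qed

lemma word_ring_simps [simp]:
  "carrier (word_ring C) = C" "x \<otimes>\<^bsub>word_ring C\<^esub> y = word_times x y"
  "\<one>\<^bsub>word_ring C\<^esub> = (\<lambda>w. if w = [] then 1 else 0)"
  "\<zero>\<^bsub>word_ring C\<^esub> = (\<lambda>w. 0)" "x \<oplus>\<^bsub>word_ring C\<^esub> y = (\<lambda>w. x w + y w)"
  by (simp_all add: word_ring_def)

lemma ring_word_ring:
  assumes one: "(\<lambda>w. if w = [] then 1 else 0) \<in> C" and zero: "(\<lambda>w. 0) \<in> C"
    and times: "\<And>f g. f \<in> C \<Longrightarrow> g \<in> C \<Longrightarrow> word_times f g \<in> C"
    and add: "\<And>f g. f \<in> C \<Longrightarrow> g \<in> C \<Longrightarrow> (\<lambda>w. f w + g w) \<in> C"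
    and uminus: "\<And>f. f \<in> C \<Longrightarrow> (\<lambda>w. - f w) \<in> C"
  shows "ring (word_ring C)"
proof (rule ringI)
  show "abelian_group (word_ring C)"
  proof (rule abelian_groupI)
    fix f assume "f \<in> carrier (word_ring C)"
    then show "\<exists>g\<in>carrier (word_ring C). g \<oplus>\<^bsub>word_ring C\<^esub> f = \<zero>\<^bsub>word_ring C\<^esub>"
      using uminus by (intro bexI[of _ "\<lambda>w. - f w"]) auto
  qed (auto simp: zero add add_ac)
  show "Group.monoid (word_ring C)"
    by (rule monoidI) (auto simp: one times word_times_assoc)
qed (auto simp: word_times_add_left word_times_add_right)

lemma ncpoly_simps [simp]:
  "carrier (ncpoly d) = {f. finite {w. f w \<noteq> 0} \<and> (\<forall>w. f w \<noteq> 0 \<longrightarrow> set w \<subseteq> {..<d})}"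
  "x \<otimes>\<^bsub>ncpoly d\<^esub> y = word_times x y" "\<one>\<^bsub>ncpoly d\<^esub> = (\<lambda>w. if w = [] then 1 else 0)"
  "\<zero>\<^bsub>ncpoly d\<^esub> = (\<lambda>w. 0)" "x \<oplus>\<^bsub>ncpoly d\<^esub> y = (\<lambda>w. x w + y w)"
  by (simp_all add: ncpoly_def)

lemma ring_ncpoly: "ring (ncpoly d)"
  unfolding ncpoly_def
proof (rule ring_word_ring)
  fix f g :: "nat list \<Rightarrow> 'a"
  let ?C = "{f. finite {w. f w \<noteq> 0} \<and> (\<forall>w. f w \<noteq> 0 \<longrightarrow> set w \<subseteq> {..<d})}"
  assume f: "f \<in> ?C" and g: "g \<in> ?C"
  have "{w. word_times f g w \<noteq> 0} \<subseteq> (\<lambda>(u, v). u @ v) ` ({w. f w \<noteq> 0} \<times> {w. g w \<noteq> 0})"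
    by (auto elim!: word_times_nonzeroE)
  moreover have "finite \<dots>" using f g by blast
  ultimately have "finite {w. word_times f g w \<noteq> 0}" by (rule finite_subset)
  moreover have "set w \<subseteq> {..<d}" if "word_times f g w \<noteq> 0" for w
  proof -
    obtain u v where "w = u @ v" "f u \<noteq> 0" "g v \<noteq> 0" by (rule word_times_nonzeroE[OF \<open>word_times f g w \<noteq> 0\<close>])
    then show ?thesis using f g by auto
  qed
  ultimately show "word_times f g \<in> ?C" by auto
  have "{w. f w + g w \<noteq> 0} \<subseteq> {w. f w \<noteq> 0} \<union> {w. g w \<noteq> 0}" by auto
  moreover have "finite \<dots>" using f g by simp
  ultimately have "finite {w. f w + g w \<noteq> 0}" by (rule finite_subset)
  moreover have "set w \<subseteq> {..<d}" if "f w + g w \<noteq> 0" for w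
    using f g that by (cases "f w = 0") auto
  ultimately show "(\<lambda>w. f w + g w) \<in> ?C" by simp
qed auto

lemma ncseries_simps [simp]:
  "carrier (ncseries d) = {f. \<forall>w. f w \<noteq> 0 \<longrightarrow> set w \<subseteq> {..<d}}"
  "x \<otimes>\<^bsub>ncseries d\<^esub> y = word_times x y" "\<one>\<^bsub>ncseries d\<^esub> = (\<lambda>w. if w = [] then 1 else 0)"
  "\<zero>\<^bsub>ncseries d\<^esub> = (\<lambda>w. 0)" "x \<oplus>\<^bsub>ncseries d\<^esub> y = (\<lambda>w. x w + y w)"
  by (simp_all add: ncseries_def)

lemma ring_ncseries: "ring (ncseries d)"
  unfolding ncseries_def
proof (rule ring_word_ring)
  fix f g :: "nat list \<Rightarrow> 'a"
  let ?C = "{f. \<forall>w. f w \<noteq> 0 \<longrightarrow> set w \<subseteq> {..<d}}"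
  assume f: "f \<in> ?C" and g: "g \<in> ?C"
  have "set w \<subseteq> {..<d}" if "word_times f g w \<noteq> 0" for w
  proof -
    obtain u v where "w = u @ v" "f u \<noteq> 0" "g v \<noteq> 0" by (rule word_times_nonzeroE[OF \<open>word_times f g w \<noteq> 0\<close>])
    then show ?thesis using f g by auto
  qed
  then show "word_times f g \<in> ?C" by auto
  have "set w \<subseteq> {..<d}" if "f w + g w \<noteq> 0" for w
    using f g that by (cases "f w = 0") auto
  then show "(\<lambda>w. f w + g w) \<in> ?C" by simp
qed auto

text \<open>Solves \<open>word_times f g = 1\<close> for the coefficient of \<open>g\<close> at
  \<open>a # w\<close>, given the coefficients at shorter words. The constant coefficient of
  \<open>f\<close> is taken to be 1 rather than read off.\<close>

function nc_inverse :: "('a list \<Rightarrow> 'k::comm_ring_1) \<Rightarrow> 'a list \<Rightarrow> 'k" where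
  "nc_inverse f [] = 1"
| "nc_inverse f (a # w) = - (\<Sum>i\<le>length w. f (a # take i w) * nc_inverse f (drop i w))"
  by pat_completeness auto
termination by (relation "Wellfounded.measure (\<lambda>(f, w). length w)") auto

lemma word_times_nc_inverse:
  assumes "f [] = 1"
  shows "word_times f (nc_inverse f) = (\<lambda>w. if w = [] then 1 else 0)"
proof
  fix w show "word_times f (nc_inverse f) w = (if w = [] then 1 else 0)"
    using assms by (cases w) (simp_all add: word_times_Cons, simp add: word_times_def)
qed

lemma nc_inverse_support:
  assumes "\<And>w. f w \<noteq> 0 \<Longrightarrow> set w \<subseteq> A" "nc_inverse f w \<noteq> 0"
  shows "set w \<subseteq> A"
  using assms(2)
proof (induction "length w" arbitrary: w rule: less_induct)
  case less
  show ?case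
  proof (cases w)
    case (Cons a u)
    then have "\<exists>i\<le>length u. f (a # take i u) * nc_inverse f (drop i u) \<noteq> 0"
      using less.prems by (auto simp: sum_nonneg intro: ccontr)
    then obtain i where i: "f (a # take i u) \<noteq> 0" "nc_inverse f (drop i u) \<noteq> 0"
      by (metis mult_not_zero)
    have "set (drop i u) \<subseteq> A" using less.hyps[OF _ i(2)] Cons by simp
    moreover have "set (a # take i u) \<subseteq> A" using assms(1) i(1) by blast
    ultimately show ?thesis using Cons
      by (metis append_take_drop_id insert_subset list.simps(15) set_append Un_subset_iff)
  qed simp
qed

text \<open>The constant coefficient maps the units of the series ring onto the units of
  \<open>F_p\<close>, so the full unit group is in general not pro-\<open>p\<close>. This kernel is
  pro-\<open>p\<close>, which makes it an admissible target for the universal property of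
  \<open>S\<close>.\<close>

definition magnus_group :: "nat \<Rightarrow> (nat list \<Rightarrow> 'k::comm_ring_1) monoid" where
  "magnus_group d = \<lparr>carrier = {f \<in> carrier (ncseries d). f [] = 1}, mult = word_times,
     one = (\<lambda>w. if w = [] then 1 else 0)\<rparr>"

lemma magnus_group_simps [simp]:
  "carrier (magnus_group d) = {f. (\<forall>w. f w \<noteq> 0 \<longrightarrow> set w \<subseteq> {..<d}) \<and> f [] = 1}"
  "x \<otimes>\<^bsub>magnus_group d\<^esub> y = word_times x y"
  "\<one>\<^bsub>magnus_group d\<^esub> = (\<lambda>w. if w = [] then 1 else 0)"
  by (simp_all add: magnus_group_def)

lemma nc_inverse_magnus_group:
  assumes "f \<in> carrier (magnus_group d)"
  shows "nc_inverse f \<in> carrier (magnus_group d)"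
  using assms nc_inverse_support[of f "{..<d}"] by auto

lemma group_magnus_group: "group (magnus_group d :: (nat list \<Rightarrow> 'k::comm_ring_1) monoid)"
proof (rule groupI)
  let ?M = "magnus_group d :: (nat list \<Rightarrow> 'k) monoid"
  interpret N: ring "ncseries d :: (nat list \<Rightarrow> 'k) ring" by (rule ring_ncseries)
  fix f g :: "nat list \<Rightarrow> 'k"
  assume f: "f \<in> carrier ?M"
  \<comment> \<open>\<open>nc_inverse\<close> yields right inverses, whereas \<open>groupI\<close>
    asks for left ones. The right inverse of \<open>?g\<close> equals \<open>f\<close> by
    associativity, so \<open>f\<close> and \<open>?g\<close> are inverse on both sides.\<close>
  let ?g = "nc_inverse f"
  have g: "?g \<in> carrier ?M" by (rule nc_inverse_magnus_group[OF f])
  have "word_times f ?g = \<one>\<^bsub>?M\<^esub>" using f by (simp add: word_times_nc_inverse)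
  moreover have "word_times ?g (nc_inverse ?g) = \<one>\<^bsub>?M\<^esub>" using g by (simp add: word_times_nc_inverse)
  ultimately have "nc_inverse ?g = word_times (word_times f ?g) (nc_inverse ?g)"
      "f = word_times f (word_times ?g (nc_inverse ?g))" by simp_all
  then have "nc_inverse ?g = f" by (simp only: word_times_assoc)
  then have "?g \<otimes>\<^bsub>?M\<^esub> f = \<one>\<^bsub>?M\<^esub>"
    using \<open>word_times ?g (nc_inverse ?g) = \<one>\<^bsub>?M\<^esub>\<close> by simp
  then show "\<exists>h\<in>carrier ?M. h \<otimes>\<^bsub>?M\<^esub> f = \<one>\<^bsub>?M\<^esub>" using g by blast
  assume g: "g \<in> carrier ?M"
  show "f \<otimes>\<^bsub>?M\<^esub> g \<in> carrier ?M"
    using f g N.m_closed[of f g] by simp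
qed (simp_all add: word_times_assoc)

lemma inv_magnus_group:
  assumes "f \<in> carrier (magnus_group d)"
  shows "inv\<^bsub>magnus_group d\<^esub> f = nc_inverse f"
proof -
  interpret group "magnus_group d" by (rule group_magnus_group)
  show ?thesis
    using assms nc_inverse_magnus_group[OF assms] word_times_nc_inverse[of f]
    by (intro inv_equality[OF inv_comm]) simp_all
qed

section \<open>The universal property and the Magnus group\<close>

definition transport_monoid :: "('a \<Rightarrow> 'b) \<Rightarrow> 'a monoid \<Rightarrow> 'b monoid" where
  "transport_monoid e H = \<lparr>carrier = e ` carrier H,
     mult = (\<lambda>a b. e (inv_into (carrier H) e a \<otimes>\<^bsub>H\<^esub> inv_into (carrier H) e b)), one = e \<one>\<^bsub>H\<^esub>\<rparr>"

definition transport_topology :: "('a \<Rightarrow> 'b) \<Rightarrow> 'a monoid \<Rightarrow> 'a topology \<Rightarrow> 'b topology" where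
  "transport_topology e H T = pullback_topology (e ` carrier H) (inv_into (carrier H) e) T"

lemma transport_monoid_simps [simp]:
  "carrier (transport_monoid e H) = e ` carrier H"
  "\<one>\<^bsub>transport_monoid e H\<^esub> = e \<one>\<^bsub>H\<^esub>"
  by (simp_all add: transport_monoid_def)

lemma transport_monoid_mult [simp]:
  assumes "inj_on e (carrier H)" "a \<in> carrier H" "b \<in> carrier H"
  shows "e a \<otimes>\<^bsub>transport_monoid e H\<^esub> e b = e (a \<otimes>\<^bsub>H\<^esub> b)"
  using assms by (simp add: transport_monoid_def)

lemma iso_transport_monoid:
  assumes "inj_on e (carrier H)"
  shows "e \<in> iso H (transport_monoid e H)"
  using assms by (auto simp: iso_def hom_def bij_betw_def)

lemma group_transport_monoid:
  assumes "group H" "inj_on e (carrier H)"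
  shows "group (transport_monoid e H)"
proof -
  interpret group H by fact
  show ?thesis
  proof (rule groupI)
    fix a assume "a \<in> carrier (transport_monoid e H)"
    then obtain a' where "a' \<in> carrier H" "a = e a'" by auto
    then show "\<exists>b\<in>carrier (transport_monoid e H).
        b \<otimes>\<^bsub>transport_monoid e H\<^esub> a = \<one>\<^bsub>transport_monoid e H\<^esub>"
      using assms(2) by (intro bexI[of _ "e (inv\<^bsub>H\<^esub> a')"]) auto
  qed (use assms(2) in \<open>auto simp: m_assoc\<close>)
qed

lemma homeomorphic_maps_transport:
  assumes H: "topspace T = carrier H" "inj_on e (carrier H)"
  shows "homeomorphic_maps T (transport_topology e H T) e (inv_into (carrier H) e)"
  unfolding homeomorphic_maps_def
proof (intro conjI ballI)
  let ?i = "inv_into (carrier H) e" and ?U = "transport_topology e H T"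
  have ts: "topspace ?U = e ` carrier H"
    unfolding transport_topology_def topspace_pullback_topology using H by auto
  have "continuous_map ?U T (id \<circ> ?i)"
    unfolding transport_topology_def by (rule continuous_map_pullback) simp
  then show "continuous_map ?U T ?i" by simp
  have "continuous_map T T (?i \<circ> e)"
    by (rule continuous_map_eq[OF continuous_map_id]) (use H in auto)
  then show "continuous_map T ?U e"
    unfolding transport_topology_def
    by (rule continuous_map_pullback') (use H in auto)
  show "?i (e a) = a" if "a \<in> topspace T" for a using that H by simp
  show "e (?i b) = b" if "b \<in> topspace ?U" for b using that ts by (auto intro: f_inv_into_f)
qed

lemma pro_p_group_transport:
  assumes H: "pro_p_group p H T" and e: "inj_on e (carrier H)"
  shows "pro_p_group p (transport_monoid e H) (transport_topology e H T)"
proof -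
  let ?H = "transport_monoid e H" and ?U = "transport_topology e H T"
    and ?i = "inv_into (carrier H) e"
  note HD = pro_p_groupD[OF H]
  interpret H: group H by (rule HD)
  interpret H': group ?H by (rule group_transport_monoid[OF HD(4) e])
  have hm: "homeomorphic_maps T ?U e ?i" by (rule homeomorphic_maps_transport[OF HD(5) e])
  then have ce: "continuous_map T ?U e" and ci: "continuous_map ?U T ?i"
    by (auto simp: homeomorphic_maps_def)
  have hs: "T homeomorphic_space ?U" using hm by (auto simp: homeomorphic_space_def)
  have ts: "topspace ?U = e ` carrier H"
    using homeomorphic_imp_surjective_map[OF homeomorphic_maps_imp_map[OF hm]] HD(5) by simp
  have "continuous_map (prod_topology ?U ?U) (prod_topology T T) (\<lambda>(a, b). (?i a, ?i b))"
    by (simp add: continuous_map_prod_top ci)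
  from continuous_map_compose[OF continuous_map_compose[OF this topological_groupD(3)[OF HD(1)]] ce]
  have 1: "continuous_map (prod_topology ?U ?U) ?U (\<lambda>(a, b). a \<otimes>\<^bsub>?H\<^esub> b)"
    by (simp add: o_def case_prod_unfold transport_monoid_def)
  have inv_e: "inv\<^bsub>?H\<^esub> (e a) = e (inv\<^bsub>H\<^esub> a)" if "a \<in> carrier H" for a
    using that e by (intro H'.inv_equality) auto
  from continuous_map_compose[OF continuous_map_compose[OF ci topological_groupD(4)[OF HD(1)]] ce]
  have "continuous_map ?U ?U (\<lambda>a. e (inv\<^bsub>H\<^esub> (?i a)))" by (simp add: o_def)
  then have 2: "continuous_map ?U ?U (\<lambda>a. inv\<^bsub>?H\<^esub> a)"
    by (rule continuous_map_eq) (use e in \<open>auto simp: ts inv_e\<close>)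
  have 3: "\<exists>N k. N \<lhd> ?H \<and> openin ?U N \<and> N \<subseteq> V \<and> order (?H Mod N) = p ^ k"
    if V: "openin ?U V" "\<one>\<^bsub>?H\<^esub> \<in> V" for V
  proof -
    have A: "openin T {a \<in> topspace T. e a \<in> V}"
      using ce V(1) by (rule openin_continuous_map_preimage)
    have B: "\<one>\<^bsub>H\<^esub> \<in> {a \<in> topspace T. e a \<in> V}" using V(2) HD(5) by simp
    obtain N k where N: "N \<lhd> H" "openin T N" "N \<subseteq> {a \<in> topspace T. e a \<in> V}"
        "order (H Mod N) = p ^ k"
      by (rule pro_p_group_nhd[OF H A B])
    have Nc: "N \<subseteq> carrier H" using N(1) normal_imp_subgroup subgroup.subset by blast
    have "e ` N \<lhd> ?H"
      using iso_normal_subgroup[OF iso_transport_monoid[OF e] HD(4) H'.group_axioms N(1)] .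
    moreover have "openin ?U (e ` N)"
      using homeomorphic_imp_open_map[OF homeomorphic_maps_imp_map[OF hm]] N(2) by (simp add: open_map_def)
    moreover have "e ` N \<subseteq> V" using N(3) by auto
    moreover have "order (?H Mod e ` N) = order (H Mod N)"
    proof -
      have "e ` N #>\<^bsub>?H\<^esub> e a = e ` (N #>\<^bsub>H\<^esub> a)" if "a \<in> carrier H" for a
        using that e Nc by (force simp: r_coset_def)
      then have "rcosets\<^bsub>?H\<^esub> (e ` N) = (\<lambda>C. e ` C) ` (rcosets\<^bsub>H\<^esub> N)"
        by (auto simp: RCOSETS_def)
      moreover have "inj_on (\<lambda>C. e ` C) (rcosets\<^bsub>H\<^esub> N)"
        using e H.rcosets_part_G[OF normal_imp_subgroup[OF N(1)]]
        by (intro inj_on_image) simp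
      ultimately show ?thesis by (simp add: order_def FactGroup_def card_image)
    qed
    ultimately show ?thesis using N(4) by metis
  qed
  show ?thesis
    unfolding pro_p_group_def topological_group_def
    using 1 2 3 H'.group_axioms ts HD homeomorphic_compact_space[OF hs] homeomorphic_Hausdorff_space[OF hs]
    by simp
qed

lemma free_pro_p_groupD:
  assumes "free_pro_p_group p S T d x"
  shows "pro_p_group p S T" "\<And>i. i < d \<Longrightarrow> x i \<in> carrier S"
  using assms by (auto simp: free_pro_p_group_def)

text \<open>Frees the universal property from the type \<open>nat \<Rightarrow> nat\<close>: a test
  group of any type whose elements inject into it may be used. Homomorphisms correspond by
  composition with \<open>e\<close> and its inverse; restricting to the carrier of \<open>S\<close>
  keeps them extensional, so that uniqueness is carried over too.\<close>

lemma free_pro_p_group_ex1: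
  fixes e :: "'h \<Rightarrow> nat \<Rightarrow> nat"
  assumes S: "free_pro_p_group p S T d x" and H: "pro_p_group p H U"
    and e: "inj_on e (carrier H)" and y: "\<And>i. i < d \<Longrightarrow> y i \<in> carrier H"
  shows "\<exists>!\<phi>. \<phi> \<in> extensional (carrier S) \<and> \<phi> \<in> continuous_hom S T H U \<and> (\<forall>i<d. \<phi> (x i) = y i)"
proof -
  let ?H = "transport_monoid e H" and ?U = "transport_topology e H U"
    and ?i = "inv_into (carrier H) e"
  note HD = pro_p_groupD[OF H] and SD = free_pro_p_groupD[OF S]
  interpret H: group H by (rule HD)
  interpret S: group S by (rule pro_p_groupD[OF SD(1)])
  have ts: "topspace T = carrier S" by (rule pro_p_groupD[OF SD(1)])
  have hm: "homeomorphic_maps U ?U e ?i" by (rule homeomorphic_maps_transport[OF HD(5) e])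
  then have ce: "continuous_map U ?U e" and ci: "continuous_map ?U U ?i"
    by (auto simp: homeomorphic_maps_def)
  have H': "pro_p_group p ?H ?U" by (rule pro_p_group_transport[OF H e])
  have y': "\<forall>i<d. e (y i) \<in> carrier ?H" using y by simp
  let ?P = "\<lambda>\<phi>. \<phi> \<in> extensional (carrier S) \<and> \<phi> \<in> continuous_hom S T ?H ?U \<and> (\<forall>i<d. \<phi> (x i) = e (y i))"
  have ex: "\<exists>!\<phi>. ?P \<phi>"
  proof -
    have "\<forall>(H :: (nat \<Rightarrow> nat) monoid) U y.
        pro_p_group p H U \<and> (\<forall>i<d. y i \<in> carrier H) \<longrightarrow>
        (\<exists>!\<phi>. \<phi> \<in> extensional (carrier S) \<and> \<phi> \<in> continuous_hom S T H U \<and>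
              (\<forall>i<d. \<phi> (x i) = y i))"
      using S unfolding free_pro_p_group_def by (elim conjE)
    from mp[OF spec[OF spec[OF spec[OF this]]] conjI[OF H' y']] show ?thesis .
  qed
  have toP: "?P (restrict (e \<circ> \<phi>) (carrier S))"
    if "\<phi> \<in> extensional (carrier S)" "\<phi> \<in> continuous_hom S T H U" "\<forall>i<d. \<phi> (x i) = y i" for \<phi>
  proof -
    have h: "\<phi> \<in> hom S H" and c: "continuous_map T U \<phi>" using that(2) by (auto simp: continuous_hom_def)
    have "restrict (e \<circ> \<phi>) (carrier S) \<in> hom S ?H"
      using h e by (auto simp: hom_def Pi_iff)
    moreover have "continuous_map T ?U (restrict (e \<circ> \<phi>) (carrier S))"
      by (rule continuous_map_eq[OF continuous_map_compose[OF c ce]]) (simp add: ts)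
    ultimately show ?thesis using that(3) SD(2) by (simp add: continuous_hom_def)
  qed
  obtain \<phi> where \<phi>: "?P \<phi>" using ex by blast
  have h: "\<phi> \<in> hom S ?H" and c: "continuous_map T ?U \<phi>" using \<phi> by (auto simp: continuous_hom_def)
  have im: "\<phi> a \<in> e ` carrier H" if "a \<in> carrier S" for a using h that by (auto simp: hom_def)
  let ?\<psi> = "restrict (?i \<circ> \<phi>) (carrier S)"
  have "?\<psi> \<in> hom S H"
  proof (rule homI)
    fix a assume "a \<in> carrier S"
    then show "?\<psi> a \<in> carrier H" using im by (simp add: inv_into_into)
  next
    fix a b assume ab: "a \<in> carrier S" "b \<in> carrier S"
    obtain a' b' where a': "a' \<in> carrier H" "\<phi> a = e a'" and b': "b' \<in> carrier H" "\<phi> b = e b'"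
      using im ab by blast
    have "\<phi> (a \<otimes>\<^bsub>S\<^esub> b) = e (a' \<otimes>\<^bsub>H\<^esub> b')" using h ab a' b' e by (simp add: hom_mult)
    then show "?\<psi> (a \<otimes>\<^bsub>S\<^esub> b) = ?\<psi> a \<otimes>\<^bsub>H\<^esub> ?\<psi> b"
      using ab a' b' e by simp
  qed
  moreover have "continuous_map T U ?\<psi>"
    by (rule continuous_map_eq[OF continuous_map_compose[OF c ci]]) (simp add: ts)
  moreover have "?\<psi> (x i) = y i" if "i < d" for i
    using \<phi> that SD(2) e y by simp
  ultimately have "\<exists>\<phi>. \<phi> \<in> extensional (carrier S) \<and> \<phi> \<in> continuous_hom S T H U \<and> (\<forall>i<d. \<phi> (x i) = y i)"
    by (intro exI[of _ ?\<psi>]) (auto simp: continuous_hom_def)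
  moreover have "\<phi>1 = \<phi>2"
    if \<phi>1: "\<phi>1 \<in> extensional (carrier S) \<and> \<phi>1 \<in> continuous_hom S T H U \<and> (\<forall>i<d. \<phi>1 (x i) = y i)"
      and \<phi>2: "\<phi>2 \<in> extensional (carrier S) \<and> \<phi>2 \<in> continuous_hom S T H U \<and> (\<forall>i<d. \<phi>2 (x i) = y i)"
    for \<phi>1 \<phi>2
  proof (rule extensionalityI)
    show "\<phi>1 \<in> extensional (carrier S)" "\<phi>2 \<in> extensional (carrier S)" using \<phi>1 \<phi>2 by auto
    fix a assume a: "a \<in> carrier S"
    have "restrict (e \<circ> \<phi>1) (carrier S) = restrict (e \<circ> \<phi>2) (carrier S)"
      using ex toP[of \<phi>1] toP[of \<phi>2] \<phi>1 \<phi>2 by blast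
    then have "e (\<phi>1 a) = e (\<phi>2 a)" using a by (metis comp_apply restrict_apply')
    moreover have "\<phi>1 a \<in> carrier H" "\<phi>2 a \<in> carrier H"
      using \<phi>1 \<phi>2 a by (auto simp: continuous_hom_def hom_def)
    ultimately show "\<phi>1 a = \<phi>2 a" using e by (simp add: inj_on_eq_iff)
  qed
  ultimately show ?thesis by blast
qed

definition magnus_coeffs :: "nat \<Rightarrow> nat list \<Rightarrow> 'k::comm_ring_1 set" where
  "magnus_coeffs d w = (if w = [] then {1} else if set w \<subseteq> {..<d} then UNIV else {0})"

text \<open>With the factors \<open>magnus_coeffs d w\<close> the Magnus group is literally a full
  product of discrete sets, so the topspace is its carrier. For finite coefficients compactness is
  Tychonoff's theorem.\<close>

definition magnus_topology :: "nat \<Rightarrow> (nat list \<Rightarrow> 'k::comm_ring_1) topology" where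
  "magnus_topology d = product_topology (\<lambda>w. discrete_topology (magnus_coeffs d w)) UNIV"

lemma magnus_coeffs_iff: "(\<forall>w. f w \<in> magnus_coeffs d w) \<longleftrightarrow> f \<in> carrier (magnus_group d)"
proof
  assume *: "\<forall>w. f w \<in> magnus_coeffs d w"
  have "set w \<subseteq> {..<d}" if "f w \<noteq> 0" for w
    using spec[OF *, of w] that by (cases "w = []") (simp_all add: magnus_coeffs_def split: if_splits)
  moreover have "f [] = 1" using spec[OF *, of "[]"] by (simp add: magnus_coeffs_def)
  ultimately show "f \<in> carrier (magnus_group d)" by simp
qed (auto simp: magnus_coeffs_def)

lemma topspace_magnus_topology: "topspace (magnus_topology d) = carrier (magnus_group d)"
  unfolding magnus_topology_def topspace_product_topology topspace_discrete_topology
  using magnus_coeffs_iff[of _ d] by (auto simp: PiE_UNIV_domain simp del: magnus_group_simps)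

lemma continuous_map_discrete_topology:
  "continuous_map T (discrete_topology V) f \<longleftrightarrow>
     continuous_map T discrete f \<and> f ` topspace T \<subseteq> V"
  by (metis continuous_map_in_subtopology inf_top.left_neutral subtopology_discrete_topology
      image_subset_iff_funcset)

lemma continuous_map_into_magnus:
  "continuous_map T (magnus_topology d) f \<longleftrightarrow>
     (\<forall>w. continuous_map T discrete (\<lambda>a. f a w)) \<and> f ` topspace T \<subseteq> carrier (magnus_group d)"
proof -
  have "f ` topspace T \<subseteq> carrier (magnus_group d) \<longleftrightarrow>
      (\<forall>w. (\<lambda>a. f a w) ` topspace T \<subseteq> magnus_coeffs d w)"
    unfolding topspace_magnus_topology[symmetric] magnus_topology_def
    by (auto simp: PiE_UNIV_domain Pi_iff)
  moreover have "continuous_map T (magnus_topology d) f \<longleftrightarrow>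
      (\<forall>w. continuous_map T discrete (\<lambda>a. f a w) \<and> (\<lambda>a. f a w) ` topspace T \<subseteq> magnus_coeffs d w)"
    unfolding magnus_topology_def continuous_map_componentwise_UNIV
    by (intro all_cong1 continuous_map_discrete_topology)
  ultimately show ?thesis by (simp only: all_conj_distrib)
qed

lemma continuous_map_magnus_coeff: "continuous_map (magnus_topology d) discrete (\<lambda>f. f w)"
  using spec[OF conjunct1[OF iffD1[OF continuous_map_into_magnus continuous_map_id]]]
  by (simp only: id_apply)

lemma topological_group_magnus:
  "topological_group (magnus_group d :: (nat list \<Rightarrow> 'k::comm_ring_1) monoid) (magnus_topology d)"
  unfolding topological_group_def
proof (intro conjI)
  let ?M = "magnus_group d :: (nat list \<Rightarrow> 'k) monoid"
    and ?T = "magnus_topology d :: (nat list \<Rightarrow> 'k) topology"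
  interpret group ?M by (rule group_magnus_group)
  show "group ?M" by (rule group_magnus_group)
  show "topspace ?T = carrier ?M" by (rule topspace_magnus_topology)
  have c1: "continuous_map (prod_topology ?T ?T) discrete (\<lambda>z. fst z w)" for w
    using continuous_map_compose[OF continuous_map_fst continuous_map_magnus_coeff]
    by (simp add: o_def)
  have c2: "continuous_map (prod_topology ?T ?T) discrete (\<lambda>z. snd z w)" for w
    using continuous_map_compose[OF continuous_map_snd continuous_map_magnus_coeff]
    by (simp add: o_def)
  have "continuous_map (prod_topology ?T ?T) discrete (\<lambda>z. word_times (fst z) (snd z) w)" for w
    unfolding word_times_def
    by (rule continuous_map_discrete_sum) (rule continuous_map_discrete_binop[where h = "(*)", OF c1 c2])
  moreover have "(\<lambda>(a, b). a \<otimes>\<^bsub>?M\<^esub> b) ` topspace (prod_topology ?T ?T) \<subseteq> carrier ?M"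
    by (auto simp: topspace_magnus_topology simp del: magnus_group_simps intro!: m_closed)
  ultimately show "continuous_map (prod_topology ?T ?T) ?T (\<lambda>(a, b). a \<otimes>\<^bsub>?M\<^esub> b)"
    unfolding continuous_map_into_magnus case_prod_unfold magnus_group_simps(2) by blast
  \<comment> \<open>Each coefficient of the inverse is a polynomial in finitely many coefficients of
    \<open>f\<close>; the induction on the length of the word follows the recursion of
    \<open>nc_inverse\<close>.\<close>
  have "continuous_map ?T discrete (\<lambda>f. nc_inverse f w)" for w
  proof (induction "length w" arbitrary: w rule: less_induct)
    case less
    show ?case
    proof (cases w)
      case (Cons a u)
      have "continuous_map ?T discrete (\<lambda>f. nc_inverse f (drop i u))" for i
        by (rule less) (simp add: Cons)
      then have "continuous_map ?T discrete (\<lambda>f. f (a # take i u) * nc_inverse f (drop i u))" for i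
        by (rule continuous_map_discrete_binop[where h = "(*)", OF continuous_map_magnus_coeff])
      then have "continuous_map ?T discrete
          (\<lambda>f. \<Sum>i\<le>length u. f (a # take i u) * nc_inverse f (drop i u))"
        by (rule continuous_map_discrete_sum)
      from continuous_map_discrete_op[OF this, of uminus]
      show ?thesis using Cons by simp
    qed simp
  qed
  then have "continuous_map ?T ?T nc_inverse"
    unfolding continuous_map_into_magnus topspace_magnus_topology
    using nc_inverse_magnus_group by blast
  then show "continuous_map ?T ?T (\<lambda>a. inv\<^bsub>?M\<^esub> a)"
    by (rule continuous_map_eq) (simp add: topspace_magnus_topology inv_magnus_group del: magnus_group_simps(1))
qed

text \<open>Two maps with the same fibres have equally many values. It serves to count cosets of a
  congruence subgroup by counting truncated series.\<close>

lemma card_image_eq_card_image: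
  assumes "\<And>a b. a \<in> A \<Longrightarrow> b \<in> A \<Longrightarrow> f a = f b \<longleftrightarrow> g a = g b"
  shows "card (f ` A) = card (g ` A)"
proof (rule bij_betw_same_card)
  let ?h = "\<lambda>c. g (inv_into A f c)"
  have h: "?h (f a) = g a" if "a \<in> A" for a
    using assms[of "inv_into A f (f a)" a] that by (simp add: inv_into_into f_inv_into_f)
  show "bij_betw ?h (f ` A) (g ` A)"
    unfolding bij_betw_def using h assms by (auto simp: inj_on_def image_iff)
qed

text \<open>The congruence subgroup \<open>1 + I^(n+1)\<close>, where \<open>I\<close> is the ideal
  of series without constant term, that is, the kernel of truncation after degree
  \<open>n\<close>.\<close>

definition magnus_congruence :: "nat \<Rightarrow> nat \<Rightarrow> (nat list \<Rightarrow> 'k::comm_ring_1) set" where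
  "magnus_congruence d n =
     {f \<in> carrier (magnus_group d). \<forall>w. length w \<le> n \<longrightarrow> f w = (if w = [] then 1 else 0)}"

lemma word_times_cong:
  assumes "\<And>u. length u \<le> length w \<Longrightarrow> f u = f' u" "\<And>u. length u \<le> length w \<Longrightarrow> g u = g' u"
  shows "word_times f g w = word_times f' g' w"
  using assms by (simp add: word_times_def)

text \<open>The coefficient of a product at \<open>w\<close> involves only words no longer than
  \<open>w\<close>, so truncation after degree \<open>n\<close> is multiplicative and its fibres are
  the cosets of the congruence subgroup.\<close>

lemma magnus_congruence_iff:
  assumes "f \<in> carrier (magnus_group d)" "g \<in> carrier (magnus_group d)"
  shows "f \<otimes>\<^bsub>magnus_group d\<^esub> inv\<^bsub>magnus_group d\<^esub> g \<in> magnus_congruence d n \<longleftrightarrow>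
     (\<forall>w. length w \<le> n \<longrightarrow> f w = g w)"
proof -
  let ?M = "magnus_group d :: (nat list \<Rightarrow> 'a) monoid"
  interpret group ?M by (rule group_magnus_group)
  let ?h = "f \<otimes>\<^bsub>?M\<^esub> inv\<^bsub>?M\<^esub> g"
  have h: "?h \<in> carrier ?M" using assms by (intro m_closed inv_closed)
  show ?thesis
  proof (intro iffI allI impI)
    fix w :: "nat list" assume "?h \<in> magnus_congruence d n" and w: "length w \<le> n"
    then have *: "?h u = (if u = [] then 1 else 0)" if "length u \<le> length w" for u
      using that by (simp add: magnus_congruence_def)
    have "f = ?h \<otimes>\<^bsub>?M\<^esub> g" using assms by (simp add: m_assoc del: magnus_group_simps)
    then have "f w = word_times ?h g w" by (metis magnus_group_simps(2))
    also have "\<dots> = word_times (\<lambda>u. if u = [] then 1 else 0) g w"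
      by (rule word_times_cong) (use * in auto)
    finally show "f w = g w" by simp
  next
    assume *: "\<forall>w. length w \<le> n \<longrightarrow> f w = g w"
    have "?h w = (if w = [] then 1 else 0)" if "length w \<le> n" for w
    proof -
      have "?h w = word_times g (inv\<^bsub>?M\<^esub> g) w"
        using that * by (auto intro: word_times_cong)
      also have "\<dots> = \<one>\<^bsub>?M\<^esub> w" using r_inv[OF assms(2)] by (metis magnus_group_simps(2))
      finally show ?thesis by simp
    qed
    with h show "?h \<in> magnus_congruence d n" by (simp add: magnus_congruence_def del: magnus_group_simps)
  qed
qed

lemma normal_magnus_congruence: "magnus_congruence d n \<lhd> magnus_group d"
proof -
  let ?M = "magnus_group d :: (nat list \<Rightarrow> 'a) monoid" and ?N = "magnus_congruence d n :: (nat list \<Rightarrow> 'a) set"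
  interpret group ?M by (rule group_magnus_group)
  have Nc: "f \<in> carrier ?M" if "f \<in> ?N" for f using that by (simp add: magnus_congruence_def)
  have one: "\<one>\<^bsub>?M\<^esub> \<in> ?N" using one_closed by (simp add: magnus_congruence_def)
  have *: "f \<in> ?N \<longleftrightarrow> (\<forall>w. length w \<le> n \<longrightarrow> f w = \<one>\<^bsub>?M\<^esub> w)" if "f \<in> carrier ?M" for f
    using magnus_congruence_iff[OF that one_closed, of n] that by (simp del: magnus_group_simps)
  have mult: "word_times f g w = g w" if "f \<in> ?N" "length w \<le> n" for f g w
  proof -
    have "word_times f g w = word_times \<one>\<^bsub>?M\<^esub> g w"
      by (rule word_times_cong) (use that in \<open>auto simp: magnus_congruence_def\<close>)
    then show ?thesis by simp
  qed
  have sub: "subgroup ?N ?M"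
  proof (rule subgroupI)
    show "?N \<subseteq> carrier ?M" using Nc by blast
    show "?N \<noteq> {}" using one by blast
    fix f assume f: "f \<in> ?N"
    have "\<one>\<^bsub>?M\<^esub> \<otimes>\<^bsub>?M\<^esub> inv\<^bsub>?M\<^esub> f \<in> ?N"
      using f *[OF Nc[OF f]] magnus_congruence_iff[OF one_closed Nc[OF f], of n] by metis
    then show "inv\<^bsub>?M\<^esub> f \<in> ?N" using Nc[OF f] by (simp del: magnus_group_simps)
    fix g assume g: "g \<in> ?N"
    have "f \<otimes>\<^bsub>?M\<^esub> g \<in> carrier ?M" using Nc[OF f] Nc[OF g] by (rule m_closed)
    then show "f \<otimes>\<^bsub>?M\<^esub> g \<in> ?N"
      using *[OF Nc[OF g]] g mult[OF f] * by (metis magnus_group_simps(2))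
  qed
  show ?thesis
  proof (rule normal_invI[OF sub])
    fix g f assume g: "g \<in> carrier ?M" and f: "f \<in> ?N"
    have "g \<otimes>\<^bsub>?M\<^esub> f \<in> carrier ?M" using g Nc[OF f] by (rule m_closed)
    moreover have "(g \<otimes>\<^bsub>?M\<^esub> f) w = g w" if "length w \<le> n" for w
    proof -
      have "word_times g f w = word_times g \<one>\<^bsub>?M\<^esub> w"
        by (rule word_times_cong) (use that f in \<open>auto simp: magnus_congruence_def\<close>)
      then show ?thesis by simp
    qed
    ultimately show "g \<otimes>\<^bsub>?M\<^esub> f \<otimes>\<^bsub>?M\<^esub> inv\<^bsub>?M\<^esub> g \<in> ?N"
      using magnus_congruence_iff[OF _ g] by blast
  qed
qed

lemma pro_p_group_magnus:
  "pro_p_group CARD('p) (magnus_group d :: (nat list \<Rightarrow> 'p::prime_card mod_ring) monoid) (magnus_topology d)"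
  unfolding pro_p_group_def
proof (intro conjI allI impI)
  let ?M = "magnus_group d :: (nat list \<Rightarrow> 'p mod_ring) monoid" and ?T = "magnus_topology d :: (nat list \<Rightarrow> 'p mod_ring) topology"
  interpret group ?M by (rule group_magnus_group)
  show "topological_group ?M ?T" by (rule topological_group_magnus)
  show "compact_space ?T" "Hausdorff_space ?T"
    unfolding magnus_topology_def compact_space_product_topology Hausdorff_space_product_topology
    by (auto simp: compact_space_discrete_topology Hausdorff_space_discrete_topology)
  fix U assume U: "openin ?T U \<and> \<one>\<^bsub>?M\<^esub> \<in> U"
  then obtain B where B: "finite {w. B w \<noteq> magnus_coeffs d w}"
      "\<one>\<^bsub>?M\<^esub> \<in> PiE UNIV B" "PiE UNIV B \<subseteq> U"
    unfolding magnus_topology_def openin_product_topology_alt topspace_discrete_topology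
    by (metis (mono_tags, lifting) UNIV_I mem_Collect_eq Collect_cong)
  \<comment> \<open>A basic open set restricts only finitely many coefficients, so it contains every
    series that is 1 up to the largest length of a restricted word. The inserted 0 keeps
    \<open>Max\<close> meaningful if there is no restriction.\<close>
  define n where "n = Max (insert 0 (length ` {w. B w \<noteq> magnus_coeffs d w}))"
  have n: "length w \<le> n" if "B w \<noteq> magnus_coeffs d w" for w
    unfolding n_def using B(1) that by (intro Max_ge) auto
  let ?N = "magnus_congruence d n :: (nat list \<Rightarrow> 'p mod_ring) set"
  \<comment> \<open>The positions of the coefficients of degree at most \<open>n\<close> that can be
    chosen freely; hence the quotient has \<open>p ^ card W\<close> elements.\<close>
  define W where "W = {w. set w \<subseteq> {..<d} \<and> length w \<le> n} - {[]}"
  have finW: "finite W" unfolding W_def using finite_lists_length_le[of "{..<d}" n] by simp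
  show "\<exists>N k. N \<lhd> ?M \<and> openin ?T N \<and> N \<subseteq> U \<and> order (?M Mod N) = CARD('p) ^ k"
  proof (intro exI conjI)
    show "?N \<lhd> ?M" by (rule normal_magnus_congruence)
    have car: "f w \<in> magnus_coeffs d w" if "f \<in> carrier ?M" for f w
      using that by (auto simp: magnus_coeffs_def)
    have "f \<in> PiE UNIV B" if f: "f \<in> ?N" for f
    proof -
      have "f w \<in> B w" for w
      proof (cases "B w = magnus_coeffs d w")
        case True
        then show ?thesis using f car[of f w] by (simp add: magnus_congruence_def)
      next
        case False
        then have "f w = \<one>\<^bsub>?M\<^esub> w" using n[of w] f by (simp add: magnus_congruence_def)
        moreover have "\<one>\<^bsub>?M\<^esub> w \<in> B w" using B(2) unfolding PiE_UNIV_domain by (rule Pi_mem) simp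
        ultimately show ?thesis by metis
      qed
      then show ?thesis by (simp add: PiE_UNIV_domain)
    qed
    then show "?N \<subseteq> U" using B(3) by blast
    have N_eq: "?N = {f \<in> carrier ?M. \<forall>w\<in>W. f w = 0}"
    proof (intro equalityI subsetI)
      fix f assume "f \<in> {f \<in> carrier ?M. \<forall>w\<in>W. f w = 0}"
      then have f: "f \<in> carrier ?M" and *: "\<And>w. w \<in> W \<Longrightarrow> f w = 0" by blast+
      have "f w = (if w = [] then 1 else 0)" if "length w \<le> n" for w
        using that f *[of w] by (cases "set w \<subseteq> {..<d}") (auto simp: W_def)
      then show "f \<in> ?N" using f by (simp add: magnus_congruence_def)
    qed (simp add: magnus_congruence_def W_def)
    have "?N = \<Inter>(insert (topspace ?T) ((\<lambda>w. {f \<in> topspace ?T. f w = 0}) ` W))"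
      unfolding N_eq topspace_magnus_topology by auto
    moreover have "openin ?T \<dots>"
      using finW continuous_map_magnus_coeff[unfolded continuous_map_discrete_iff]
      by (intro openin_Inter) auto
    ultimately show "openin ?T ?N" by metis
    have "rcosets\<^bsub>?M\<^esub> ?N = (\<lambda>f. ?N #>\<^bsub>?M\<^esub> f) ` carrier ?M" by (auto simp: RCOSETS_def)
    moreover have "card ((\<lambda>f. ?N #>\<^bsub>?M\<^esub> f) ` carrier ?M) = card ((\<lambda>f. restrict f W) ` carrier ?M)"
    proof (rule card_image_eq_card_image)
      fix f g assume f: "f \<in> carrier ?M" and g: "g \<in> carrier ?M"
      have sub: "subgroup ?N ?M" using normal_magnus_congruence by (rule normal_imp_subgroup)
      have "?N #>\<^bsub>?M\<^esub> f = ?N #>\<^bsub>?M\<^esub> g \<longleftrightarrow> f \<otimes>\<^bsub>?M\<^esub> inv\<^bsub>?M\<^esub> g \<in> ?N"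
      proof
        assume "?N #>\<^bsub>?M\<^esub> f = ?N #>\<^bsub>?M\<^esub> g"
        then have "f \<in> ?N #>\<^bsub>?M\<^esub> g" using rcos_self[OF f sub] by simp
        then show "f \<otimes>\<^bsub>?M\<^esub> inv\<^bsub>?M\<^esub> g \<in> ?N"
          using subgroup.rcos_module_imp[OF sub group_axioms g] by blast
      next
        assume "f \<otimes>\<^bsub>?M\<^esub> inv\<^bsub>?M\<^esub> g \<in> ?N"
        then have "f \<in> ?N #>\<^bsub>?M\<^esub> g"
          using subgroup.rcos_module_rev[OF sub group_axioms g f] by blast
        then show "?N #>\<^bsub>?M\<^esub> f = ?N #>\<^bsub>?M\<^esub> g"
          using repr_independence[OF _ g sub] by blast
      qed
      also have "\<dots> \<longleftrightarrow> (\<forall>w. length w \<le> n \<longrightarrow> f w = g w)" by (rule magnus_congruence_iff[OF f g])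
      also have "\<dots> \<longleftrightarrow> (\<forall>w\<in>W. f w = g w)"
      proof (intro iffI allI impI)
        fix w :: "nat list" assume *: "\<forall>w\<in>W. f w = g w" and w: "length w \<le> n"
        show "f w = g w"
        proof (cases "w \<in> W")
          case False
          then have "w = [] \<or> \<not> set w \<subseteq> {..<d}" using w by (auto simp: W_def)
          then show ?thesis using f g by (cases "f w = 0"; cases "g w = 0") auto
        qed (use * in auto)
      qed (auto simp: W_def)
      also have "\<dots> \<longleftrightarrow> restrict f W = restrict g W"
        by (metis restrict_apply' restrict_ext)
      finally show "?N #>\<^bsub>?M\<^esub> f = ?N #>\<^bsub>?M\<^esub> g \<longleftrightarrow> restrict f W = restrict g W" .
    qed
    moreover have "(\<lambda>f. restrict f W) ` carrier ?M = PiE W (\<lambda>_. UNIV)"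
    proof (intro equalityI subsetI)
      fix g :: "nat list \<Rightarrow> 'p mod_ring" assume g: "g \<in> PiE W (\<lambda>_. UNIV)"
      let ?f = "\<lambda>w. if w = [] then 1 else if w \<in> W then g w else 0"
      have f: "?f \<in> carrier ?M" by (auto simp: W_def)
      have "g = restrict ?f W" using g by (auto simp: W_def PiE_def extensional_def)
      from image_eqI[where f = "\<lambda>f. restrict f W", OF this f]
      show "g \<in> (\<lambda>f. restrict f W) ` carrier ?M" .
    qed auto
    ultimately show "order (?M Mod ?N) = CARD('p) ^ card W"
      by (simp add: order_def FactGroup_def card_PiE[OF finW] del: magnus_group_simps)
  qed
qed

lemma finite_type_inj_nat: "\<exists>\<iota> :: 'a::finite \<Rightarrow> nat. inj \<iota>"
  using finite_imp_inj_to_nat_seg[of "UNIV :: 'a set"] by auto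

text \<open>Words are countable and the coefficients finite, so a series can be coded by a sequence
  of natural numbers. This is the injection that admits the Magnus group as a test group.\<close>

lemma inj_word_functions: "\<exists>e :: (nat list \<Rightarrow> 'k::finite) \<Rightarrow> nat \<Rightarrow> nat. inj e"
proof -
  obtain \<iota> :: "'k \<Rightarrow> nat" where \<iota>: "inj \<iota>" using finite_type_inj_nat by blast
  have "inj (\<lambda>f :: nat list \<Rightarrow> 'k. \<lambda>n. \<iota> (f (from_nat n)))"
  proof (rule injI)
    fix f g :: "nat list \<Rightarrow> 'k"
    assume *: "(\<lambda>n. \<iota> (f (from_nat n))) = (\<lambda>n. \<iota> (g (from_nat n)))"
    show "f = g"
    proof
      fix w
      have "\<iota> (f w) = \<iota> (g w)" using fun_cong[OF *, of "to_nat w"] by simp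
      then show "f w = g w" using \<iota> by (simp add: inj_eq)
    qed
  qed
  then show ?thesis by blast
qed

lemma mod_ring_power_card: "(c :: 'p::prime_card mod_ring) ^ CARD('p) = c"
proof -
  let ?p = "CARD('p)"
  have p: "Factorial_Ring.prime ?p" by (rule prime_card)
  obtain n where c: "c = of_nat n" using surj_of_nat_mod_ring by blast
  show ?thesis
  proof (cases "?p dvd n")
    case True
    then have "c = 0" using c by auto
    then show ?thesis using prime_gt_0_nat[OF p] by (simp add: power_0_left)
  next
    case False
    then have "[n ^ (?p - 1) = 1] (mod ?p)" by (rule fermat_theorem[OF p])
    then have "(of_nat (n ^ (?p - 1)) :: 'p mod_ring) = of_nat 1"
      by (simp only: of_nat_eq_iff_cong_CHAR semiring_char_mod_ring)
    then have "c ^ (?p - 1) = 1" by (simp add: c)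
    moreover have "c ^ ?p = c * c ^ (?p - 1)"
      using prime_gt_0_nat[OF p] by (simp add: power_eq_if)
    ultimately show ?thesis by simp
  qed
qed

section \<open>The additive group of \<open>F_p\<close> as a pro-\<open>p\<close> test group\<close>

definition additive_monoid :: "'k::comm_ring_1 monoid" where
  "additive_monoid = \<lparr>carrier = UNIV, mult = (+), one = 0\<rparr>"

lemma additive_monoid_simps [simp]:
  "carrier additive_monoid = UNIV" "x \<otimes>\<^bsub>additive_monoid\<^esub> y = x + y" "\<one>\<^bsub>additive_monoid\<^esub> = 0"
  by (simp_all add: additive_monoid_def)

lemma group_additive_monoid: "group (additive_monoid :: 'k::comm_ring_1 monoid)"
proof (rule groupI)
  fix a :: 'k
  show "\<exists>b\<in>carrier additive_monoid. b \<otimes>\<^bsub>additive_monoid\<^esub> a = \<one>\<^bsub>additive_monoid\<^esub>"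
    by (intro bexI[of _ "- a"]) auto
qed (auto simp: add_ac)

lemma pro_p_group_additive_monoid:
  "pro_p_group CARD('p) (additive_monoid :: 'p::prime_card mod_ring monoid) discrete"
  unfolding pro_p_group_def topological_group_def
proof (intro conjI allI impI)
  let ?A = "additive_monoid :: 'p mod_ring monoid"
  interpret group ?A by (rule group_additive_monoid)
  show "group ?A" by (rule group_additive_monoid)
  show "continuous_map (prod_topology discrete discrete) discrete (\<lambda>(a, b). a \<otimes>\<^bsub>?A\<^esub> b)"
    by (simp add: prod_topology_discrete_topology[symmetric])
  fix U :: "'p mod_ring set" assume "openin discrete U \<and> \<one>\<^bsub>?A\<^esub> \<in> U"
  moreover have "{0} \<lhd> ?A" using one_is_normal by simp
  moreover have "order (?A Mod {0}) = CARD('p) ^ 1"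
  proof -
    have "rcosets\<^bsub>?A\<^esub> {0} = (\<lambda>a. {a}) ` UNIV"
      by (auto simp: RCOSETS_def r_coset_def)
    then show ?thesis by (simp add: order_def FactGroup_def card_image)
  qed
  ultimately show "\<exists>N k. N \<lhd> ?A \<and> openin discrete N \<and> N \<subseteq> U \<and> order (?A Mod N) = CARD('p) ^ k"
    by (intro exI[of _ "{0}"] exI[of _ 1]) auto
qed (auto simp: compact_space_discrete_topology)

text \<open>The uniqueness half of the universal property, applied to \<open>h\<close> and the zero
  map. It takes the place of the statement that the \<open>x i\<close> generate a dense subgroup of
  \<open>S\<close>.\<close>

lemma free_pro_p_hom_eq_0:
  fixes h :: "'s \<Rightarrow> 'p::prime_card mod_ring"
  assumes S: "free_pro_p_group CARD('p) S T d x"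
    and h: "continuous_map T discrete h"
      "\<And>s t. s \<in> carrier S \<Longrightarrow> t \<in> carrier S \<Longrightarrow> h (s \<otimes>\<^bsub>S\<^esub> t) = h s + h t"
      "\<And>i. i < d \<Longrightarrow> h (x i) = 0"
    and s: "s \<in> carrier S"
  shows "h s = 0"
proof -
  note SD = free_pro_p_groupD[OF S]
  interpret group S by (rule pro_p_groupD[OF SD(1)])
  have ts: "topspace T = carrier S" by (rule pro_p_groupD[OF SD(1)])
  obtain \<iota> :: "'p mod_ring \<Rightarrow> nat" where \<iota>: "inj \<iota>" using finite_type_inj_nat by blast
  let ?A = "additive_monoid :: 'p mod_ring monoid"
  let ?P = "\<lambda>\<phi>. \<phi> \<in> extensional (carrier S) \<and> \<phi> \<in> continuous_hom S T ?A discrete \<and> (\<forall>i<d. \<phi> (x i) = 0)"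
  have "inj_on (\<lambda>c (_::nat). \<iota> c) (carrier ?A)"
    using \<iota> by (auto simp: inj_on_def fun_eq_iff)
  from free_pro_p_group_ex1[OF S pro_p_group_additive_monoid this, of "\<lambda>_. 0"]
  have ex: "\<exists>!\<phi>. ?P \<phi>" by simp
  have "continuous_map T discrete (restrict h (carrier S))"
    by (rule continuous_map_eq[OF h(1)]) (simp add: ts)
  then have 1: "?P (restrict h (carrier S))"
    using h SD(2) by (auto simp: continuous_hom_def hom_def)
  have "continuous_map T discrete (restrict (\<lambda>_. 0) (carrier S) :: 's \<Rightarrow> 'p mod_ring)"
    by (rule continuous_map_eq[of _ _ "\<lambda>_. 0"]) (auto simp: ts)
  then have 2: "?P (restrict (\<lambda>_. 0) (carrier S))"
    using SD(2) by (auto simp: continuous_hom_def hom_def)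
  have "restrict h (carrier S) = restrict (\<lambda>_. 0) (carrier S)" using ex 1 2 by blast
  then show ?thesis using s by (metis restrict_apply')
qed

section \<open>Existence and uniqueness of the Magnus map\<close>

lemma magnus_group_subset_Units: "carrier (magnus_group d) \<subseteq> Units (ncseries d)"
proof
  fix f :: "nat list \<Rightarrow> 'k::comm_ring_1" assume f: "f \<in> carrier (magnus_group d)"
  interpret group "magnus_group d :: (nat list \<Rightarrow> 'k) monoid" by (rule group_magnus_group)
  have "inv\<^bsub>magnus_group d\<^esub> f \<in> carrier (magnus_group d)" using f by (rule inv_closed)
  then show "f \<in> Units (ncseries d)"
    using f l_inv[OF f] r_inv[OF f] unfolding Units_def by auto
qed

text \<open>A continuous homomorphism from a pro-\<open>p\<close> group to the units has constant coefficient 1: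
  some \<open>p\<close>-power iterate of the Frobenius, which is the identity of \<open>F\<^sub>p\<close>, maps this coefficient to 1.\<close>

lemma units_hom_constant_coeff:
  fixes \<mu> :: "'s \<Rightarrow> nat list \<Rightarrow> 'p::prime_card mod_ring"
  assumes S: "pro_p_group CARD('p) S T"
    and \<mu>: "\<mu> \<in> hom S (units_of (ncseries d))"
      "continuous_map T (product_topology (\<lambda>_. discrete) UNIV) \<mu>"
    and s: "s \<in> carrier S"
  shows "\<mu> s [] = 1"
proof -
  interpret S: group S by (rule pro_p_groupD[OF S])
  interpret N: ring "ncseries d :: (nat list \<Rightarrow> 'p mod_ring) ring" by (rule ring_ncseries)
  have ts: "topspace T = carrier S" by (rule pro_p_groupD[OF S])
  interpret U: group "units_of (ncseries d :: (nat list \<Rightarrow> 'p mod_ring) ring)" by (rule N.units_group)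
  interpret h: group_hom S "units_of (ncseries d)" \<mu> by unfold_locales (rule \<mu>(1))
  have mult: "\<mu> (a \<otimes>\<^bsub>S\<^esub> b) [] = \<mu> a [] * \<mu> b []" if "a \<in> carrier S" "b \<in> carrier S" for a b
    using that by (simp add: units_of_mult)
  have one: "\<mu> \<one>\<^bsub>S\<^esub> [] = 1" by (simp add: units_of_one)
  have pow: "\<mu> (s [^]\<^bsub>S\<^esub> n) [] = (\<mu> s []) ^ n" for n :: nat
    by (induction n) (use s in \<open>auto simp: units_of_one units_of_mult\<close>)
  have "continuous_map T discrete (\<lambda>a. \<mu> a [])"
    using \<mu>(2) unfolding continuous_map_componentwise_UNIV by blast
  then have "openin T {a \<in> topspace T. \<mu> a [] = 1}" unfolding continuous_map_discrete_iff by blast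
  moreover have "\<one>\<^bsub>S\<^esub> \<in> {a \<in> topspace T. \<mu> a [] = 1}" using one ts by simp
  ultimately obtain N k where N: "N \<lhd> S" "openin T N" "N \<subseteq> {a \<in> topspace T. \<mu> a [] = 1}"
      "order (S Mod N) = CARD('p) ^ k"
    by (rule pro_p_group_nhd[OF S])
  have "s [^]\<^bsub>S\<^esub> (CARD('p) ^ k) \<in> N" by (rule S.quotient_pow_card_mem[OF N(1) s N(4)])
  then have "(\<mu> s []) ^ (CARD('p) ^ k) = 1" using N(3) pow by auto
  moreover have "c ^ (CARD('p) ^ k) = c" for c :: "'p mod_ring"
    by (induction k) (simp_all add: power_mult[of c "CARD('p)"] mod_ring_power_card)
  ultimately show ?thesis by simp
qed

text \<open>By \<open>units_hom_constant_coeff\<close>, every candidate with values in the units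
  already has values in \<open>magnus_group d\<close>. Hence the candidates are the same as in the
  universal property for that group, which has exactly one.\<close>

lemma magnus_ex1:
  assumes S: "free_pro_p_group CARD('p) S T d x"
  shows "\<exists>!\<mu> :: 's \<Rightarrow> nat list \<Rightarrow> 'p::prime_card mod_ring. \<mu> \<in> extensional (carrier S) \<and>
     \<mu> \<in> hom S (units_of (ncseries d)) \<and>
     continuous_map T (product_topology (\<lambda>_. discrete_topology UNIV) UNIV) \<mu> \<and>
     (\<forall>i<d. \<mu> (x i) = \<one>\<^bsub>ncseries d\<^esub> \<oplus>\<^bsub>ncseries d\<^esub> ncvar i)" (is "\<exists>!\<mu>. ?P \<mu>")
proof -
  let ?M = "magnus_group d :: (nat list \<Rightarrow> 'p mod_ring) monoid"
    and ?T = "magnus_topology d :: (nat list \<Rightarrow> 'p mod_ring) topology"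
  note SD = free_pro_p_groupD[OF S]
  have ts: "topspace T = carrier S" by (rule pro_p_groupD[OF SD(1)])
  let ?y = "\<lambda>i. \<one>\<^bsub>ncseries d\<^esub> \<oplus>\<^bsub>ncseries d\<^esub> ncvar i :: nat list \<Rightarrow> 'p mod_ring"
  have y: "?y i \<in> carrier ?M" if "i < d" for i
    using that by (auto simp: ncvar_def split: if_splits)
  obtain e :: "(nat list \<Rightarrow> 'p mod_ring) \<Rightarrow> nat \<Rightarrow> nat" where "inj e" using inj_word_functions by blast
  then have e: "inj_on e (carrier ?M)" by (rule inj_on_subset) simp
  have ex: "\<exists>!\<mu>. \<mu> \<in> extensional (carrier S) \<and> \<mu> \<in> continuous_hom S T ?M ?T \<and> (\<forall>i<d. \<mu> (x i) = ?y i)"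
    by (rule free_pro_p_group_ex1[OF S pro_p_group_magnus e y])
  have "?P \<mu> \<longleftrightarrow> \<mu> \<in> extensional (carrier S) \<and> \<mu> \<in> continuous_hom S T ?M ?T \<and> (\<forall>i<d. \<mu> (x i) = ?y i)" for \<mu>
  proof (intro iffI conjI; elim conjE)
    assume \<mu>: "\<mu> \<in> hom S (units_of (ncseries d))"
      "continuous_map T (product_topology (\<lambda>_. discrete_topology UNIV) UNIV) \<mu>"
    have M: "\<mu> s \<in> carrier ?M" if s: "s \<in> carrier S" for s
    proof -
      have "\<mu> s \<in> Units (ncseries d)" using \<mu>(1) s by (auto simp: hom_def units_of_carrier)
      then have "\<mu> s \<in> carrier (ncseries d)" by (auto simp: Units_def)
      then show ?thesis using units_hom_constant_coeff[OF SD(1) \<mu> s] by simp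
    qed
    then have "\<mu> \<in> hom S ?M" using \<mu>(1) by (auto simp: hom_def units_of_mult)
    moreover have "continuous_map T ?T \<mu>"
      using \<mu>(2) M unfolding continuous_map_into_magnus continuous_map_componentwise_UNIV ts by blast
    ultimately show "\<mu> \<in> continuous_hom S T ?M ?T" by (simp add: continuous_hom_def)
  next
    assume \<mu>: "\<mu> \<in> continuous_hom S T ?M ?T"
    then show "\<mu> \<in> hom S (units_of (ncseries d))"
      using magnus_group_subset_Units[of d]
      by (auto simp: continuous_hom_def hom_def units_of_mult units_of_carrier simp del: magnus_group_simps(1))
    show "continuous_map T (product_topology (\<lambda>_. discrete_topology UNIV) UNIV) \<mu>"
      using \<mu> unfolding continuous_hom_def continuous_map_into_magnus continuous_map_componentwise_UNIV
      by blast
  qed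
  then show ?thesis using ex by (simp only:)
qed

text \<open>Makes the definite description in \<open>magnus\<close> usable. All that is said later
  about the Magnus map is derived from these five facts.\<close>

lemma magnus_properties:
  fixes x :: "nat \<Rightarrow> 's"
  assumes S: "free_pro_p_group CARD('p) S T d x"
  defines "\<mu> \<equiv> magnus S T d x :: 's \<Rightarrow> nat list \<Rightarrow> 'p::prime_card mod_ring"
  shows "\<And>s. s \<in> carrier S \<Longrightarrow> \<mu> s \<in> carrier (ncseries d)"
    "\<And>s. s \<in> carrier S \<Longrightarrow> \<mu> s [] = 1"
    "\<And>s t. s \<in> carrier S \<Longrightarrow> t \<in> carrier S \<Longrightarrow> \<mu> (s \<otimes>\<^bsub>S\<^esub> t) = word_times (\<mu> s) (\<mu> t)"
    "\<And>w. continuous_map T discrete (\<lambda>s. \<mu> s w)"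
    "\<And>i j. i < d \<Longrightarrow> j < d \<Longrightarrow> \<mu> (x j) [i] = (if i = j then 1 else 0)"
proof -
  note SD = free_pro_p_groupD[OF S]
  have "\<mu> \<in> extensional (carrier S) \<and> \<mu> \<in> hom S (units_of (ncseries d)) \<and>
     continuous_map T (product_topology (\<lambda>_. discrete_topology UNIV) UNIV) \<mu> \<and>
     (\<forall>i<d. \<mu> (x i) = \<one>\<^bsub>ncseries d\<^esub> \<oplus>\<^bsub>ncseries d\<^esub> ncvar i)"
    unfolding \<mu>_def magnus_def by (rule theI'[OF magnus_ex1[OF S]])
  then have h: "\<mu> \<in> hom S (units_of (ncseries d))"
    and c: "continuous_map T (product_topology (\<lambda>_. discrete_topology UNIV) UNIV) \<mu>"
    and v: "\<forall>i<d. \<mu> (x i) = \<one>\<^bsub>ncseries d\<^esub> \<oplus>\<^bsub>ncseries d\<^esub> ncvar i" by auto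
  show "\<mu> s [] = 1" if "s \<in> carrier S" for s by (rule units_hom_constant_coeff[OF SD(1) h c that])
  show "\<mu> s \<in> carrier (ncseries d)" if "s \<in> carrier S" for s
    using hom_in_carrier[OF h that] by (auto simp: units_of_carrier Units_def)
  show "\<mu> (s \<otimes>\<^bsub>S\<^esub> t) = word_times (\<mu> s) (\<mu> t)" if "s \<in> carrier S" "t \<in> carrier S" for s t
    using hom_mult[OF h that] by (simp add: units_of_mult)
  show "continuous_map T discrete (\<lambda>s. \<mu> s w)" for w
    using c unfolding continuous_map_componentwise_UNIV by blast
  show "\<mu> (x j) [i] = (if i = j then 1 else 0)" if "i < d" "j < d" for i j
    using v that by (simp add: ncvar_def)
qed

section \<open>Finite \<open>p\<close>-groups\<close>

text \<open>The class equation for the conjugation action on \<open>K\<close>: orbit sizes are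
  powers of \<open>p\<close>, and if \<open>{\<one>}\<close> were the only orbit of size 1, then
  \<open>p\<close> would divide both the order of \<open>K\<close> and that order minus 1. A
  suitable power of the central element found in this way has order \<open>p\<close>.\<close>

lemma (in group) p_group_normal_meets_center:
  fixes p :: nat
  assumes p: "Factorial_Ring.prime p" "order G = p ^ k" and K: "K \<lhd> G" "K \<noteq> {\<one>}"
  obtains z where "z \<in> K" "z \<noteq> \<one>" "z [^] p = \<one>" "\<And>g. g \<in> carrier G \<Longrightarrow> g \<otimes> z = z \<otimes> g"
proof -
  interpret K: normal K G by (rule K)
  have fin: "finite (carrier G)" using p by (metis order_gt_0_iff_finite prime_gt_0_nat zero_less_power)
  have finK: "finite K" using fin K.subset by (rule finite_subset[rotated])
  define \<phi> where "\<phi> = (\<lambda>g. (\<lambda>h \<in> carrier G. g \<otimes> h \<otimes> inv g))"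
  interpret A: group_action G "carrier G" \<phi> unfolding \<phi>_def by (rule action_by_conjugation)
  have orb: "orbit G \<phi> a = {g \<otimes> a \<otimes> inv g | g. g \<in> carrier G}" if "a \<in> K" for a
    using K.mem_carrier[OF that] by (auto simp: orbit_def \<phi>_def)
  have orbK: "orbit G \<phi> a \<subseteq> K" if "a \<in> K" for a
    using orb[OF that] K.inv_op_closed2[OF _ that] by auto
  have card_orb: "p dvd card (orbit G \<phi> a) \<or> card (orbit G \<phi> a) = 1" if "a \<in> K" for a
  proof -
    have "card (orbit G \<phi> a) dvd p ^ k"
      using A.orbit_stabilizer_theorem[OF K.mem_carrier[OF that]] p(2) by (metis dvd_triv_left)
    then obtain i where "card (orbit G \<phi> a) = p ^ i" using p(1) divides_primepow_nat by blast
    then show ?thesis by (cases i) auto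
  qed
  have "\<exists>z\<in>K. z \<noteq> \<one> \<and> card (orbit G \<phi> z) = 1"
  proof (rule ccontr)
    assume *: "\<not> (\<exists>z\<in>K. z \<noteq> \<one> \<and> card (orbit G \<phi> z) = 1)"
    let ?C = "orbit G \<phi> ` (K - {\<one>})"
    have "\<Union>?C = K - {\<one>}"
    proof (intro equalityI subsetI)
      fix b assume "b \<in> \<Union>?C"
      then obtain a g where a: "a \<in> K" "a \<noteq> \<one>" and g: "g \<in> carrier G" and b: "b = g \<otimes> a \<otimes> inv g"
        using orb by auto
      have "b \<in> K" using orbK[OF a(1)] orb[OF a(1)] g b by blast
      moreover have "b \<noteq> \<one>"
      proof
        assume "b = \<one>"
        then have "g \<otimes> a = g" using a(1) g b by (metis K.mem_carrier inv_closed inv_equality inv_inv m_closed)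
        then show False using a g K.mem_carrier[OF a(1)] by simp
      qed
      ultimately show "b \<in> K - {\<one>}" by blast
    next
      fix b assume "b \<in> K - {\<one>}"
      then show "b \<in> \<Union>?C" using A.orbit_refl[OF K.mem_carrier] by blast
    qed
    moreover have "pairwise disjnt ?C"
    proof (rule pairwiseI)
      fix B C assume BC: "B \<in> ?C" "C \<in> ?C" "B \<noteq> C"
      then have "B \<in> orbits G (carrier G) \<phi>" "C \<in> orbits G (carrier G) \<phi>"
        using K.mem_carrier by (auto simp: orbits_def)
      then show "disjnt B C" using A.disjoint_union BC(3) by (auto simp: disjnt_def)
    qed
    moreover have "finite B" if "B \<in> ?C" for B
      using that finite_subset[OF orbK finK] by blast
    ultimately have "card (K - {\<one>}) = sum card ?C" by (metis card_Union_disjoint)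
    moreover have "p dvd sum card ?C"
      using * card_orb by (intro dvd_sum) auto
    ultimately have 1: "p dvd card (K - {\<one>})" by simp
    have "card K dvd p ^ k"
      using lagrange[OF K.subgroup_axioms] p(2) by (metis dvd_triv_right)
    then obtain i where i: "card K = p ^ i" using p(1) divides_primepow_nat by blast
    have "i \<noteq> 0"
    proof
      assume "i = 0"
      then have "card K = 1" using i by simp
      then show False using K(2) K.one_closed by (metis card_1_singletonE singletonD)
    qed
    then have "p dvd card K" using i by simp
    moreover have "card K = Suc (card (K - {\<one>}))"
      using finK K.one_closed by (metis card_Suc_Diff1)
    ultimately have "p dvd 1" using 1 by (metis dvd_add_right_iff Suc_eq_plus1)
    then show False using p(1) by simp
  qed
  then obtain y where y: "y \<in> K" "y \<noteq> \<one>" "card (orbit G \<phi> y) = 1" by blast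
  have yc: "y \<in> carrier G" using y(1) by (rule K.mem_carrier)
  have central_y: "g \<otimes> y = y \<otimes> g" if "g \<in> carrier G" for g
  proof -
    have "y \<in> orbit G \<phi> y" using yc by (rule A.orbit_refl)
    moreover have "g \<otimes> y \<otimes> inv g \<in> orbit G \<phi> y" using orb[OF y(1)] that by blast
    ultimately have "g \<otimes> y \<otimes> inv g = y" using y(3) by (metis card_1_singletonE singletonD)
    then show ?thesis using that yc by (metis inv_solve_right m_closed)
  qed
  have central: "g \<otimes> y [^] n = y [^] n \<otimes> g" if "g \<in> carrier G" for g and n :: nat
    using group_commutes_pow[OF central_y[OF that, symmetric] yc that] by simp
  have "y [^] (p ^ k) = \<one>" using pow_order_eq_1[OF yc] p(2) by simp
  \<comment> \<open>With \<open>m\<close> the least exponent such that the \<open>p ^ m\<close>-th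
    power of \<open>y\<close> is trivial, the power with exponent \<open>p ^ (m - 1)\<close> is
    nontrivial, but its own \<open>p\<close>-th power is trivial.\<close>
  define m where "m = (LEAST m. y [^] (p ^ m) = \<one>)"
  have m: "y [^] (p ^ m) = \<one>" unfolding m_def by (rule LeastI) fact
  have "m \<noteq> 0" using m y(2) yc by (metis nat_pow_eone power_0)
  then obtain l where l: "m = Suc l" by (cases m) auto
  let ?z = "y [^] (p ^ l)"
  have "?z \<noteq> \<one>" using not_less_Least[of l "\<lambda>m. y [^] (p ^ m) = \<one>"] l by (simp add: m_def)
  moreover have "?z [^] p = \<one>" using m l yc by (simp add: nat_pow_pow mult.commute)
  moreover have "?z \<in> K"
  proof -
    have "y [^] (n::nat) \<in> K" for n by (induction n) (use y(1) in auto)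
    then show ?thesis .
  qed
  ultimately show ?thesis using that central by blast
qed

text \<open>\<open>f\<close> is read off from a central subgroup of order \<open>p\<close> in the image of \<open>R\<close> modulo a normal subgroup
  \<open>P\<close> that is maximal among those that contain \<open>N\<close> but not \<open>R\<close>; \<open>h\<close> extends it along representatives of
  the cosets of \<open>R P\<close>.\<close>

lemma (in group) p_group_invariant_function:
  fixes N R :: "'a set"
  assumes order: "order G = CARD('p::prime_card) ^ k" and N: "N \<lhd> G" and R: "R \<lhd> G" and NR: "\<not> R \<subseteq> N"
  obtains h f :: "'a \<Rightarrow> 'p::prime_card mod_ring" where
    "\<And>s y. s \<in> carrier G \<Longrightarrow> y \<in> R \<Longrightarrow> h (s \<otimes> y) = h s + f y"
    "\<And>y z. y \<in> R \<Longrightarrow> z \<in> R \<Longrightarrow> f (y \<otimes> z) = f y + f z"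
    "\<And>s y. s \<in> carrier G \<Longrightarrow> y \<in> R \<Longrightarrow> f (s \<otimes> y \<otimes> inv s) = f y"
    "\<And>y. y \<in> N \<inter> R \<Longrightarrow> f y = 0" "\<exists>y\<in>R. f y \<noteq> 0"
proof -
  let ?p = "CARD('p)"
  have p: "Factorial_Ring.prime ?p" by (rule prime_card)
  have fin: "finite (carrier G)" using order p by (metis order_gt_0_iff_finite prime_gt_0_nat zero_less_power)
  interpret R: normal R G by (rule R)
  let ?F = "{P. P \<lhd> G \<and> N \<subseteq> P \<and> \<not> R \<subseteq> P}"
  have "?F \<subseteq> Pow (carrier G)" using normal_imp_subgroup subgroup.subset by blast
  then have "finite ?F" using fin by (meson finite_Pow_iff finite_subset)
  moreover have "N \<in> ?F" using N NR by blast
  ultimately obtain P where "P \<in> ?F" and max: "\<And>Q. Q \<in> ?F \<Longrightarrow> P \<subseteq> Q \<Longrightarrow> P = Q"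
    by (metis (no_types, lifting) empty_iff finite_has_maximal)
  then have P: "P \<lhd> G" "N \<subseteq> P" "\<not> R \<subseteq> P" by auto
  interpret P: normal P G by (rule P)
  note mult_FactGroup [simp del]
  let ?Q = "G Mod P" and ?c = "\<lambda>a. P #> a"
  interpret Q: group ?Q by (rule P.factorgroup_is_group)
  interpret c: group_hom G ?Q ?c
    by unfold_locales (rule P.r_coset_hom_Mod)
  have c_one: "\<one>\<^bsub>?Q\<^esub> = ?c \<one>" by (simp add: FactGroup_def coset_mult_one P.subset)
  have c_mem: "?c a = ?c \<one> \<longleftrightarrow> a \<in> P" if "a \<in> carrier G" for a
    using coset_join1[OF _ that P.subgroup_axioms] coset_join2[OF that P.subgroup_axioms]
    by (auto simp: coset_mult_one P.subset)
  have surj: "?c ` carrier G = carrier ?Q" by (auto simp: FactGroup_def RCOSETS_def)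
  have "order ?Q dvd ?p ^ k"
    using lagrange[OF P.subgroup_axioms] order by (metis dvd_triv_left order_def FactGroup_def partial_object.select_convs(1))
  then obtain j where j: "order ?Q = ?p ^ j" using p divides_primepow_nat by blast
  have cR: "?c ` R \<lhd> ?Q"
    by (rule R.surj_hom_normal_subgroup[OF c.group_hom_axioms surj])
  have cR1: "?c ` R \<noteq> {\<one>\<^bsub>?Q\<^esub>}"
  proof
    assume "?c ` R = {\<one>\<^bsub>?Q\<^esub>}"
    then have "?c y = ?c \<one>" if "y \<in> R" for y using that c_one by auto
    then have "y \<in> P" if "y \<in> R" for y using that c_mem[OF R.mem_carrier[OF that]] by simp
    then show False using P(3) by auto
  qed
  obtain z where z: "z \<in> ?c ` R" "z \<noteq> \<one>\<^bsub>?Q\<^esub>" "z [^]\<^bsub>?Q\<^esub> ?p = \<one>\<^bsub>?Q\<^esub>"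
      "\<And>g. g \<in> carrier ?Q \<Longrightarrow> g \<otimes>\<^bsub>?Q\<^esub> z = z \<otimes>\<^bsub>?Q\<^esub> g"
    by (rule Q.p_group_normal_meets_center[OF p j cR cR1]) (rule that)
  obtain r where r: "r \<in> R" "z = ?c r" using z(1) by blast
  have zc: "z \<in> carrier ?Q" using r R.mem_carrier c.hom_closed by blast
  have zn: "g \<otimes>\<^bsub>?Q\<^esub> z [^]\<^bsub>?Q\<^esub> n = z [^]\<^bsub>?Q\<^esub> n \<otimes>\<^bsub>?Q\<^esub> g" if "g \<in> carrier ?Q" for g and n :: nat
    using Q.group_commutes_pow[OF z(4)[OF that, symmetric] zc that] by simp
  \<comment> \<open>The preimage of the cyclic group generated by \<open>z\<close>. It is normal
    since \<open>z\<close> is central, and it contains \<open>P\<close> properly because of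
    \<open>r\<close>; the maximality of \<open>P\<close> then forces \<open>R\<close> into
    it.\<close>
  define L where "L = {y \<in> carrier G. \<exists>n::nat. ?c y = z [^]\<^bsub>?Q\<^esub> n}"
  have Lc: "y \<in> carrier G" if "y \<in> L" for y using that by (simp add: L_def)
  have "subgroup L G"
  proof (rule subgroupI)
    show "L \<subseteq> carrier G" using Lc by blast
    have "\<one> \<in> L" unfolding L_def using c.hom_one by (auto intro!: exI[of _ 0])
    then show "L \<noteq> {}" by blast
    fix y assume y: "y \<in> L"
    then obtain n where n: "?c y = z [^]\<^bsub>?Q\<^esub> (n::nat)" by (auto simp: L_def)
    have "z [^]\<^bsub>?Q\<^esub> (n * (?p - 1)) \<otimes>\<^bsub>?Q\<^esub> z [^]\<^bsub>?Q\<^esub> n = z [^]\<^bsub>?Q\<^esub> (?p * n)"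
    proof -
      have "n * (?p - 1) + n = ?p * n"
        using prime_gt_0_nat[OF p] by (cases ?p) (simp_all add: algebra_simps)
      then show ?thesis using zc by (simp add: Q.nat_pow_mult)
    qed
    also have "\<dots> = \<one>\<^bsub>?Q\<^esub>" using z(3) zc by (metis Q.nat_pow_one Q.nat_pow_pow)
    finally have "inv\<^bsub>?Q\<^esub> (?c y) = z [^]\<^bsub>?Q\<^esub> (n * (?p - 1))"
      using n zc Q.inv_equality Q.nat_pow_closed by metis
    moreover have "?c (inv y) = inv\<^bsub>?Q\<^esub> (?c y)" using Lc[OF y] by (rule c.hom_inv)
    ultimately show "inv y \<in> L" using Lc[OF y] unfolding L_def by auto
    fix y' assume y': "y' \<in> L"
    then obtain n' where n': "?c y' = z [^]\<^bsub>?Q\<^esub> (n'::nat)" by (auto simp: L_def)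
    have "?c (y \<otimes> y') = ?c y \<otimes>\<^bsub>?Q\<^esub> ?c y'" using Lc[OF y] Lc[OF y'] by (rule c.hom_mult)
    also have "\<dots> = z [^]\<^bsub>?Q\<^esub> (n + n')" unfolding n n' using zc by (rule Q.nat_pow_mult)
    finally show "y \<otimes> y' \<in> L" using Lc[OF y] Lc[OF y'] unfolding L_def by blast
  qed
  have conj: "?c (s \<otimes> y \<otimes> inv s) = ?c y" if s: "s \<in> carrier G" and y: "y \<in> L" for s y
  proof -
    obtain n where n: "?c y = z [^]\<^bsub>?Q\<^esub> (n::nat)" using y by (auto simp: L_def)
    have sc: "?c s \<in> carrier ?Q" using s by (rule c.hom_closed)
    have yc: "?c y \<in> carrier ?Q" using Lc[OF y] by (rule c.hom_closed)
    have "?c (s \<otimes> y \<otimes> inv s) = ?c s \<otimes>\<^bsub>?Q\<^esub> ?c y \<otimes>\<^bsub>?Q\<^esub> inv\<^bsub>?Q\<^esub> ?c s"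
      using s Lc[OF y] c.hom_mult c.hom_inv by simp
    also have "?c s \<otimes>\<^bsub>?Q\<^esub> ?c y = ?c y \<otimes>\<^bsub>?Q\<^esub> ?c s" unfolding n by (rule zn[OF sc])
    also have "\<dots> \<otimes>\<^bsub>?Q\<^esub> inv\<^bsub>?Q\<^esub> ?c s = ?c y"
      using sc yc by (metis Q.inv_closed Q.m_assoc Q.r_inv Q.r_one)
    finally show ?thesis .
  qed
  have "L \<lhd> G"
  proof (rule normal_invI[OF \<open>subgroup L G\<close>])
    fix s y assume s: "s \<in> carrier G" and y: "y \<in> L"
    obtain n where "?c y = z [^]\<^bsub>?Q\<^esub> (n::nat)" using y by (auto simp: L_def)
    then have "?c (s \<otimes> y \<otimes> inv s) = z [^]\<^bsub>?Q\<^esub> n" by (simp only: conj[OF s y])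
    moreover have "s \<otimes> y \<otimes> inv s \<in> carrier G" using s Lc[OF y] by simp
    ultimately show "s \<otimes> y \<otimes> inv s \<in> L" unfolding L_def by blast
  qed
  interpret L: normal L G by fact
  have PL: "P \<subseteq> L"
  proof
    fix y assume y: "y \<in> P"
    then have "?c y = z [^]\<^bsub>?Q\<^esub> (0::nat)" using c_mem[of y] c_one P.mem_carrier by auto
    then show "y \<in> L" using y P.mem_carrier unfolding L_def by blast
  qed
  have rc: "r \<in> carrier G" using r(1) by (rule R.mem_carrier)
  have cr: "?c r = z [^]\<^bsub>?Q\<^esub> (1::nat)" unfolding r(2)[symmetric] Q.nat_pow_eone[OF zc] ..
  have rL: "r \<in> L" using rc cr unfolding L_def by blast
  have "r \<notin> P" using c_mem[OF rc] c_one r z(2) by metis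
  then have "P \<noteq> L" using rL by blast
  have RL: "R \<subseteq> L"
  proof (rule ccontr)
    assume "\<not> R \<subseteq> L"
    then have "L \<in> ?F" using \<open>L \<lhd> G\<close> P(2) PL by blast
    then show False using max PL \<open>P \<noteq> L\<close> by blast
  qed
  have eq: "(of_nat m :: 'p mod_ring) = of_nat n" if "z [^]\<^bsub>?Q\<^esub> m = z [^]\<^bsub>?Q\<^esub> n" for m n
  proof -
    have *: "(of_nat m :: 'p mod_ring) = of_nat n" if mn: "z [^]\<^bsub>?Q\<^esub> m = z [^]\<^bsub>?Q\<^esub> n" "m \<le> n" for m n
    proof -
      have "z [^]\<^bsub>?Q\<^esub> m \<otimes>\<^bsub>?Q\<^esub> z [^]\<^bsub>?Q\<^esub> (n - m) = z [^]\<^bsub>?Q\<^esub> m"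
        by (simp only: Q.nat_pow_mult[OF zc] le_add_diff_inverse[OF mn(2)] mn(1)[symmetric])
      then have "z [^]\<^bsub>?Q\<^esub> (n - m) = \<one>\<^bsub>?Q\<^esub>"
        by (subst (asm) Q.l_cancel_one) (use zc in simp_all)
      then have "Q.ord z dvd n - m" using zc Q.pow_eq_id by blast
      moreover have "Q.ord z = ?p"
      proof -
        have "Q.ord z dvd ?p" using z(3) zc Q.pow_eq_id by blast
        moreover have "Q.ord z \<noteq> 1"
        proof
          assume "Q.ord z = 1"
          then have "z [^]\<^bsub>?Q\<^esub> (1::nat) = \<one>\<^bsub>?Q\<^esub>" unfolding Q.pow_eq_id[OF zc] by simp
          then show False using z(2) unfolding Q.nat_pow_eone[OF zc] by simp
        qed
        ultimately show ?thesis using p unfolding prime_nat_iff by blast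
      qed
      ultimately obtain c where "n - m = ?p * c" by auto
      then have "n = m + ?p * c" using mn(2) by simp
      then show ?thesis by simp
    qed
    show ?thesis
    proof (cases "m \<le> n")
      case True
      then show ?thesis by (rule *[OF that])
    next
      case False
      then have "n \<le> m" by simp
      from *[OF that[symmetric] this] show ?thesis by (rule sym)
    qed
  qed
  \<comment> \<open>On \<open>L\<close> this is the discrete logarithm of the coset of
    \<open>y\<close> to the base \<open>z\<close>. Its value in \<open>F_p\<close> does not depend
    on the chosen exponent, by \<open>eq\<close>, since \<open>z\<close> has order
    \<open>p\<close>.\<close>
  define f :: "'a \<Rightarrow> 'p mod_ring" where "f y = of_nat (SOME n. ?c y = z [^]\<^bsub>?Q\<^esub> (n::nat))" for y
  have f: "f y = of_nat n" if "?c y = z [^]\<^bsub>?Q\<^esub> n" for y and n :: nat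
    unfolding f_def by (rule eq) (metis (mono_tags, lifting) someI_ex that)
  have f_add: "f (y \<otimes> y') = f y + f y'" if y: "y \<in> L" "y' \<in> L" for y y'
  proof -
    obtain n where n1: "?c y = z [^]\<^bsub>?Q\<^esub> (n::nat)" using y(1) unfolding L_def by blast
    obtain n' where n2: "?c y' = z [^]\<^bsub>?Q\<^esub> (n'::nat)" using y(2) unfolding L_def by blast
    note n = n1 n2
    have "?c (y \<otimes> y') = ?c y \<otimes>\<^bsub>?Q\<^esub> ?c y'" using Lc[OF y(1)] Lc[OF y(2)] by (rule c.hom_mult)
    also have "\<dots> = z [^]\<^bsub>?Q\<^esub> (n + n')" unfolding n using zc by (rule Q.nat_pow_mult)
    finally show ?thesis using f[OF n(1)] f[OF n(2)] by (simp only: f of_nat_add)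
  qed
  have f_conj: "f (s \<otimes> y \<otimes> inv s) = f y" if "s \<in> carrier G" "y \<in> L" for s y
    using conj[OF that] by (simp add: f_def)
  have f_P: "f y = 0" if "y \<in> P" for y
  proof -
    have "?c y = ?c \<one>" using c_mem[OF P.mem_carrier[OF that]] that by simp
    then have "?c y = z [^]\<^bsub>?Q\<^esub> (0::nat)" by (simp only: Q.nat_pow_0 c_one)
    from f[OF this] show ?thesis by simp
  qed
  have f_r: "f r = 1" using f[OF cr] by (simp only: of_nat_1)
  define rep where "rep C = (SOME t. t \<in> C)" for C :: "'a set"
  \<comment> \<open>On the carrier the argument of \<open>f\<close> is the deviation of
    \<open>s\<close> from the representative of its coset, an element of \<open>L\<close>. Left
    cosets are used because multiplying \<open>s\<close> by an element of \<open>L\<close> on the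
    right must not change the representative.\<close>
  define h where "h s = f (inv (rep (s <# L)) \<otimes> s)" for s
  have h_add: "h (s \<otimes> y) = h s + f y" if s: "s \<in> carrier G" and y: "y \<in> L" for s y
  proof -
    have "s \<otimes> y \<in> s <# L" using y by (auto simp: l_coset_def)
    then have eqC: "s \<otimes> y <# L = s <# L"
      using l_repr_independence[OF _ s L.subgroup_axioms] by simp
    have "s \<in> s <# L" using s L.one_closed by (force simp: l_coset_def)
    then have "rep (s <# L) \<in> s <# L" unfolding rep_def by (metis someI)
    then obtain u where u: "u \<in> L" "rep (s <# L) = s \<otimes> u" by (auto simp: l_coset_def)
    have "inv (rep (s <# L)) \<otimes> s = inv u"
      using u(2) s Lc[OF u(1)] by (simp add: inv_mult_group m_assoc)
    then have "inv (rep (s <# L)) \<otimes> s \<in> L" using u(1) by simp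
    then have "f ((inv (rep (s <# L)) \<otimes> s) \<otimes> y) = h s + f y" using y unfolding h_def by (rule f_add)
    moreover have "(inv (rep (s <# L)) \<otimes> s) \<otimes> y = inv (rep (s <# L)) \<otimes> (s \<otimes> y)"
      using u s y Lc by (simp add: m_assoc)
    ultimately show ?thesis by (simp add: h_def eqC)
  qed
  show ?thesis
  proof (rule that[of h f])
    show "\<exists>y\<in>R. f y \<noteq> 0" using r(1) f_r by (intro bexI[of _ r]) auto
    show "h (s \<otimes> y) = h s + f y" if "s \<in> carrier G" "y \<in> R" for s y
      using that(1) subsetD[OF RL that(2)] by (rule h_add)
    show "f (y \<otimes> z) = f y + f z" if "y \<in> R" "z \<in> R" for y z
      using subsetD[OF RL that(1)] subsetD[OF RL that(2)] by (rule f_add)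
    show "f (s \<otimes> y \<otimes> inv s) = f y" if "s \<in> carrier G" "y \<in> R" for s y
      using that(1) subsetD[OF RL that(2)] by (rule f_conj)
    show "f y = 0" if "y \<in> N \<inter> R" for y
      using that P(2) by (intro f_P) blast
  qed
qed

section \<open>Coefficients of the Magnus map and the Zassenhaus filtration\<close>

text \<open>Every scalar of a prime field is a natural multiple of 1, so additive closure already
  gives closure under scalars.\<close>

lemma additive_closed_mod_ring:
  fixes M :: "('i \<Rightarrow> 'p::prime_card mod_ring) set"
  assumes "(\<lambda>_. 0) \<in> M" "\<And>f g. f \<in> M \<Longrightarrow> g \<in> M \<Longrightarrow> (\<lambda>i. f i + g i) \<in> M" "f \<in> M"
  shows "(\<lambda>i. c * f i) \<in> M"
proof -
  obtain n where "c = of_nat n" using surj_of_nat_mod_ring by blast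
  moreover have "(\<lambda>i. of_nat n * f i) \<in> M"
    by (induction n) (use assms in \<open>auto simp: distrib_right\<close>)
  ultimately show ?thesis by simp
qed

lemma separating_functional:
  fixes M :: "('i \<Rightarrow> 'p::prime_card mod_ring) set"
  assumes "finite A" "(\<lambda>_. 0) \<in> M" "\<And>f g. f \<in> M \<Longrightarrow> g \<in> M \<Longrightarrow> (\<lambda>i. f i + g i) \<in> M"
    and "\<And>f i. f \<in> M \<Longrightarrow> i \<notin> A \<Longrightarrow> f i = 0" "\<And>i. i \<notin> A \<Longrightarrow> F i = 0" "F \<notin> M"
  shows "\<exists>W. (\<forall>f\<in>M. (\<Sum>i\<in>A. f i * W i) = 0) \<and> (\<Sum>i\<in>A. F i * W i) \<noteq> 0"
  using assms
proof (induction A arbitrary: M F rule: finite_induct)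
  case empty
  then have "F = (\<lambda>_. 0)" by auto
  then show ?case using empty by auto
next
  case (insert a A)
  note zero = insert.prems(1) and add = insert.prems(2) and suppM = insert.prems(3)
    and suppF = insert.prems(4) and F = insert.prems(5)
  have scale: "(\<lambda>i. c * f i) \<in> M" if "f \<in> M" for c f
    by (rule additive_closed_mod_ring[OF zero add that])
  show ?case
  proof (cases "\<exists>m\<in>M. m a \<noteq> 0")
    case True
    then obtain m where m: "m \<in> M" "m a \<noteq> 0" by blast
    define m0 where "m0 = (\<lambda>i. inverse (m a) * m i)"
    have m0: "m0 \<in> M" "m0 a = 1" unfolding m0_def using scale m by auto
    let ?M = "{f \<in> M. f a = 0}" and ?F = "\<lambda>i. F i + (- F a) * m0 i"
    have F_eq: "(\<lambda>i. ?F i + F a * m0 i) = F" by auto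
    have "?F \<notin> M"
      using add[of ?F "\<lambda>i. F a * m0 i"] scale[OF m0(1), of "F a"] F unfolding F_eq by blast
    then have "\<exists>W. (\<forall>f\<in>?M. (\<Sum>i\<in>A. f i * W i) = 0) \<and> (\<Sum>i\<in>A. ?F i * W i) \<noteq> 0"
    proof (intro insert.IH)
      show "f i = 0" if "f \<in> ?M" "i \<notin> A" for f i
        using suppM[of f i] that by (cases "i = a") auto
      show "?F i = 0" if "i \<notin> A" for i
        using suppF[of i] suppM[OF m0(1), of i] that m0(2) by (cases "i = a") auto
    qed (use zero add in auto)
    then obtain W where W: "\<And>f. f \<in> M \<Longrightarrow> f a = 0 \<Longrightarrow> (\<Sum>i\<in>A. f i * W i) = 0" "(\<Sum>i\<in>A. ?F i * W i) \<noteq> 0"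
      by blast
    \<comment> \<open>The value at \<open>a\<close> is the one for which the pivot \<open>m0\<close>
      pairs to 0. Pairing any \<open>f\<close> with \<open>?W\<close> then amounts to pairing its
      reduction by \<open>m0\<close> with \<open>W\<close>.\<close>
    let ?W = "W(a := - (\<Sum>i\<in>A. m0 i * W i))"
    have sum: "(\<Sum>i\<in>insert a A. f i * ?W i) = (\<Sum>i\<in>A. (f i + (- f a) * m0 i) * W i)" for f
    proof -
      have "(\<Sum>i\<in>A. f i * ?W i) = (\<Sum>i\<in>A. f i * W i)"
        by (rule sum.cong) (use insert.hyps in auto)
      then show ?thesis
        using insert.hyps by (simp add: algebra_simps sum_subtractf sum_distrib_left)
    qed
    have "(\<Sum>i\<in>insert a A. f i * ?W i) = 0" if "f \<in> M" for f
      unfolding sum using add[OF that scale[OF m0(1), of "- f a"]] m0(2) by (intro W(1)) auto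
    moreover have "(\<Sum>i\<in>insert a A. F i * ?W i) \<noteq> 0" unfolding sum by (rule W(2))
    ultimately show ?thesis by blast
  next
    case False
    show ?thesis
    proof (cases "F a = 0")
      case True
      have "\<exists>W. (\<forall>f\<in>M. (\<Sum>i\<in>A. f i * W i) = 0) \<and> (\<Sum>i\<in>A. F i * W i) \<noteq> 0" (is "\<exists>W. ?Q W")
      proof (rule insert.IH[OF zero add _ _ F])
        show "f i = 0" if "f \<in> M" "i \<notin> A" for f i
          using suppM[OF that(1), of i] that False by (cases "i = a") auto
        show "F i = 0" if "i \<notin> A" for i using suppF[of i] that True by (cases "i = a") auto
      qed
      then obtain W where "?Q W" ..
      then show ?thesis using insert.hyps False True by (intro exI[of _ W]) auto
    next
      case nz: False
      let ?W = "(\<lambda>i. if i = a then 1 else 0)"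
      have "(\<Sum>i\<in>insert a A. f i * ?W i) = f a" for f :: "'i \<Rightarrow> 'p mod_ring"
        using insert.hyps by (simp add: if_distrib[of "\<lambda>c. f _ * c"] sum.delta cong: if_cong)
      then show ?thesis using nz False by (intro exI[of _ ?W]) auto
    qed
  qed
qed

text \<open>The tool for every upper bound on the filtration: one unfolding of the recursion, fed
  with what is known about the lower terms. A closed subgroup that contains the generators contains
  the closure of the subgroup they generate.\<close>

lemma zassenhaus_subset_closed_subgroup:
  assumes T: "topspace T = carrier S" and S: "group S" and n: "n \<ge> 2" and p: "p \<ge> 2"
    and H: "subgroup H S" "closedin T H"
    and pow: "\<And>a. a \<in> zassenhaus p S T (nat \<lceil>real n / real p\<rceil>) \<Longrightarrow> a [^]\<^bsub>S\<^esub> p \<in> H"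
    and comm: "\<And>i a b. 1 \<le> i \<Longrightarrow> i < n \<Longrightarrow> a \<in> zassenhaus p S T i \<Longrightarrow> b \<in> zassenhaus p S T (n - i) \<Longrightarrow>
       a \<otimes>\<^bsub>S\<^esub> b \<otimes>\<^bsub>S\<^esub> inv\<^bsub>S\<^esub> a \<otimes>\<^bsub>S\<^esub> inv\<^bsub>S\<^esub> b \<in> H"
  shows "zassenhaus p S T n \<subseteq> H"
proof -
  interpret group S by (rule S)
  have eq: "zassenhaus p S T n = T closure_of (generate S
        ((\<lambda>a. a [^]\<^bsub>S\<^esub> p) ` zassenhaus p S T (nat \<lceil>real n / real p\<rceil>) \<union>
         (\<Union>i\<in>{1..<n}. \<Union>a\<in>zassenhaus p S T i. \<Union>b\<in>zassenhaus p S T (n - i).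
            {a \<otimes>\<^bsub>S\<^esub> b \<otimes>\<^bsub>S\<^esub> inv\<^bsub>S\<^esub> a \<otimes>\<^bsub>S\<^esub> inv\<^bsub>S\<^esub> b})))" (is "_ = T closure_of (generate S ?X)")
    using n p by (subst zassenhaus.simps) auto
  have "?X \<subseteq> H" using pow comm by auto
  then have "generate S ?X \<subseteq> H" by (rule generate_subgroup_incl[OF _ H(1)])
  then show ?thesis unfolding eq using H(2) by (rule closure_of_minimal)
qed

lemma zassenhaus_subset_carrier:
  assumes "topspace T = carrier S"
  shows "zassenhaus p S T n \<subseteq> carrier S"
  using closure_of_subset_topspace[of T] assms by (subst zassenhaus.simps) auto

section \<open>The Magnus coefficients of degree 1 and 2\<close>

locale magnus_coefficients =
  fixes S :: "'s monoid" (structure) and T :: "'s topology" and d :: nat and x :: "nat \<Rightarrow> 's"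
    and \<mu> :: "'s \<Rightarrow> nat list \<Rightarrow> 'p::prime_card mod_ring"
  defines "\<mu> \<equiv> magnus S T d x"
  assumes free: "free_pro_p_group CARD('p) S T d x"
begin

lemma pro_p: "pro_p_group CARD('p) S T" by (rule free_pro_p_groupD[OF free])

sublocale group S by (rule pro_p_groupD[OF pro_p])

lemma topspace_eq: "topspace T = carrier S" by (rule pro_p_groupD[OF pro_p])

definition a :: "nat \<Rightarrow> 's \<Rightarrow> 'p mod_ring" where "a i s = \<mu> s [i]"
definition b :: "nat \<Rightarrow> nat \<Rightarrow> 's \<Rightarrow> 'p mod_ring" where "b i j s = \<mu> s [i, j]"

lemma a_mult: "s \<in> carrier S \<Longrightarrow> t \<in> carrier S \<Longrightarrow> a i (s \<otimes> t) = a i s + a i t"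
  unfolding a_def \<mu>_def
  by (simp add: magnus_properties[OF free] word_times_Cons)

lemma b_mult:
  "s \<in> carrier S \<Longrightarrow> t \<in> carrier S \<Longrightarrow> b i j (s \<otimes> t) = b i j s + b i j t + a i s * a j t"
  unfolding a_def b_def \<mu>_def
  by (simp add: magnus_properties[OF free] word_times_Cons)

lemma continuous_a: "continuous_map T discrete (a i)"
  unfolding a_def[abs_def] \<mu>_def by (rule magnus_properties[OF free])

lemma continuous_b: "continuous_map T discrete (b i j)"
  unfolding b_def[abs_def] \<mu>_def by (rule magnus_properties[OF free])

lemma a_x: "i < d \<Longrightarrow> j < d \<Longrightarrow> a i (x j) = (if i = j then 1 else 0)"
  unfolding a_def \<mu>_def by (rule magnus_properties[OF free])

lemma b_outside: "s \<in> carrier S \<Longrightarrow> \<not> (i < d \<and> j < d) \<Longrightarrow> b i j s = 0"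
  using magnus_properties(1)[OF free, of s] by (force simp: b_def \<mu>_def)

lemma hom_one_inv:
  fixes h :: "'s \<Rightarrow> 'p mod_ring"
  assumes "\<And>s t. s \<in> carrier S \<Longrightarrow> t \<in> carrier S \<Longrightarrow> h (s \<otimes> t) = h s + h t"
  shows "h \<one> = 0" "s \<in> carrier S \<Longrightarrow> h (inv s) = - h s" "s \<in> carrier S \<Longrightarrow> h (s [^] (n::nat)) = of_nat n * h s"
proof -
  show one: "h \<one> = 0" using assms[OF one_closed one_closed] by (metis add_cancel_right_right l_one one_closed)
  show "h (inv s) = - h s" if "s \<in> carrier S"
    using assms[of s "inv s"] that one by (simp add: eq_neg_iff_add_eq_0 add.commute)
  show "h (s [^] n) = of_nat n * h s" if "s \<in> carrier S"
    by (induction n) (use that one assms in \<open>simp_all add: algebra_simps\<close>)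
qed

lemmas a_simps = a_mult hom_one_inv[where h = "a i" for i, OF a_mult]

text \<open>The target \<open>F_p\<close> is abelian of exponent \<open>p\<close>, so
  \<open>h\<close> kills all \<open>p\<close>-th powers and all commutators. Of the lower terms only
  their inclusion in \<open>S\<close> is used.\<close>

lemma hom_vanishes_on_zassenhaus:
  assumes h: "continuous_map T discrete h"
      "\<And>s t. s \<in> carrier S \<Longrightarrow> t \<in> carrier S \<Longrightarrow> h (s \<otimes> t) = h s + h t"
    and n: "n \<ge> 2" and s: "s \<in> zassenhaus CARD('p) S T n"
  shows "h s = (0 :: 'p mod_ring)"
proof -
  let ?H = "{s \<in> carrier S. h s = 0}" and ?Z = "zassenhaus CARD('p) S T"
  note h_simps = h(2) hom_one_inv[where h = h, OF h(2)]
  have Z: "t \<in> carrier S" if "t \<in> ?Z m" for t m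
    using that zassenhaus_subset_carrier[OF topspace_eq] by blast
  have "?Z n \<subseteq> ?H"
  proof (rule zassenhaus_subset_closed_subgroup[OF topspace_eq group_axioms n])
    show "CARD('p) \<ge> 2" using prime_card prime_ge_2_nat by blast
    show "subgroup ?H S" by (rule subgroupI) (use h_simps in auto)
    show "closedin T ?H" using closedin_discrete_vimage[OF h(1), of "{0}"] by (simp add: topspace_eq)
    show "t [^] CARD('p) \<in> ?H" if "t \<in> ?Z (nat \<lceil>real n / real CARD('p)\<rceil>)" for t
      using Z[OF that] by (simp add: h_simps)
    show "t \<otimes> u \<otimes> inv t \<otimes> inv u \<in> ?H" if "t \<in> ?Z i" "u \<in> ?Z (n - i)" for t u i
      using Z[OF that(1)] Z[OF that(2)] by (simp add: h_simps)
  qed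
  then show ?thesis using s by blast
qed

lemma a_vanishes_on_zassenhaus:
  assumes "n \<ge> 2" "s \<in> zassenhaus CARD('p) S T n"
  shows "a i s = 0"
  by (rule hom_vanishes_on_zassenhaus[where h = "a i", OF continuous_a a_mult assms])

text \<open>Iterating \<open>b_mult\<close> collects one product \<open>a i s * a j s\<close> for
  each pair of positions among the \<open>n\<close> factors, which explains the binomial
  coefficient.\<close>

lemma b_pow:
  assumes "s \<in> carrier S"
  shows "b i j (s [^] (n::nat)) = of_nat n * b i j s + of_nat (n choose 2) * (a i s * a j s)"
proof (induction n)
  case (Suc n)
  have "b i j (s [^] Suc n) = b i j (s [^] n) + b i j s + of_nat n * a i s * a j s"
    using assms by (simp add: b_mult a_simps)
  moreover have "(of_nat (Suc n choose 2) :: 'p mod_ring) = of_nat (n choose 2) + of_nat n"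
    unfolding numeral_2_eq_2 by simp
  ultimately show ?case by (simp add: Suc distrib_right distrib_left mult.assoc del: binomial_Suc_n)
next
  case 0
  have "b i j \<one> = b i j \<one> + b i j \<one>"
    using b_mult[OF one_closed one_closed, of i j] by (simp add: a_simps)
  then have "b i j \<one> = 0" by (metis add_cancel_right_right)
  then show ?case by (simp add: binomial_eq_0)
qed

lemma b_one: "b i j \<one> = 0"
  using b_pow[OF one_closed, of i j 0] by (simp add: binomial_eq_0)

text \<open>The condition on all \<open>a i\<close> belongs to \<open>?H\<close> because the
  functions \<open>b i j\<close> are additive only up to products of values of the
  \<open>a i\<close>; the zero set of the \<open>b i j\<close> alone need not be a subgroup.\<close>

lemma b_vanishes_on_zassenhaus:
  assumes n: "n \<ge> 3" and s: "s \<in> zassenhaus CARD('p) S T n"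
  shows "b i j s = 0"
proof -
  let ?p = "CARD('p)" and ?Z = "zassenhaus CARD('p) S T"
  let ?H = "{s \<in> carrier S. (\<forall>i. a i s = 0) \<and> (\<forall>i j. b i j s = 0)}"
  have p2: "?p \<ge> 2" using prime_card prime_ge_2_nat by blast
  have Z: "t \<in> carrier S" if "t \<in> ?Z m" for t m
    using that zassenhaus_subset_carrier[OF topspace_eq] by blast
  have b_inv: "b i j (inv t) = - b i j t + a i t * a j t" if "t \<in> carrier S" for i j t
    using b_mult[of t "inv t" i j] that by (simp add: a_simps b_one eq_neg_iff_add_eq_0 algebra_simps)
  have "?Z n \<subseteq> ?H"
  proof (rule zassenhaus_subset_closed_subgroup[OF topspace_eq group_axioms _ p2])
    show "subgroup ?H S"
    proof (rule subgroupI)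
      have "\<one> \<in> ?H" by (simp add: a_simps b_one)
      then show "?H \<noteq> {}" by blast
    qed (simp_all add: a_simps b_mult b_inv subset_eq)
    have closed: "closedin T {s \<in> carrier S. a i s \<in> {0}}" "closedin T {s \<in> carrier S. b i j s \<in> {0}}" for i j
      unfolding topspace_eq[symmetric]
      by (rule closedin_discrete_vimage, rule continuous_a continuous_b)+
    have "closedin T (carrier S)" using closedin_topspace[of T] by (simp only: topspace_eq)
    note closed = closed this
    have "?H = carrier S \<inter> (\<Inter>i. {s \<in> carrier S. a i s \<in> {0}}) \<inter> (\<Inter>i j. {s \<in> carrier S. b i j s \<in> {0}})"
      by auto
    moreover have "closedin T \<dots>"
      by (intro closedin_Int closedin_INT closed) simp_all
    ultimately show "closedin T ?H" by metis
  next
    fix t assume t: "t \<in> ?Z (nat \<lceil>real n / real ?p\<rceil>)"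
    have tc: "t \<in> carrier S" by (rule Z[OF t])
    \<comment> \<open>For odd \<open>p\<close> the binomial coefficient is divisible by
      \<open>p\<close>. For \<open>p = 2\<close> it is 1, but then \<open>n \<ge> 3\<close> gives
      \<open>\<lceil>n / 2\<rceil> \<ge> 2\<close>, so the elements to be squared have vanishing
      \<open>a i\<close>.\<close>
    have "of_nat (?p choose 2) * (a i t * a j t) = 0" for i j
    proof (cases "?p = 2")
      case True
      then have "2 \<le> nat \<lceil>real n / real ?p\<rceil>" using n by simp linarith
      then have "a i t = 0" for i using t by (rule a_vanishes_on_zassenhaus)
      then show ?thesis by simp
    next
      case False
      then have "?p dvd (?p choose 2)" using p2 prime_card by (intro dvd_choose_prime) auto
      then show ?thesis by auto
    qed
    then have "b i j (t [^] ?p) = 0" for i j using b_pow[OF tc, of i j ?p] by simp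
    then show "t [^] ?p \<in> ?H" using tc a_simps(4) by auto
  next
    fix k t u assume k: "1 \<le> k" "k < n" and t: "t \<in> ?Z k" and u: "u \<in> ?Z (n - k)"
    have tc: "t \<in> carrier S" and uc: "u \<in> carrier S" using t u Z by blast+
    \<comment> \<open>The indices \<open>k\<close> and \<open>n - k\<close> add up to at least 3, so
      one of them is at least 2. The degree 2 coefficient of a commutator is bilinear in the linear
      coefficients of the two elements, hence it vanishes.\<close>
    have "(\<forall>i. a i t = 0) \<or> (\<forall>i. a i u = 0)"
    proof (cases "k \<ge> 2")
      case True then show ?thesis using a_vanishes_on_zassenhaus[OF _ t] by blast
    next
      case False
      then have "n - k \<ge> 2" using n by simp
      then show ?thesis using a_vanishes_on_zassenhaus[OF _ u] by blast
    qed
    then have "b i j (t \<otimes> u \<otimes> inv t \<otimes> inv u) = 0" for i j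
      by (elim disjE) (simp_all add: b_mult a_simps b_inv tc uc)
    then show "t \<otimes> u \<otimes> inv t \<otimes> inv u \<in> ?H" using tc uc by (simp add: a_simps)
  qed (use n in simp)
  then show ?thesis using s by blast
qed

definition beta :: "(nat list \<Rightarrow> 'p mod_ring) \<Rightarrow> 's \<Rightarrow> 'p mod_ring" where
  "beta W s = (\<Sum>i<d. \<Sum>j<d. W [i, j] * b i j s)"

lemma continuous_beta: "continuous_map T discrete (beta W)"
proof -
  have "continuous_map T discrete (\<lambda>s. W [i, j] * b i j s)" for i j
    by (rule continuous_map_discrete_op[OF continuous_b, where h = "\<lambda>c. W [i, j] * c"])
  then show ?thesis unfolding beta_def[abs_def] by (intro continuous_map_discrete_sum)
qed

lemma beta_mult:
  assumes "s \<in> carrier S" "t \<in> carrier S"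
  shows "beta W (s \<otimes> t) = beta W s + beta W t + (\<Sum>i<d. \<Sum>j<d. W [i, j] * (a i s * a j t))"
  unfolding beta_def using assms by (simp add: b_mult distrib_left sum.distrib)

end

section \<open>Cochains of low degree\<close>

abbreviation nc_word :: "nat list \<Rightarrow> nat list \<Rightarrow> 'k::comm_ring_1" where
  "nc_word w \<equiv> (\<lambda>u. if u = w then 1 else 0)"

lemma nc_word_Cons: "(nc_word (i # w) :: nat list \<Rightarrow> 'k::comm_ring_1) = word_times (ncvar i) (nc_word w)"
proof
  fix u :: "nat list"
  show "nc_word (i # w) u = (word_times (ncvar i) (nc_word w) u :: 'k)"
  proof (cases u)
    case (Cons j v)
    have "word_times (\<lambda>u. ncvar i (j # u)) (nc_word w) v
        = (if j = i then nc_word w v else (0 :: 'k))"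
    proof (cases "j = i")
      case True
      then have "(\<lambda>u. ncvar i (j # u)) = (\<lambda>w. if w = [] then 1 else (0::'k))" by (auto simp: ncvar_def)
      then show ?thesis unfolding True by (simp only: word_times_one_left) simp
    next
      case False
      then show ?thesis by (simp add: ncvar_def word_times_def)
    qed
    then show ?thesis using Cons by (simp add: word_times_Cons) (simp add: ncvar_def)
  qed (simp add: ncvar_def)
qed

lemma ncvar_closed: "i < d \<Longrightarrow> ncvar i \<in> carrier (ncpoly d)"
  by (auto simp: ncvar_def split: if_splits)

lemma nc_word_closed: "set w \<subseteq> {..<d} \<Longrightarrow> nc_word w \<in> carrier (ncpoly d)"
  by (auto split: if_splits)

lemma ncpoly_add_closed:
  assumes "f \<in> carrier (ncpoly d)" "g \<in> carrier (ncpoly d)"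
  shows "(\<lambda>w. f w + g w) \<in> carrier (ncpoly d)"
proof -
  interpret ring "ncpoly d :: (nat list \<Rightarrow> 'a) ring" by (rule ring_ncpoly)
  show ?thesis using a_closed[OF assms] by (simp only: ncpoly_simps)
qed

text \<open>Coefficients in \<open>F_p\<close> are natural multiples of 1, so every polynomial is a
  sum of words and scalars need no case of their own. The set \<open>A\<close> confines the words,
  for instance to those of length 2.\<close>

lemma ncpoly_induct [consumes 2, case_names zero word add]:
  fixes F :: "nat list \<Rightarrow> 'p::prime_card mod_ring"
  assumes F: "F \<in> carrier (ncpoly d)" "\<forall>w. F w \<noteq> 0 \<longrightarrow> w \<in> A"
    and zero: "P (\<lambda>_. 0)" and word: "\<And>w. set w \<subseteq> {..<d} \<Longrightarrow> w \<in> A \<Longrightarrow> P (nc_word w)"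
    and add: "\<And>f g. f \<in> carrier (ncpoly d) \<Longrightarrow> g \<in> carrier (ncpoly d) \<Longrightarrow> P f \<Longrightarrow> P g \<Longrightarrow> P (\<lambda>w. f w + g w)"
  shows "P F"
proof -
  have word_multiple: "P (\<lambda>u. of_nat n * nc_word w u) \<and>
      (\<lambda>u. of_nat n * nc_word w u :: 'p mod_ring) \<in> carrier (ncpoly d)"
    if w: "set w \<subseteq> {..<d}" "w \<in> A" for w and n :: nat
  proof (induction n)
    case 0
    then show ?case using zero by simp
  next
    case (Suc n)
    have eq: "(\<lambda>u. of_nat (Suc n) * nc_word w u) = (\<lambda>u. nc_word w u + of_nat n * nc_word w u :: 'p mod_ring)"
      by (auto simp: algebra_simps)
    have c: "nc_word w \<in> carrier (ncpoly d :: (nat list \<Rightarrow> 'p mod_ring) ring)"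
      "(\<lambda>u. of_nat n * nc_word w u) \<in> carrier (ncpoly d :: (nat list \<Rightarrow> 'p mod_ring) ring)"
      using nc_word_closed[OF w(1)] Suc.IH by blast+
    have "P (\<lambda>u. of_nat n * nc_word w u)" using Suc.IH by blast
    with add c word[OF w] have "P (\<lambda>u. nc_word w u + of_nat n * nc_word w u)" by blast
    then show ?case
      unfolding eq using ncpoly_add_closed[OF c] by blast
  qed
  have "P F" if "finite B" "{w. F w \<noteq> 0} = B" "F \<in> carrier (ncpoly d)" "\<forall>w. F w \<noteq> 0 \<longrightarrow> w \<in> A" for B F
    using that
  proof (induction B arbitrary: F rule: finite_induct)
    case empty
    then have "F = (\<lambda>_. 0)" by auto
    then show ?case using zero by simp
  next
    case (insert v B)
    obtain n where n: "F v = of_nat n" using surj_of_nat_mod_ring by blast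
    let ?F = "\<lambda>w. if w = v then 0 else F w"
    have v: "set v \<subseteq> {..<d}" "v \<in> A" using insert.prems by auto
    have 1: "{w. ?F w \<noteq> 0} = B" using insert.prems(1) insert.hyps(2) by auto
    moreover have 2: "?F \<in> carrier (ncpoly d)"
      using insert.prems(2) insert.hyps(1) 1 by auto
    ultimately have 3: "P ?F" using insert.prems(3) by (intro insert.IH) auto
    have eq: "F = (\<lambda>w. ?F w + of_nat n * nc_word v w)" using n by auto
    show ?case
      by (subst eq, rule add[OF 2]) (use 3 word_multiple[OF v, of n] in blast)+
  qed
  then show ?thesis using F by auto
qed

text \<open>If \<open>F\<close> has no terms of degree below 2, then multiplying it by
  \<open>H\<close> on either side only scales its degree 2 part by \<open>H []\<close>. So the
  polynomials of this kind with degree 2 part in \<open>\<Omega>\<close> form an ideal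
  \<open>?J\<close> containing \<open>\<Omega>\<close>.\<close>

lemma ideal_degree_2_part:
  fixes \<Omega> :: "(nat list \<Rightarrow> 'p::prime_card mod_ring) set"
  assumes \<Omega>: "\<Omega> \<subseteq> ncpoly_deg d 2" "additive_subgroup \<Omega> (ncpoly d)"
    and W: "W \<in> Idl\<^bsub>ncpoly d\<^esub> \<Omega>" "W \<in> ncpoly_deg d 2"
  shows "W \<in> \<Omega>"
proof -
  interpret R: ring "ncpoly d :: (nat list \<Rightarrow> 'p mod_ring) ring" by (rule ring_ncpoly)
  interpret \<Omega>: additive_subgroup \<Omega> "ncpoly d" by (rule \<Omega>(2))
  have zero: "(\<lambda>_. 0) \<in> \<Omega>" using \<Omega>.zero_closed by (simp only: ncpoly_simps)
  have add: "(\<lambda>w. f w + g w) \<in> \<Omega>" if "f \<in> \<Omega>" "g \<in> \<Omega>" for f g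
    using \<Omega>.a_closed[OF that] by (simp only: ncpoly_simps)
  have scale: "(\<lambda>w. c * f w) \<in> \<Omega>" if "f \<in> \<Omega>" for c f
    by (rule additive_closed_mod_ring[OF zero add that])
  let ?J = "{F \<in> carrier (ncpoly d). (\<forall>w. length w < 2 \<longrightarrow> F w = 0) \<and> homogeneous_part 2 F \<in> \<Omega>}"
  have part_mult: "homogeneous_part 2 (word_times F H) = (\<lambda>w. H [] * homogeneous_part 2 F w)"
      "homogeneous_part 2 (word_times H F) = (\<lambda>w. H [] * homogeneous_part 2 F w)"
      "\<And>w. length w < 2 \<Longrightarrow> word_times F H w = 0 \<and> word_times H F w = 0"
    if F: "\<And>w. length w < 2 \<Longrightarrow> F w = 0" for F H :: "nat list \<Rightarrow> 'p mod_ring"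
  proof -
    have two: "word_times F H [i, j] = F [i, j] * H []" "word_times H F [i, j] = H [] * F [i, j]" for i j
      using F by (simp_all add: word_times_Cons)
    show "homogeneous_part 2 (word_times F H) = (\<lambda>w. H [] * homogeneous_part 2 F w)"
      "homogeneous_part 2 (word_times H F) = (\<lambda>w. H [] * homogeneous_part 2 F w)"
      by (auto simp: homogeneous_part_def fun_eq_iff length_Suc_conv numeral_2_eq_2 two mult.commute)
    show "word_times F H w = 0 \<and> word_times H F w = 0" if "length w < 2" for w
      using F that by (simp add: word_times_def)
  qed
  have "ideal ?J (ncpoly d)"
  proof (rule idealI)
    show "ring (ncpoly d :: (nat list \<Rightarrow> 'p mod_ring) ring)" by (rule ring_ncpoly)
    show "subgroup ?J (add_monoid (ncpoly d))"
    proof (rule R.add.subgroupI)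
      show "?J \<subseteq> carrier (ncpoly d)" by blast
      have "(\<lambda>_. 0) \<in> ?J" using zero by (simp add: homogeneous_part_def)
      then show "?J \<noteq> {}" by blast
    next
      fix f assume f: "f \<in> ?J"
      have fc: "f \<in> carrier (ncpoly d)" using f by blast
      have "\<ominus>\<^bsub>ncpoly d\<^esub> f = (\<lambda>w. - f w)"
        by (rule R.minus_equality) (use fc in auto)
      moreover have "(\<lambda>w. (-1) * homogeneous_part 2 f w) \<in> \<Omega>" using f by (intro scale) blast
      moreover have "(\<lambda>w. (-1) * homogeneous_part 2 f w) = homogeneous_part 2 (\<lambda>w. - f w)"
        by (auto simp: homogeneous_part_def)
      ultimately show "\<ominus>\<^bsub>ncpoly d\<^esub> f \<in> ?J" using f by auto
    next
      fix f g assume f: "f \<in> ?J" and g: "g \<in> ?J"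
      have "homogeneous_part 2 (\<lambda>w. f w + g w) = (\<lambda>w. homogeneous_part 2 f w + homogeneous_part 2 g w)"
        by (auto simp: homogeneous_part_def)
      moreover have "\<dots> \<in> \<Omega>" using f g by (intro add) blast+
      moreover have "(\<lambda>w. f w + g w) \<in> carrier (ncpoly d)" using f g by (intro ncpoly_add_closed) blast+
      ultimately have "(\<lambda>w. f w + g w) \<in> ?J" using f g by simp
      then show "f \<oplus>\<^bsub>ncpoly d\<^esub> g \<in> ?J" by (simp only: ncpoly_simps)
    qed
  next
    fix F H :: "nat list \<Rightarrow> 'p mod_ring"
    assume F: "F \<in> ?J" and H: "H \<in> carrier (ncpoly d)"
    have low: "F w = 0" if "length w < 2" for w using F that by blast
    have "(\<lambda>w. H [] * homogeneous_part 2 F w) \<in> \<Omega>" using F by (intro scale) blast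
    moreover have "word_times H F \<in> carrier (ncpoly d)" "word_times F H \<in> carrier (ncpoly d)"
      using R.m_closed[OF H, of F] R.m_closed[OF _ H, of F] F by (simp_all only: ncpoly_simps) blast+
    ultimately show "H \<otimes>\<^bsub>ncpoly d\<^esub> F \<in> ?J" "F \<otimes>\<^bsub>ncpoly d\<^esub> H \<in> ?J"
      using part_mult[OF low]
      by (simp_all del: ncpoly_simps(1))
  qed
  moreover have "\<Omega> \<subseteq> ?J"
  proof
    fix f assume f: "f \<in> \<Omega>"
    have fd: "f \<in> carrier (ncpoly d)" "\<And>w. f w \<noteq> 0 \<Longrightarrow> length w = 2"
      using f \<Omega>(1) by (auto simp: ncpoly_deg_def homogeneous_def)
    have "homogeneous_part 2 f = f"
      unfolding homogeneous_part_def by (rule ext) (use fd(2) in metis)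
    moreover have "f w = 0" if "length w < 2" for w using fd(2)[of w] that by (cases "f w = 0") auto
    ultimately show "f \<in> ?J" using f fd(1) by simp
  qed
  ultimately have "W \<in> ?J" using W(1) R.genideal_minimal by blast
  moreover have "homogeneous_part 2 W = W"
  proof -
    have "\<And>w. W w \<noteq> 0 \<Longrightarrow> length w = 2" using W(2) by (simp add: ncpoly_deg_def homogeneous_def)
    then show ?thesis unfolding homogeneous_part_def by (intro ext) metis
  qed
  ultimately show ?thesis by simp
qed

section \<open>Coboundaries and cochains of degree at most 3\<close>

lemma coboundary_1: "set [g] \<subseteq> carrier G \<Longrightarrow> coboundary G c [g] = 0"
  by (simp add: coboundary_def)

lemma coboundary_2:
  "set [g, h] \<subseteq> carrier G \<Longrightarrow> coboundary G c [g, h] = c [h] - c [g \<otimes>\<^bsub>G\<^esub> h] + c [g]"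
  by (simp add: coboundary_def)

lemma coboundary_3:
  "set [g, h, k] \<subseteq> carrier G \<Longrightarrow>
    coboundary G c [g, h, k] = c [h, k] - c [g \<otimes>\<^bsub>G\<^esub> h, k] + c [g, h \<otimes>\<^bsub>G\<^esub> k] - c [g, h]"
  by (simp add: coboundary_def numeral_2_eq_2)

lemma coboundary_homogeneous:
  assumes "\<And>gs. length gs \<noteq> n \<Longrightarrow> c gs = 0" "length gs \<noteq> Suc n"
  shows "coboundary G c gs = 0"
proof (cases "gs = []")
  case False
  then have "c (tl gs) = 0" "c (butlast gs) = 0" using assms by (auto intro!: assms(1))
  moreover have "c (take i gs @ [gs ! i \<otimes>\<^bsub>G\<^esub> gs ! (i + 1)] @ drop (i + 2) gs) = 0" if "i < length gs - 1" for i
    by (rule assms(1)) (use that assms(2) in auto)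
  ultimately show ?thesis by (simp add: coboundary_def)
qed (simp add: coboundary_def)

lemma coboundary_add: "coboundary G (\<lambda>gs. c gs + c' gs) = (\<lambda>gs. coboundary G c gs + coboundary G c' gs)"
  by (auto simp: coboundary_def fun_eq_iff distrib_left sum.distrib sum_subtractf sum_negf)

lemma cochains_add:
  assumes "c \<in> cochains G T" "c' \<in> cochains G T"
  shows "(\<lambda>gs. c gs + c' gs) \<in> cochains G T"
proof -
  obtain N N' where N: "\<And>gs. c gs \<noteq> 0 \<Longrightarrow> length gs \<le> N" "\<And>gs. c' gs \<noteq> 0 \<Longrightarrow> length gs \<le> N'"
    using assms unfolding cochains_def by blast
  have "length gs \<le> max N N'" if "c gs + c' gs \<noteq> 0" for gs
    using that N[of gs] by (cases "c gs = 0") auto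
  moreover have "set gs \<subseteq> carrier G" if "c gs + c' gs \<noteq> 0" for gs
    using that assms unfolding cochains_def by (cases "c gs = 0") auto
  ultimately show ?thesis
    using assms continuous_map_discrete_binop[where h = "(+)"] unfolding cochains_def by blast
qed

lemma cochains_uminus:
  assumes "c \<in> cochains G T"
  shows "(\<lambda>gs. - c gs) \<in> cochains G T"
  using assms continuous_map_discrete_op[where h = uminus]
  unfolding cochains_def mem_Collect_eq neg_equal_0_iff_equal by blast

lemma coboundaries_add:
  assumes "u \<in> coboundaries G T" "v \<in> coboundaries G T"
  shows "(\<lambda>gs. u gs + v gs) \<in> coboundaries G T"
proof -
  obtain c c' where c: "c \<in> cochains G T" "u = coboundary G c" "c' \<in> cochains G T" "v = coboundary G c'"
    using assms unfolding coboundaries_def by blast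
  then show ?thesis
    using imageI[OF cochains_add[OF c(1,3)], of "coboundary G"] by (simp only: coboundaries_def coboundary_add)
qed

lemma coboundaries_uminus:
  assumes "u \<in> coboundaries G T"
  shows "(\<lambda>gs. - u gs) \<in> coboundaries G T"
proof -
  obtain c where c: "c \<in> cochains G T" "u = coboundary G c"
    using assms unfolding coboundaries_def by blast
  have "coboundary G (\<lambda>gs. - c gs) = (\<lambda>gs. - u gs)"
    unfolding c(2) by (auto simp: coboundary_def fun_eq_iff sum_negf)
  then show ?thesis using cochains_uminus[OF c(1)] unfolding coboundaries_def by force
qed

lemma zero_in_coboundaries:
  fixes G :: "'g monoid"
  shows "(\<lambda>_. 0 :: 'k::comm_ring_1) \<in> coboundaries G T"
proof -
  have 1: "(\<lambda>_ :: 'g list. 0 :: 'k) \<in> cochains G T" by (simp add: cochains_def)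
  have 2: "coboundary G (\<lambda>_ :: 'g list. 0 :: 'k) = (\<lambda>_. 0)" by (auto simp: coboundary_def)
  from imageI[OF 1, of "coboundary G"] show ?thesis unfolding 2 coboundaries_def .
qed

lemma coboundaries_coset:
  "coboundaries G T +>\<^bsub>word_ring C\<^esub> f = {\<lambda>gs. c gs + f gs | c. c \<in> coboundaries G T}"
  by (auto simp: a_r_coset_def r_coset_def word_ring_def)

lemma cochains_degree_1:
  assumes "continuous_map T discrete (c :: 'g \<Rightarrow> 'k::comm_ring_1)" "topspace T = carrier G"
  shows "(\<lambda>gs. if length gs = 1 \<and> set gs \<subseteq> carrier G then c (gs ! 0) else 0) \<in> cochains G T" (is "?f \<in> _")
  unfolding cochains_def
proof (intro CollectI conjI allI exI impI)
  fix n :: nat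
  show "continuous_map (product_topology (\<lambda>_. T) {..<n}) discrete (\<lambda>u. ?f (map u [0..<n]))"
  proof (cases "n = 1")
    case True
    have "continuous_map (product_topology (\<lambda>_. T) {..<n}) T (\<lambda>u. u 0)"
      by (rule continuous_map_product_projection[where X = "\<lambda>_. T"]) (simp add: True)
    from continuous_map_compose[OF this assms(1)]
    have "continuous_map (product_topology (\<lambda>_. T) {..<n}) discrete (\<lambda>u. c (u 0))" by (simp add: o_def)
    then show ?thesis
      by (rule continuous_map_eq) (use True assms(2) in \<open>auto simp: PiE_iff\<close>)
  qed simp
next
  fix gs assume "?f gs \<noteq> 0" then show "length gs \<le> 1" by (auto split: if_splits)
next
  fix gs assume "?f gs \<noteq> 0" then show "set gs \<subseteq> carrier G" by (auto split: if_splits)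
qed

lemma cochains_degree_2:
  assumes "continuous_map (prod_topology T T) discrete (\<lambda>(g, h). c g h :: 'k::comm_ring_1)" "topspace T = carrier G"
  shows "(\<lambda>gs. if length gs = 2 \<and> set gs \<subseteq> carrier G then c (gs ! 0) (gs ! 1) else 0) \<in> cochains G T" (is "?f \<in> _")
  unfolding cochains_def
proof (intro CollectI conjI allI exI impI)
  fix n :: nat
  show "continuous_map (product_topology (\<lambda>_. T) {..<n}) discrete (\<lambda>u. ?f (map u [0..<n]))"
  proof (cases "n = 2")
    case True
    have "continuous_map (product_topology (\<lambda>_. T) {..<n}) T (\<lambda>u. u i)" if "i < 2" for i
      by (rule continuous_map_product_projection[where X = "\<lambda>_. T"]) (use that True in simp)
    then have "continuous_map (product_topology (\<lambda>_. T) {..<n}) (prod_topology T T) (\<lambda>u. (u 0, u 1))"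
      by (simp add: continuous_map_pairwise o_def)
    from continuous_map_compose[OF this assms(1)]
    have "continuous_map (product_topology (\<lambda>_. T) {..<n}) discrete (\<lambda>u. c (u 0) (u 1))" by (simp add: o_def)
    then show ?thesis
      by (rule continuous_map_eq) (use True assms(2) in \<open>auto simp: PiE_iff\<close>)
  qed simp
next
  fix gs assume "?f gs \<noteq> 0" then show "length gs \<le> 2" by (auto split: if_splits)
next
  fix gs assume "?f gs \<noteq> 0" then show "set gs \<subseteq> carrier G" by (auto split: if_splits)
qed

lemma cochains_restrict_1:
  assumes "f \<in> cochains G T"
  shows "continuous_map T discrete (\<lambda>g. f [g])"
proof -
  have 1: "continuous_map (product_topology (\<lambda>_. T) {..<1}) discrete (\<lambda>u. f (map u [0..<1]))"
    using assms unfolding cochains_def by blast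
  have 2: "continuous_map T (product_topology (\<lambda>_. T) {..<1::nat}) (\<lambda>g. \<lambda>i\<in>{..<1}. g)"
    by (auto simp: continuous_map_componentwise)
  show ?thesis using continuous_map_compose[OF 2 1] by (simp add: o_def)
qed

text \<open>Cohomology enters only through the components of degree at most 2 of the representatives of
  the classes in the image of \<open>\<phi>\<close>; neither the Leibniz rule nor \<open>d \<circ> d = 0\<close> is needed.\<close>

locale quadratic_cohomology =
  fixes G :: "'g monoid" (structure) and T :: "'g topology" and d :: nat
    and chi :: "nat \<Rightarrow> 'g list \<Rightarrow> 'p::prime_card mod_ring"
    and \<Omega> :: "(nat list \<Rightarrow> 'p mod_ring) set"
    and \<phi> :: "(nat list \<Rightarrow> 'p mod_ring) \<Rightarrow> ('g list \<Rightarrow> 'p mod_ring) set"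
  assumes grp: "group G" and topspace_eq: "topspace T = carrier G"
    and chi: "\<And>i. i < d \<Longrightarrow> chi i \<in> cocycles G T \<inter> homogeneous 1"
    and \<Omega>: "\<Omega> \<subseteq> ncpoly_deg d 2" "additive_subgroup \<Omega> (ncpoly d)"
    and \<phi>: "\<phi> \<in> Ring.ring_hom (ncpoly d) (cohomology_ring G T)"
    and \<phi>_var: "\<And>i. i < d \<Longrightarrow> \<phi> (ncvar i) = cohomology_class G T (chi i)"
    and \<phi>_surj: "\<phi> ` carrier (ncpoly d) = carrier (cohomology_ring G T)"
    and \<phi>_kernel: "a_kernel (ncpoly d) (cohomology_ring G T) \<phi> = Idl\<^bsub>ncpoly d\<^esub> \<Omega>"
begin

sublocale group G by (rule grp)

abbreviation B :: "('g list \<Rightarrow> 'p mod_ring) set" where "B \<equiv> coboundaries G T"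

definition d1 :: "('g \<Rightarrow> 'p mod_ring) \<Rightarrow> 'g \<Rightarrow> 'g \<Rightarrow> 'p mod_ring" where
  "d1 c g h = c h - c (g \<otimes> h) + c g"

definition cup :: "(nat list \<Rightarrow> 'p mod_ring) \<Rightarrow> 'g \<Rightarrow> 'g \<Rightarrow> 'p mod_ring" where
  "cup F g h = (\<Sum>i<d. \<Sum>j<d. F [i, j] * (chi i [g] * chi j [h]))"

text \<open>In degrees up to 2, \<open>z\<close> is the value of the polynomial \<open>F\<close> at
  the cochains \<open>chi i\<close>, up to a continuous coboundary. Degree 1 has no correction term
  since coboundaries of 0-cochains vanish for trivial coefficients.\<close>

definition represents :: "('g list \<Rightarrow> 'p mod_ring) \<Rightarrow> (nat list \<Rightarrow> 'p mod_ring) \<Rightarrow> bool" where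
  "represents z F \<longleftrightarrow> z [] = F [] \<and> (\<forall>g\<in>carrier G. z [g] = (\<Sum>i<d. F [i] * chi i [g])) \<and>
     (\<exists>c. continuous_map T discrete c \<and>
       (\<forall>g\<in>carrier G. \<forall>h\<in>carrier G. z [g, h] = cup F g h + d1 c g h))"

lemma chi_homogeneous: "i < d \<Longrightarrow> length gs \<noteq> 1 \<Longrightarrow> chi i gs = 0"
  using chi[of i] by (auto simp: homogeneous_def)

lemma chi_support: "i < d \<Longrightarrow> \<not> set gs \<subseteq> carrier G \<Longrightarrow> chi i gs = 0"
  using chi[of i] by (auto simp: cocycles_def cochains_def)

lemma represents_add:
  assumes "represents z F" "represents z' F'"
  shows "represents (\<lambda>gs. z gs + z' gs) (\<lambda>w. F w + F' w)"
proof -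
  obtain c where c: "continuous_map T discrete c"
      "\<And>g h. g \<in> carrier G \<Longrightarrow> h \<in> carrier G \<Longrightarrow> z [g, h] = cup F g h + d1 c g h"
    using assms(1) unfolding represents_def by blast
  obtain c' where c': "continuous_map T discrete c'"
      "\<And>g h. g \<in> carrier G \<Longrightarrow> h \<in> carrier G \<Longrightarrow> z' [g, h] = cup F' g h + d1 c' g h"
    using assms(2) unfolding represents_def by blast
  have "continuous_map T discrete (\<lambda>g. c g + c' g)"
    by (rule continuous_map_discrete_binop[OF c(1) c'(1)])
  moreover have "z [g, h] + z' [g, h] = cup (\<lambda>w. F w + F' w) g h + d1 (\<lambda>g. c g + c' g) g h"
    if "g \<in> carrier G" "h \<in> carrier G" for g h
    using c(2)[OF that] c'(2)[OF that] by (simp add: cup_def d1_def distrib_right sum.distrib)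
  ultimately have "\<exists>c. continuous_map T discrete c \<and>
       (\<forall>g\<in>carrier G. \<forall>h\<in>carrier G. z [g, h] + z' [g, h] = cup (\<lambda>w. F w + F' w) g h + d1 c g h)"
    by blast
  then show ?thesis
    using assms unfolding represents_def by (simp add: distrib_right sum.distrib)
qed

lemma represents_times:
  assumes "represents z F" "represents z' F'"
  shows "represents (word_times z z') (word_times F F')"
proof -
  obtain c where c: "continuous_map T discrete c"
      "\<And>g h. g \<in> carrier G \<Longrightarrow> h \<in> carrier G \<Longrightarrow> z [g, h] = cup F g h + d1 c g h"
    using assms(1) unfolding represents_def by blast
  obtain c' where c': "continuous_map T discrete c'"
      "\<And>g h. g \<in> carrier G \<Longrightarrow> h \<in> carrier G \<Longrightarrow> z' [g, h] = cup F' g h + d1 c' g h"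
    using assms(2) unfolding represents_def by blast
  have low: "z [] = F []" "z' [] = F' []"
    "\<And>g. g \<in> carrier G \<Longrightarrow> z [g] = (\<Sum>i<d. F [i] * chi i [g])"
    "\<And>g. g \<in> carrier G \<Longrightarrow> z' [g] = (\<Sum>i<d. F' [i] * chi i [g])"
    using assms unfolding represents_def by blast+
  \<comment> \<open>In degree 2 of the product, the degree 2 part of each factor is multiplied by
    the constant term of the other, which can be pulled into the coboundary. The product of the two
    linear parts is a cup product with no correction.\<close>
  let ?c = "\<lambda>g. F [] * c' g + F' [] * c g"
  have "continuous_map T discrete ?c"
    by (rule continuous_map_discrete_binop[OF c'(1) c(1), where h = "\<lambda>u v. F [] * u + F' [] * v"])
  moreover have "word_times z z' [g, h] = cup (word_times F F') g h + d1 ?c g h"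
    if g: "g \<in> carrier G" and h: "h \<in> carrier G" for g h
  proof -
    have "word_times z z' [g, h] = F [] * (cup F' g h + d1 c' g h)
        + (\<Sum>i<d. F [i] * chi i [g]) * (\<Sum>i<d. F' [i] * chi i [h]) + (cup F g h + d1 c g h) * F' []"
      using g h by (simp add: word_times_Cons low c(2) c'(2))
    moreover have "cup (word_times F F') g h = F [] * cup F' g h
        + (\<Sum>i<d. F [i] * chi i [g]) * (\<Sum>i<d. F' [i] * chi i [h]) + cup F g h * F' []"
    proof -
      have "word_times F F' [i, j] * (chi i [g] * chi j [h]) =
         F [] * (F' [i, j] * (chi i [g] * chi j [h])) + (F [i] * chi i [g]) * (F' [j] * chi j [h])
         + (F [i, j] * (chi i [g] * chi j [h])) * F' []" for i j
        by (simp add: word_times_Cons algebra_simps)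
      then show ?thesis
        by (simp add: cup_def sum.distrib sum_distrib_left sum_distrib_right sum_product) (rule sum.swap)
    qed
    ultimately show ?thesis by (simp add: d1_def algebra_simps)
  qed
  ultimately have "\<exists>c. continuous_map T discrete c \<and>
       (\<forall>g\<in>carrier G. \<forall>h\<in>carrier G. word_times z z' [g, h] = cup (word_times F F') g h + d1 c g h)"
    by blast
  moreover have "word_times z z' [g] = (\<Sum>i<d. word_times F F' [i] * chi i [g])" if "g \<in> carrier G" for g
    using that
    by (simp add: word_times_Cons low distrib_right sum.distrib sum_distrib_left sum_distrib_right mult.assoc)
      (simp add: mult.left_commute mult.commute)
  ultimately show ?thesis unfolding represents_def by (simp add: low)
qed

lemma represents_coboundary:
  assumes "u \<in> B"
  shows "represents u (\<lambda>_. 0)"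
proof -
  obtain c where c: "c \<in> cochains G T" "u = coboundary G c" using assms unfolding coboundaries_def by blast
  have "u [g] = 0" if "g \<in> carrier G" for g
    using that unfolding c(2) by (intro coboundary_1) simp
  moreover have "u [g, h] = cup (\<lambda>_. 0) g h + d1 (\<lambda>g. c [g]) g h" if "g \<in> carrier G" "h \<in> carrier G" for g h
    using that unfolding c(2) by (subst coboundary_2) (simp_all add: cup_def d1_def)
  moreover have "u [] = 0" by (simp add: c(2) coboundary_def)
  ultimately show ?thesis
    using cochains_restrict_1[OF c(1)] unfolding represents_def by auto
qed

lemma represents_coset:
  assumes "represents f F" "z \<in> B +>\<^bsub>word_ring C\<^esub> f"
  shows "represents z F"
proof -
  obtain u where u: "u \<in> B" "z = (\<lambda>gs. u gs + f gs)" using assms(2) unfolding coboundaries_coset by blast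
  show ?thesis using represents_add[OF represents_coboundary[OF u(1)] assms(1)] by (simp add: u(2))
qed

lemma represents_one: "represents (\<lambda>w. if w = [] then 1 else 0) (\<lambda>w. if w = [] then 1 else 0)"
  unfolding represents_def by (auto simp: cup_def d1_def intro!: exI[of _ "\<lambda>_. 0"])

lemma represents_chi:
  assumes "i < d"
  shows "represents (chi i) (ncvar i)"
  using assms
  by (auto simp: represents_def cup_def d1_def ncvar_def chi_homogeneous if_distrib[of "\<lambda>c. c * _"] sum.delta
      intro!: exI[of _ "\<lambda>_. 0"] cong: if_cong)

lemma cohomology_ring_simps:
  "U \<oplus>\<^bsub>cohomology_ring G T\<^esub> V = {\<lambda>gs. u gs + v gs | u v. u \<in> U \<and> v \<in> V}"
  "U \<otimes>\<^bsub>cohomology_ring G T\<^esub> V = (\<Union>u\<in>U. \<Union>v\<in>V. B +>\<^bsub>word_ring (cocycles G T)\<^esub> word_times u v)"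
  "\<one>\<^bsub>cohomology_ring G T\<^esub> = B +>\<^bsub>word_ring (cocycles G T)\<^esub> (\<lambda>w. if w = [] then 1 else 0)"
  "\<zero>\<^bsub>cohomology_ring G T\<^esub> = B"
  "carrier (cohomology_ring G T) = (\<lambda>f. B +>\<^bsub>word_ring (cocycles G T)\<^esub> f) ` cocycles G T"
  by (auto simp: cohomology_ring_def FactRing_def set_add_def set_mult_def rcoset_mult_def
      A_RCOSETS_def RCOSETS_def a_r_coset_def word_ring_def)

lemma \<phi>_add:
  "F \<in> carrier (ncpoly d) \<Longrightarrow> H \<in> carrier (ncpoly d) \<Longrightarrow>
     \<phi> (\<lambda>w. F w + H w) = {\<lambda>gs. u gs + v gs | u v. u \<in> \<phi> F \<and> v \<in> \<phi> H}"
  using ring_hom_add[OF \<phi>, of F H] unfolding cohomology_ring_simps ncpoly_simps(5) .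

lemma \<phi>_times:
  "F \<in> carrier (ncpoly d) \<Longrightarrow> H \<in> carrier (ncpoly d) \<Longrightarrow>
     \<phi> (word_times F H) = (\<Union>u\<in>\<phi> F. \<Union>v\<in>\<phi> H. B +>\<^bsub>word_ring (cocycles G T)\<^esub> word_times u v)"
  using ring_hom_mult[OF \<phi>, of F H] unfolding cohomology_ring_simps ncpoly_simps(2) .

lemma \<Omega>_carrier: "\<Omega> \<subseteq> carrier (ncpoly d)"
  using \<Omega>(1) unfolding ncpoly_deg_def by blast

lemma \<phi>_eq_zero_iff: "F \<in> carrier (ncpoly d) \<Longrightarrow> \<phi> F = B \<longleftrightarrow> F \<in> Idl\<^bsub>ncpoly d\<^esub> \<Omega>"
  unfolding \<phi>_kernel[symmetric] a_kernel_def' cohomology_ring_simps by blast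

lemma \<phi>_zero: "\<phi> (\<lambda>_. 0) = B"
proof -
  interpret ring "ncpoly d :: (nat list \<Rightarrow> 'p mod_ring) ring" by (rule ring_ncpoly)
  have "(\<lambda>_. 0) \<in> \<Omega>" using additive_subgroup.zero_closed[OF \<Omega>(2)] by (simp only: ncpoly_simps)
  then have "(\<lambda>_. 0) \<in> Idl\<^bsub>ncpoly d\<^esub> \<Omega>" using genideal_self[OF \<Omega>_carrier] by blast
  then show ?thesis by (subst \<phi>_eq_zero_iff) simp_all
qed

text \<open>The relation holds for the variables and is preserved by sums, products and change of
  representative, so it passes from the generators to all polynomials. With the surjectivity of
  \<open>\<phi>\<close> it describes the degree 2 part of every cocycle.\<close>

lemma represents_\<phi>:
  assumes "F \<in> carrier (ncpoly d)"
  shows "\<forall>z\<in>\<phi> F. represents z F"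
proof -
  have "\<forall>w. F w \<noteq> 0 \<longrightarrow> w \<in> UNIV" by simp
  with assms show ?thesis
  proof (induction F rule: ncpoly_induct)
    case zero
    then show ?case using represents_coboundary by (simp add: \<phi>_zero)
  next
    case (word w)
    then show ?case
    proof (induction w)
      case Nil
      have "\<phi> (nc_word []) = B +>\<^bsub>word_ring (cocycles G T)\<^esub> (\<lambda>w. if w = [] then 1 else 0)"
        using ring_hom_one[OF \<phi>] unfolding cohomology_ring_simps ncpoly_simps(3) .
      then show ?case using represents_coset[OF represents_one] by blast
    next
      case (Cons i w)
      have i: "i < d" and w: "set w \<subseteq> {..<d}" using Cons.prems by auto
      have "\<forall>z\<in>\<phi> (ncvar i). represents z (ncvar i)"
        unfolding \<phi>_var[OF i] cohomology_class_def using represents_coset[OF represents_chi[OF i]] by blast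
      moreover have "\<forall>z\<in>\<phi> (nc_word w). represents z (nc_word w)" using w by (intro Cons.IH) auto
      ultimately show ?case
        unfolding nc_word_Cons \<phi>_times[OF ncvar_closed[OF i] nc_word_closed[OF w]]
        using represents_coset[OF represents_times] by blast
    qed
  next
    case (add F H)
    then show ?case unfolding \<phi>_add[OF add(1,2)] using represents_add by blast
  qed
qed

definition cup_cochain :: "(nat list \<Rightarrow> 'p mod_ring) \<Rightarrow> 'g list \<Rightarrow> 'p mod_ring" where
  "cup_cochain F gs = (if length gs = 2 then cup F (gs ! 0) (gs ! 1) else 0)"

lemma mem_coset: "f \<in> B +>\<^bsub>word_ring C\<^esub> f"
  unfolding coboundaries_coset using zero_in_coboundaries by force

text \<open>\<open>represents_\<phi>\<close> says nothing about members of \<open>\<phi> F\<close>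
  above degree 2, whereas comparing \<open>\<phi> F\<close> with \<open>B\<close> needs a member
  known in all degrees. For a word \<open>[i, j]\<close> the product of \<open>chi i\<close> and
  \<open>chi j\<close> is one, and it is concentrated in degree 2.\<close>

lemma cup_cochain_in_\<phi>:
  assumes "F \<in> ncpoly_deg d 2"
  shows "cup_cochain F \<in> \<phi> F"
proof -
  have F: "F \<in> carrier (ncpoly d)" "\<forall>w. F w \<noteq> 0 \<longrightarrow> w \<in> {w. length w = 2}"
    using assms by (auto simp: ncpoly_deg_def homogeneous_def)
  then show ?thesis
  proof (induction F rule: ncpoly_induct)
    case zero
    have "cup_cochain (\<lambda>_. 0) = (\<lambda>_. 0)" by (auto simp: cup_cochain_def cup_def)
    then show ?case using zero_in_coboundaries by (simp add: \<phi>_zero)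
  next
    case (word w)
    then obtain i j where w: "w = [i, j]" by (auto simp: length_Suc_conv numeral_2_eq_2)
    have ij: "i < d" "j < d" using word w by auto
    have nc: "(nc_word w :: nat list \<Rightarrow> 'p mod_ring) = word_times (ncvar i) (ncvar j)"
      using nc_word_Cons[of j "[]", where 'k = "'p mod_ring"] by (simp add: w nc_word_Cons)
    have "word_times (chi i) (chi j) \<in> \<phi> (nc_word w)"
      unfolding nc \<phi>_times[OF ncvar_closed[OF ij(1)] ncvar_closed[OF ij(2)]] \<phi>_var[OF ij(1)] \<phi>_var[OF ij(2)]
        cohomology_class_def
      using mem_coset by blast
    moreover have "cup_cochain (nc_word w) = word_times (chi i) (chi j)"
    proof
      fix gs
      show "cup_cochain (nc_word w) gs = word_times (chi i) (chi j) gs"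
      proof (cases "length gs = 2")
        case True
        then obtain g h where gs: "gs = [g, h]" by (auto simp: length_Suc_conv numeral_2_eq_2)
        have "cup (nc_word w) g h = (\<Sum>k<d. \<Sum>l<d. if l = j then (if k = i then chi k [g] * chi l [h] else 0) else 0)"
          unfolding cup_def w by (intro sum.cong) auto
        also have "\<dots> = chi i [g] * chi j [h]" using ij by (simp add: sum.delta)
        finally show ?thesis using ij
          by (simp add: gs cup_cochain_def word_times_Cons chi_homogeneous)
      next
        case False
        have "word_times (chi i) (chi j) gs = 0"
        proof (rule ccontr)
          assume "word_times (chi i) (chi j) gs \<noteq> 0"
          then obtain u v where uv: "gs = u @ v" "chi i u \<noteq> 0" "chi j v \<noteq> 0" by (rule word_times_nonzeroE)
          have "length u = 1" using chi_homogeneous[OF ij(1)] uv(2) by blast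
          moreover have "length v = 1" using chi_homogeneous[OF ij(2)] uv(3) by blast
          ultimately show False using False uv(1) by simp
        qed
        then show ?thesis using False by (simp add: cup_cochain_def)
      qed
    qed
    ultimately show ?case by simp
  next
    case (add F H)
    have "cup_cochain (\<lambda>w. F w + H w) = (\<lambda>gs. cup_cochain F gs + cup_cochain H gs)"
      by (auto simp: cup_cochain_def cup_def distrib_right sum.distrib)
    then show ?case unfolding \<phi>_add[OF add(1,2)] using add(3,4) by auto
  qed
qed

lemma \<Omega>_imp_coboundary:
  assumes "W \<in> \<Omega>"
  obtains c where "continuous_map T discrete c"
    "\<And>g h. g \<in> carrier G \<Longrightarrow> h \<in> carrier G \<Longrightarrow> cup W g h = d1 c g h"
proof -
  interpret R: ring "ncpoly d :: (nat list \<Rightarrow> 'p mod_ring) ring" by (rule ring_ncpoly)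
  have W: "W \<in> ncpoly_deg d 2" "W \<in> carrier (ncpoly d)" using assms \<Omega>(1) \<Omega>_carrier by auto
  have "W \<in> Idl\<^bsub>ncpoly d\<^esub> \<Omega>" using R.genideal_self[OF \<Omega>_carrier] assms by blast
  then have "\<phi> W = B" using \<phi>_eq_zero_iff[OF W(2)] by simp
  then have "cup_cochain W \<in> B" using cup_cochain_in_\<phi>[OF W(1)] by simp
  then obtain c where c: "c \<in> cochains G T" "cup_cochain W = coboundary G c"
    unfolding coboundaries_def by blast
  have "cup W g h = d1 (\<lambda>g. c [g]) g h" if "g \<in> carrier G" "h \<in> carrier G" for g h
    using fun_cong[OF c(2), of "[g, h]"] that by (simp add: cup_cochain_def coboundary_2 d1_def)
  then show ?thesis using that cochains_restrict_1[OF c(1)] by blast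
qed

text \<open>The coset \<open>\<phi> W\<close> contains the coboundary \<open>cup_cochain W\<close>,
  so it is the zero coset and \<open>W\<close> lies in the ideal generated by
  \<open>\<Omega>\<close>. Being of degree 2, \<open>W\<close> lies in \<open>\<Omega>\<close>
  itself.\<close>

lemma coboundary_imp_\<Omega>:
  assumes W: "W \<in> ncpoly_deg d 2" and c: "continuous_map T discrete c"
    and eq: "\<And>g h. g \<in> carrier G \<Longrightarrow> h \<in> carrier G \<Longrightarrow> cup W g h = d1 c g h"
  shows "W \<in> \<Omega>"
proof -
  have Wc: "W \<in> carrier (ncpoly d)" using W by (simp add: ncpoly_deg_def del: ncpoly_simps)
  let ?c = "\<lambda>gs. if length gs = 1 \<and> set gs \<subseteq> carrier G then c (gs ! 0) else 0"
  have "coboundary G ?c gs = cup_cochain W gs" for gs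
  proof (cases "length gs = 2")
    case True
    then obtain g h where gs: "gs = [g, h]" by (auto simp: length_Suc_conv numeral_2_eq_2)
    show ?thesis
    proof (cases "g \<in> carrier G \<and> h \<in> carrier G")
      case True
      then show ?thesis by (simp add: gs coboundary_2 cup_cochain_def eq d1_def)
    next
      case False
      then have "chi i [g] * chi j [h] = 0" if "i < d" "j < d" for i j
        using chi_support[of i "[g]"] chi_support[of j "[h]"] that by auto
      then have "cup W g h = 0" unfolding cup_def by (intro sum.neutral ballI) simp
      then show ?thesis using False by (simp add: gs cup_cochain_def coboundary_def)
    qed
  next
    case False
    then have "coboundary G ?c gs = 0" by (intro coboundary_homogeneous[where n = 1]) auto
    then show ?thesis using False by (simp add: cup_cochain_def)
  qed
  then have "cup_cochain W = coboundary G ?c" by auto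
  then have "cup_cochain W \<in> B"
    unfolding coboundaries_def using cochains_degree_1[OF c topspace_eq] by (rule image_eqI)
  moreover have "\<phi> W \<in> carrier (cohomology_ring G T)" using \<phi>_surj Wc by blast
  then obtain f where f: "\<phi> W = {\<lambda>gs. u gs + f gs | u. u \<in> B}"
    unfolding cohomology_ring_simps(5) coboundaries_coset by blast
  moreover obtain u where u: "u \<in> B" "cup_cochain W = (\<lambda>gs. u gs + f gs)"
    using cup_cochain_in_\<phi>[OF W] unfolding f by blast
  ultimately have "(\<lambda>gs. cup_cochain W gs + - u gs) \<in> B"
    using coboundaries_add coboundaries_uminus by blast
  moreover have "(\<lambda>gs. cup_cochain W gs + - u gs) = f" using u(2) by auto
  ultimately have fB: "f \<in> B" by simp
  have "\<phi> W = B"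
  proof (intro equalityI subsetI)
    fix v assume "v \<in> \<phi> W"
    then show "v \<in> B" unfolding f using coboundaries_add fB by blast
  next
    fix v assume "v \<in> B"
    then have "(\<lambda>gs. v gs + - f gs) \<in> B" using coboundaries_add coboundaries_uminus[OF fB] by blast
    moreover have "v = (\<lambda>gs. (v gs + - f gs) + f gs)" by auto
    ultimately show "v \<in> \<phi> W"
      unfolding f by (intro CollectI exI[of _ "\<lambda>gs. v gs + - f gs"] conjI)
  qed
  then have "W \<in> Idl\<^bsub>ncpoly d\<^esub> \<Omega>" using \<phi>_eq_zero_iff[OF Wc] by simp
  then show ?thesis using ideal_degree_2_part[OF \<Omega>] W by blast
qed

text \<open>This is where generation of the cohomology by degree 1 enters, as surjectivity of
  \<open>\<phi>\<close>. The polynomial \<open>F\<close> may have terms of other degrees;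
  \<open>cup\<close> reads only its coefficients of degree 2.\<close>

lemma cocycle_eq_cup:
  fixes z :: "'g \<Rightarrow> 'g \<Rightarrow> 'p mod_ring"
  assumes z: "continuous_map (prod_topology T T) discrete (\<lambda>(g, h). z g h)"
    and cocycle: "\<And>g h k. g \<in> carrier G \<Longrightarrow> h \<in> carrier G \<Longrightarrow> k \<in> carrier G \<Longrightarrow>
      z h k - z (g \<otimes> h) k + z g (h \<otimes> k) - z g h = 0"
  obtains F c where "continuous_map T discrete c"
    "\<And>g h. g \<in> carrier G \<Longrightarrow> h \<in> carrier G \<Longrightarrow> z g h = cup F g h + d1 c g h"
proof -
  let ?z = "\<lambda>gs. if length gs = 2 \<and> set gs \<subseteq> carrier G then z (gs ! 0) (gs ! 1) else 0"
  have "coboundary G ?z gs = 0" for gs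
  proof (cases "length gs = 3")
    case True
    then obtain g h k where gs: "gs = [g, h, k]" by (auto simp: length_Suc_conv numeral_3_eq_3)
    show ?thesis
    proof (cases "set gs \<subseteq> carrier G")
      case True
      then show ?thesis using cocycle[of g h k] by (simp add: gs coboundary_3)
    qed (simp add: coboundary_def)
  next
    case False
    then show ?thesis by (intro coboundary_homogeneous[where n = 2]) auto
  qed
  then have "?z \<in> cocycles G T"
    unfolding cocycles_def using cochains_degree_2[OF z topspace_eq] by auto
  then have "B +>\<^bsub>word_ring (cocycles G T)\<^esub> ?z \<in> \<phi> ` carrier (ncpoly d)"
    unfolding \<phi>_surj cohomology_ring_simps by (rule imageI)
  then obtain F where F: "F \<in> carrier (ncpoly d)" "B +>\<^bsub>word_ring (cocycles G T)\<^esub> ?z = \<phi> F" by (rule imageE)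
  have "?z \<in> \<phi> F" unfolding F(2)[symmetric] by (rule mem_coset)
  then have "represents ?z F" using represents_\<phi>[OF F(1)] by blast
  then obtain c where c: "continuous_map T discrete c"
      "\<And>g h. g \<in> carrier G \<Longrightarrow> h \<in> carrier G \<Longrightarrow> ?z [g, h] = cup F g h + d1 c g h"
    unfolding represents_def by blast
  show ?thesis
  proof (rule that[OF c(1)])
    fix g h assume "g \<in> carrier G" "h \<in> carrier G"
    then show "z g h = cup F g h + d1 c g h" using c(2)[of g h] by simp
  qed
qed

end

section \<open>The annihilator of the cup product relations\<close>

lemma one_in_zassenhaus:
  assumes "group S" "topspace T = carrier S"
  shows "\<one>\<^bsub>S\<^esub> \<in> zassenhaus p S T n"
proof -
  interpret group S by fact
  have "\<one>\<^bsub>S\<^esub> \<in> T closure_of (generate S A)" for A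
    using closure_of_subset_Int[of T "generate S A"] generate.one[of S A] assms(2) by auto
  then show ?thesis by (subst zassenhaus.simps) simp
qed

lemma (in group) normal_Inter:
  assumes "\<And>N. N \<in> \<N> \<Longrightarrow> N \<lhd> G" "\<N> \<noteq> {}"
  shows "\<Inter>\<N> \<lhd> G"
proof (rule normal_invI)
  show "subgroup (\<Inter>\<N>) G"
    using assms by (intro subgroups_Inter) (auto simp: normal_imp_subgroup)
  fix a b assume a: "a \<in> carrier G" and b: "b \<in> \<Inter>\<N>"
  show "a \<otimes> b \<otimes> inv a \<in> \<Inter>\<N>"
  proof
    fix N assume N: "N \<in> \<N>"
    show "a \<otimes> b \<otimes> inv a \<in> N" using normal.inv_op_closed2[OF assms(1)[OF N] a] b N by blast
  qed
qed

lemma closed_normal_closure: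
  fixes G :: "'a monoid"
  assumes G: "group G" and T: "topspace T = carrier G" and A: "A \<subseteq> carrier G"
  shows "closed_normal_closure G T A \<lhd> G" "closedin T (closed_normal_closure G T A)"
    "A \<subseteq> closed_normal_closure G T A"
    "\<And>N. N \<lhd> G \<Longrightarrow> closedin T N \<Longrightarrow> A \<subseteq> N \<Longrightarrow> closed_normal_closure G T A \<subseteq> N"
proof -
  interpret group G by (rule G)
  let ?F = "{N. N \<lhd> G \<and> closedin T N \<and> A \<subseteq> N}"
  \<comment> \<open>Exhibits a member of the family; the intersection of an empty family would be
    the whole type.\<close>
  have "carrier G \<lhd> G" by (rule normal_invI[OF subgroup_self]) simp
  moreover have "closedin T (carrier G)" using closedin_topspace[of T] by (simp only: T)
  ultimately have ne: "?F \<noteq> {}" using A by blast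
  show "closed_normal_closure G T A \<lhd> G"
    unfolding closed_normal_closure_def by (rule normal_Inter[OF _ ne]) blast
  show "closedin T (closed_normal_closure G T A)"
    unfolding closed_normal_closure_def by (rule closedin_Inter[OF ne]) blast
  show "A \<subseteq> closed_normal_closure G T A" unfolding closed_normal_closure_def by blast
  show "\<And>N. N \<lhd> G \<Longrightarrow> closedin T N \<Longrightarrow> A \<subseteq> N \<Longrightarrow> closed_normal_closure G T A \<subseteq> N"
    unfolding closed_normal_closure_def by blast
qed

locale quadratic_presentation_setup =
  M: magnus_coefficients S TS d x \<mu> + Q: quadratic_cohomology G TG d chi \<Omega> \<phi>
  for S :: "'s monoid" and TS :: "'s topology" and d :: nat and x :: "nat \<Rightarrow> 's"
    and \<mu> :: "'s \<Rightarrow> nat list \<Rightarrow> 'p::prime_card mod_ring"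
    and G :: "'g monoid" and TG :: "'g topology"
    and chi :: "nat \<Rightarrow> 'g list \<Rightarrow> 'p mod_ring" and \<Omega> :: "(nat list \<Rightarrow> 'p mod_ring) set"
    and \<phi> :: "(nat list \<Rightarrow> 'p mod_ring) \<Rightarrow> ('g list \<Rightarrow> 'p mod_ring) set" +
  fixes \<pi> :: "'s \<Rightarrow> 'g" and R :: "'s set"
  assumes G_pro_p: "pro_p_group CARD('p) G TG"
    and \<pi>: "\<pi> \<in> continuous_hom S TS G TG" "\<pi> ` carrier S = carrier G" "kernel S G \<pi> = R"
    and minimal: "R \<subseteq> zassenhaus CARD('p) S TS 2"
    and dual: "\<And>i j. i < d \<Longrightarrow> j < d \<Longrightarrow> chi i [\<pi> (x j)] = (if i = j then 1 else 0)"
begin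

lemma \<pi>_hom: "group_hom S G \<pi>"
  by unfold_locales (use \<pi>(1) in \<open>simp add: continuous_hom_def\<close>)

lemma \<pi>_continuous: "continuous_map TS TG \<pi>"
  using \<pi>(1) by (simp add: continuous_hom_def)

lemma \<pi>_closed: "s \<in> carrier S \<Longrightarrow> \<pi> s \<in> carrier G"
  using \<pi>(2) by blast

lemma \<pi>_mult: "s \<in> carrier S \<Longrightarrow> t \<in> carrier S \<Longrightarrow> \<pi> (s \<otimes>\<^bsub>S\<^esub> t) = \<pi> s \<otimes>\<^bsub>G\<^esub> \<pi> t"
  using group_hom.hom_mult[OF \<pi>_hom] by blast

lemma \<pi>_one: "\<pi> \<one>\<^bsub>S\<^esub> = \<one>\<^bsub>G\<^esub>"
  by (rule group_hom.hom_one[OF \<pi>_hom])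

lemma R_iff: "r \<in> R \<longleftrightarrow> r \<in> carrier S \<and> \<pi> r = \<one>\<^bsub>G\<^esub>"
  using \<pi>(3) by (auto simp: kernel_def)

lemma R_carrier: "r \<in> R \<Longrightarrow> r \<in> carrier S"
  by (simp add: R_iff)

lemma R_normal: "R \<lhd> S"
  using group_hom.normal_kernel[OF \<pi>_hom] \<pi>(3) by simp

lemma R_mult: "r \<in> R \<Longrightarrow> r' \<in> R \<Longrightarrow> r \<otimes>\<^bsub>S\<^esub> r' \<in> R"
  using subgroup.m_closed[OF normal_imp_subgroup[OF R_normal]] by blast

lemma one_in_R: "\<one>\<^bsub>S\<^esub> \<in> R"
  by (simp add: R_iff \<pi>_one)

lemma R_conj: "s \<in> carrier S \<Longrightarrow> r \<in> R \<Longrightarrow> s \<otimes>\<^bsub>S\<^esub> r \<otimes>\<^bsub>S\<^esub> inv\<^bsub>S\<^esub> s \<in> R"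
  by (rule normal.inv_op_closed2[OF R_normal])

lemma R_closedin: "closedin TS R"
proof -
  have "closedin TG {\<one>\<^bsub>G\<^esub>}"
    using pro_p_groupD(3)[OF G_pro_p] by (intro closedin_Hausdorff_singleton) (simp_all add: Q.topspace_eq)
  from closedin_continuous_map_preimage[OF \<pi>_continuous this]
  have "closedin TS {s \<in> topspace TS. \<pi> s \<in> {\<one>\<^bsub>G\<^esub>}}" .
  moreover have "{s \<in> topspace TS. \<pi> s \<in> {\<one>\<^bsub>G\<^esub>}} = R" by (auto simp: M.topspace_eq R_iff)
  ultimately show ?thesis by simp
qed

lemma hom_vanishes_on_R:
  fixes h :: "'s \<Rightarrow> 'p mod_ring"
  assumes "continuous_map TS discrete h"
    "\<And>s t. s \<in> carrier S \<Longrightarrow> t \<in> carrier S \<Longrightarrow> h (s \<otimes>\<^bsub>S\<^esub> t) = h s + h t" "r \<in> R"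
  shows "h r = 0"
  by (rule M.hom_vanishes_on_zassenhaus[where h = h and n = 2, OF assms(1,2) order_refl subsetD[OF minimal assms(3)]])

lemma a_R: "r \<in> R \<Longrightarrow> M.a i r = 0"
  by (rule hom_vanishes_on_R[where h = "M.a i", OF M.continuous_a M.a_mult])

lemma fibre:
  assumes "s \<in> carrier S" "t \<in> carrier S" "\<pi> s = \<pi> t"
  obtains r where "r \<in> R" "t = s \<otimes>\<^bsub>S\<^esub> r"
proof (rule that[of "inv\<^bsub>S\<^esub> s \<otimes>\<^bsub>S\<^esub> t"])
  show "t = s \<otimes>\<^bsub>S\<^esub> (inv\<^bsub>S\<^esub> s \<otimes>\<^bsub>S\<^esub> t)"
    using assms by (simp add: M.m_assoc[symmetric])
  show "inv\<^bsub>S\<^esub> s \<otimes>\<^bsub>S\<^esub> t \<in> R"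
    using assms \<pi>_closed[OF assms(2)] by (simp add: R_iff \<pi>_mult group_hom.hom_inv[OF \<pi>_hom])
qed

text \<open>A 1-cocycle with trivial coefficients is a homomorphism, so both sides are continuous
  homomorphisms from \<open>S\<close> to \<open>F_p\<close>. They agree on the generators
  \<open>x j\<close> by duality.\<close>

lemma chi_\<pi>:
  assumes i: "i < d" and s: "s \<in> carrier S"
  shows "chi i [\<pi> s] = M.a i s"
proof -
  let ?h = "\<lambda>s. chi i [\<pi> s] - M.a i s"
  have cc: "chi i \<in> cocycles G TG" using Q.chi[OF i] by blast
  then have c: "chi i \<in> cochains G TG" by (simp add: cocycles_def)
  have cocycle: "chi i [g \<otimes>\<^bsub>G\<^esub> h] = chi i [g] + chi i [h]" if "g \<in> carrier G" "h \<in> carrier G" for g h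
  proof -
    have "coboundary G (chi i) [g, h] = 0" using cc unfolding cocycles_def by auto
    then show ?thesis using that by (simp add: coboundary_2 algebra_simps)
  qed
  have "continuous_map TS discrete (\<lambda>s. chi i [\<pi> s])"
    using continuous_map_compose[OF \<pi>_continuous cochains_restrict_1[OF c]] by (simp add: o_def)
  then have "continuous_map TS discrete ?h"
    by (rule continuous_map_discrete_binop[OF _ M.continuous_a, where h = "(-)"])
  then have "?h s = 0"
    by (rule free_pro_p_hom_eq_0[where h = ?h, OF M.free])
      (use s i dual M.a_x \<pi>_closed in \<open>simp_all add: \<pi>_mult cocycle M.a_mult\<close>)
  then show ?thesis by simp
qed

lemma beta_mult:
  assumes "s \<in> carrier S" "t \<in> carrier S"
  shows "M.beta W (s \<otimes>\<^bsub>S\<^esub> t) = M.beta W s + M.beta W t + Q.cup W (\<pi> s) (\<pi> t)"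
proof -
  have "Q.cup W (\<pi> s) (\<pi> t) = (\<Sum>i<d. \<Sum>j<d. W [i, j] * (M.a i s * M.a j t))"
    unfolding Q.cup_def by (intro sum.cong) (simp_all add: chi_\<pi> assms)
  then show ?thesis by (simp add: M.beta_mult[OF assms])
qed

lemma beta_mult_R:
  assumes "s \<in> carrier S" "r \<in> R"
  shows "M.beta W (s \<otimes>\<^bsub>S\<^esub> r) = M.beta W s + M.beta W r"
  using M.beta_mult[OF assms(1) R_carrier[OF assms(2)], of W] by (simp add: a_R[OF assms(2)])

lemma beta_one: "M.beta W \<one>\<^bsub>S\<^esub> = 0"
  by (simp add: M.beta_def M.b_one)

text \<open>If \<open>c\<close> bounds the cup product given by \<open>W\<close>, then the cup terms
  in the product rules of \<open>\<beta>_W\<close> and of \<open>c \<circ> \<pi>\<close> cancel. The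
  sum is thus a homomorphism on \<open>S\<close> and vanishes on \<open>R\<close>.\<close>

lemma beta_\<Omega>:
  assumes W: "W \<in> \<Omega>" and r: "r \<in> R"
  shows "M.beta W r = 0"
proof -
  obtain c where c: "continuous_map TG discrete c"
    "\<And>g h. g \<in> carrier G \<Longrightarrow> h \<in> carrier G \<Longrightarrow> Q.cup W g h = Q.d1 c g h"
    using Q.\<Omega>_imp_coboundary[OF W] by blast
  let ?h = "\<lambda>s. M.beta W s + c (\<pi> s)"
  have "continuous_map TS discrete (\<lambda>s. c (\<pi> s))"
    using continuous_map_compose[OF \<pi>_continuous c(1)] by (simp add: o_def)
  then have h: "continuous_map TS discrete ?h"
    by (rule continuous_map_discrete_binop[OF M.continuous_beta])
  have mult: "?h (s \<otimes>\<^bsub>S\<^esub> t) = ?h s + ?h t" if "s \<in> carrier S" "t \<in> carrier S" for s t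
    using that c(2)[OF \<pi>_closed[OF that(1)] \<pi>_closed[OF that(2)]]
    by (simp add: beta_mult \<pi>_mult Q.d1_def)
  have "?h s = 0" if "s \<in> R" for s
    by (rule hom_vanishes_on_R[where h = ?h, OF h mult that])
  \<comment> \<open>On \<open>R\<close> the function \<open>c \<circ> \<pi>\<close> is the constant
    \<open>c \<one>\<close>, and the instance at the neutral element shows that this constant is
    0.\<close>
  from this[OF r] this[OF one_in_R] show ?thesis using r by (simp add: R_iff beta_one \<pi>_one)
qed

text \<open>A continuous surjection of compact Hausdorff spaces is a quotient map. Hence continuity
  of a function on \<open>G\<close> can be tested on \<open>S\<close>, which replaces a continuous
  section of \<open>\<pi>\<close>.\<close>

lemma quotient_map_\<pi>: "quotient_map TS TG \<pi>"
  by (rule continuous_imp_quotient_map[OF \<pi>_continuous])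
    (use pro_p_groupD[OF M.pro_p] pro_p_groupD[OF G_pro_p] \<pi>(2) in simp_all)

lemma quotient_map_\<pi>_prod:
  "quotient_map (prod_topology TS TS) (prod_topology TG TG) (\<lambda>(s, t). (\<pi> s, \<pi> t))"
proof (rule continuous_imp_quotient_map)
  show "continuous_map (prod_topology TS TS) (prod_topology TG TG) (\<lambda>(s, t). (\<pi> s, \<pi> t))"
    by (simp add: continuous_map_prod_top \<pi>_continuous)
  show "(\<lambda>(s, t). (\<pi> s, \<pi> t)) ` topspace (prod_topology TS TS) = topspace (prod_topology TG TG)"
    using map_prod_surj_on[OF \<pi>(2) \<pi>(2)]
    by (simp only: map_prod_def topspace_prod_topology M.topspace_eq Q.topspace_eq)
qed (simp_all add: compact_space_prod_topology Hausdorff_space_prod_topology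
      pro_p_groupD[OF M.pro_p] pro_p_groupD[OF G_pro_p])

text \<open>A bare set-theoretic section of \<open>\<pi>\<close>. Functions on \<open>G\<close> are
  written down with it, and their continuity is then read off from their pullbacks to
  \<open>S\<close>.\<close>

definition \<sigma> :: "'g \<Rightarrow> 's" where "\<sigma> = inv_into (carrier S) \<pi>"

lemma \<sigma>: "s \<in> carrier S \<Longrightarrow> \<sigma> (\<pi> s) \<in> carrier S" "s \<in> carrier S \<Longrightarrow> \<pi> (\<sigma> (\<pi> s)) = \<pi> s"
  unfolding \<sigma>_def by (simp_all add: inv_into_into f_inv_into_f)

lemma mem_\<Omega>_if_beta:
  assumes W: "W \<in> ncpoly_deg d 2" and beta: "\<And>r. r \<in> R \<Longrightarrow> M.beta W r = 0"
  shows "W \<in> \<Omega>"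
proof -
  let ?c = "\<lambda>g. - M.beta W (\<sigma> g)"
  have c: "?c (\<pi> s) = - M.beta W s" if s: "s \<in> carrier S" for s
  proof -
    obtain r where r: "r \<in> R" "\<sigma> (\<pi> s) = s \<otimes>\<^bsub>S\<^esub> r"
      using fibre[OF s \<sigma>(1)[OF s] \<sigma>(2)[OF s, symmetric]] by blast
    show ?thesis using beta_mult_R[OF s r(1)] beta[OF r(1)] by (simp add: r(2))
  qed
  have "continuous_map TS discrete (\<lambda>s. - M.beta W s)"
    by (rule continuous_map_discrete_op[OF M.continuous_beta])
  then have "continuous_map TS discrete (?c \<circ> \<pi>)"
    by (rule continuous_map_eq) (use c in \<open>simp add: M.topspace_eq\<close>)
  then have "continuous_map TG discrete ?c"
    by (rule continuous_compose_quotient_map[OF quotient_map_\<pi>])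
  then show ?thesis
  proof (rule Q.coboundary_imp_\<Omega>[OF W])
    fix g h assume "g \<in> carrier G" "h \<in> carrier G"
    then obtain s t where s: "s \<in> carrier S" "g = \<pi> s" and t: "t \<in> carrier S" "h = \<pi> t"
      using \<pi>(2) by blast
    have "Q.cup W g h = M.beta W (s \<otimes>\<^bsub>S\<^esub> t) - M.beta W s - M.beta W t"
      using beta_mult[OF s(1) t(1), of W] s t by simp
    moreover have "Q.d1 ?c g h = - M.beta W t - - M.beta W (s \<otimes>\<^bsub>S\<^esub> t) + - M.beta W s"
      unfolding Q.d1_def s(2) t(2) using s t by (simp add: c \<pi>_mult[symmetric])
    ultimately show "Q.cup W g h = Q.d1 ?c g h" by simp
  qed
qed

section \<open>The degree 2 part of the Magnus map on \<open>R\<close>\<close>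

definition part :: "'s \<Rightarrow> nat list \<Rightarrow> 'p mod_ring" where
  "part s = homogeneous_part 2 (magnus S TS d x s)"

abbreviation words2 :: "nat list set" where
  "words2 \<equiv> (\<lambda>(i, j). [i, j]) ` ({..<d} \<times> {..<d})"

lemma part_word: "part s [i, j] = M.b i j s"
  by (simp add: part_def homogeneous_part_def M.b_def M.\<mu>_def)

lemma part_outside:
  assumes "s \<in> carrier S" "w \<notin> words2"
  shows "part s w = 0"
proof (cases "length w = 2")
  case True
  then obtain i j where w: "w = [i, j]" by (auto simp: length_Suc_conv numeral_2_eq_2)
  have "\<not> (i < d \<and> j < d)" using assms(2) w by auto
  then show ?thesis using M.b_outside[OF assms(1)] by (simp add: w part_word)
qed (simp add: part_def homogeneous_part_def)

lemma part_eqI: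
  assumes "s \<in> carrier S" "t \<in> carrier S" "\<And>i j. i < d \<Longrightarrow> j < d \<Longrightarrow> M.b i j s = M.b i j t"
  shows "part s = part t"
proof
  fix w show "part s w = part t w"
  proof (cases "w \<in> words2")
    case True
    then obtain i j where "w = [i, j]" "i < d" "j < d" by auto
    then show ?thesis using assms(3) by (simp add: part_word)
  qed (simp add: part_outside assms)
qed

lemma part_mult:
  assumes s: "s \<in> carrier S" and t: "t \<in> carrier S" and a: "(\<forall>i. M.a i s = 0) \<or> (\<forall>i. M.a i t = 0)"
  shows "part (s \<otimes>\<^bsub>S\<^esub> t) = (\<lambda>w. part s w + part t w)"
proof
  fix w show "part (s \<otimes>\<^bsub>S\<^esub> t) w = part s w + part t w"
  proof (cases "w \<in> words2")
    case True
    then obtain i j where "w = [i, j]" by auto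
    moreover have "M.a i s * M.a j t = 0" using a by auto
    ultimately show ?thesis by (simp add: part_word M.b_mult s t)
  qed (simp add: part_outside s t)
qed

lemma part_one: "part \<one>\<^bsub>S\<^esub> = (\<lambda>_. 0)"
proof
  fix w show "part \<one>\<^bsub>S\<^esub> w = 0"
    by (cases "w \<in> words2") (auto simp: part_word M.b_one part_outside)
qed

lemma part_inv:
  assumes "r \<in> R"
  shows "part (inv\<^bsub>S\<^esub> r) = (\<lambda>w. - part r w)"
proof
  fix w
  have "part (r \<otimes>\<^bsub>S\<^esub> inv\<^bsub>S\<^esub> r) = (\<lambda>w. part r w + part (inv\<^bsub>S\<^esub> r) w)"
    using assms by (intro part_mult) (simp_all add: a_R R_carrier)
  then have "(\<lambda>w. part r w + part (inv\<^bsub>S\<^esub> r) w) = (\<lambda>_. 0)"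
    using R_carrier[OF assms] by (simp add: part_one)
  from fun_cong[OF this, of w] show "part (inv\<^bsub>S\<^esub> r) w = - part r w"
    by (simp add: eq_neg_iff_add_eq_0 add.commute)
qed

text \<open>The conjugate \<open>?r\<close> satisfies \<open>?r s = s r\<close>. Both
  \<open>?r\<close> and \<open>r\<close> lie in \<open>R\<close>, where the linear coefficients
  vanish, so \<open>part\<close> is additive on both products and \<open>part s\<close>
  cancels.\<close>

lemma part_conj:
  assumes s: "s \<in> carrier S" and r: "r \<in> R"
  shows "part (s \<otimes>\<^bsub>S\<^esub> r \<otimes>\<^bsub>S\<^esub> inv\<^bsub>S\<^esub> s) = part r"
proof -
  let ?r = "s \<otimes>\<^bsub>S\<^esub> r \<otimes>\<^bsub>S\<^esub> inv\<^bsub>S\<^esub> s"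
  have r': "?r \<in> R" using R_conj[OF s r] .
  have rc: "r \<in> carrier S" by (rule R_carrier[OF r])
  have "?r \<otimes>\<^bsub>S\<^esub> s = s \<otimes>\<^bsub>S\<^esub> r" using s rc by (simp add: M.m_assoc)
  then have "part (?r \<otimes>\<^bsub>S\<^esub> s) = part (s \<otimes>\<^bsub>S\<^esub> r)" by simp
  moreover have "part (?r \<otimes>\<^bsub>S\<^esub> s) = (\<lambda>w. part ?r w + part s w)"
    using a_R[OF r'] R_carrier[OF r'] s by (intro part_mult) simp_all
  moreover have "part (s \<otimes>\<^bsub>S\<^esub> r) = (\<lambda>w. part s w + part r w)"
    using a_R[OF r] rc s by (intro part_mult) simp_all
  ultimately show ?thesis by (auto simp: fun_eq_iff)
qed

lemma part_in_ncpoly_deg: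
  assumes "s \<in> carrier S"
  shows "part s \<in> ncpoly_deg d 2"
proof -
  have supp: "w \<in> words2" if "part s w \<noteq> 0" for w using part_outside[OF assms] that by blast
  then have "{w. part s w \<noteq> 0} \<subseteq> words2" by blast
  then have "finite {w. part s w \<noteq> 0}" by (rule finite_subset) simp
  moreover have "set w \<subseteq> {..<d}" "length w = 2" if "part s w \<noteq> 0" for w
    using supp[OF that] by auto
  ultimately show ?thesis by (simp add: ncpoly_deg_def homogeneous_def)
qed

lemma sum_words2: "(\<Sum>w\<in>words2. f w) = (\<Sum>i<d. \<Sum>j<d. f [i, j])"
  by (subst sum.reindex) (auto simp: inj_on_def sum.cartesian_product o_def case_prod_unfold)

lemma continuous_part: "continuous_map TS discrete part"
proof (rule continuous_map_discrete_local)
  fix s assume "s \<in> topspace TS"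
  then have s: "s \<in> carrier S" by (simp add: M.topspace_eq)
  let ?U = "(\<Inter>p\<in>{..<d} \<times> {..<d}. {t \<in> topspace TS. M.b (fst p) (snd p) t = M.b (fst p) (snd p) s}) \<inter> topspace TS"
  have "openin TS ?U"
    using M.continuous_b[unfolded continuous_map_discrete_iff] by (intro openin_INT) auto
  moreover have "s \<in> ?U" using s by (auto simp: M.topspace_eq)
  moreover have "part t = part s" if "t \<in> ?U" for t
    by (rule part_eqI) (use that s in \<open>auto simp: M.topspace_eq\<close>)
  ultimately show "\<exists>U. openin TS U \<and> s \<in> U \<and> (\<forall>t\<in>U. part t = part s)" by blast
qed

theorem annihilator_eq: "annihilator d \<Omega> = part ` R"
proof (intro equalityI subsetI)
  fix F assume "F \<in> part ` R"
  then obtain r where r: "r \<in> R" "F = part r" by blast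
  have "tensor_pairing d F W = 0" if "W \<in> \<Omega>" for W
    using beta_\<Omega>[OF that r(1)]
    by (simp add: tensor_pairing_def r(2) part_word M.beta_def mult.commute)
  then show "F \<in> annihilator d \<Omega>"
    unfolding annihilator_def using part_in_ncpoly_deg[OF R_carrier[OF r(1)]] r(2) by blast
next
  fix F assume F: "F \<in> annihilator d \<Omega>"
  have Fd: "F \<in> ncpoly_deg d 2" using F by (simp add: annihilator_def)
  show "F \<in> part ` R"
  proof (rule ccontr)
    assume nF: "F \<notin> part ` R"
    have F0: "F w = 0" if "w \<notin> words2" for w
    proof (rule ccontr)
      assume "F w \<noteq> 0"
      then have "length w = 2" "set w \<subseteq> {..<d}" using Fd by (auto simp: ncpoly_deg_def homogeneous_def)
      then have "w \<in> words2" by (auto simp: length_Suc_conv numeral_2_eq_2)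
      then show False using that by blast
    qed
    have "\<exists>W. (\<forall>f\<in>part ` R. (\<Sum>w\<in>words2. f w * W w) = 0) \<and> (\<Sum>w\<in>words2. F w * W w) \<noteq> 0"
    proof (rule separating_functional[OF _ _ _ _ F0 nF])
      show "finite words2" by simp
      show "(\<lambda>_. 0) \<in> part ` R" using part_one one_in_R by (metis image_eqI)
      fix f assume f: "f \<in> part ` R"
      show "f w = 0" if "w \<notin> words2" for w using f that part_outside R_carrier by auto
      fix g assume g: "g \<in> part ` R"
      obtain r r' where r: "r \<in> R" "f = part r" "r' \<in> R" "g = part r'" using f g by blast
      have "part (r \<otimes>\<^bsub>S\<^esub> r') = (\<lambda>w. f w + g w)"
        using r a_R[OF r(1)] R_carrier by (simp add: part_mult)
      then show "(\<lambda>w. f w + g w) \<in> part ` R" using R_mult[OF r(1,3)] by (metis image_eqI)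
    qed
    then obtain W where W: "\<And>r. r \<in> R \<Longrightarrow> (\<Sum>w\<in>words2. part r w * W w) = 0"
        "(\<Sum>w\<in>words2. F w * W w) \<noteq> 0" by blast
    \<comment> \<open>The separating functional is arbitrary off the words of length 2 in the
      variables; cutting it off there makes it a polynomial of degree 2.\<close>
    let ?W = "\<lambda>w. if w \<in> words2 then W w else 0"
    have W_word: "?W [i, j] = W [i, j]" if "i < d" "j < d" for i j using that by auto
    have W0: "w \<in> words2" if "?W w \<noteq> 0" for w using that by (metis (full_types))
    then have "{w. ?W w \<noteq> 0} \<subseteq> words2" by blast
    then have "finite {w. ?W w \<noteq> 0}" by (rule finite_subset) simp
    moreover have "set w \<subseteq> {..<d}" "length w = 2" if "?W w \<noteq> 0" for w
      using W0[OF that] by auto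
    ultimately have Wd: "?W \<in> ncpoly_deg d 2" unfolding ncpoly_deg_def homogeneous_def ncpoly_simps by blast
    have "?W \<in> \<Omega>"
    proof (rule mem_\<Omega>_if_beta[OF Wd])
      fix r assume r: "r \<in> R"
      have "M.beta ?W r = (\<Sum>i<d. \<Sum>j<d. part r [i, j] * W [i, j])"
        unfolding M.beta_def by (intro sum.cong refl) (use W_word in \<open>simp add: part_word mult.commute\<close>)
      then show "M.beta ?W r = 0" using W(1)[OF r] by (simp only: sum_words2)
    qed
    then have 1: "tensor_pairing d F ?W = 0" using F by (simp only: annihilator_def) blast
    have 2: "tensor_pairing d F ?W = - (\<Sum>i<d. \<Sum>j<d. F [i, j] * W [i, j])"
      unfolding tensor_pairing_def
      by (intro arg_cong[where f = uminus] sum.cong refl) (use W_word in simp)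
    have "(\<Sum>i<d. \<Sum>j<d. F [i, j] * W [i, j]) = 0"
      using trans[OF sym[OF 2] 1] by (simp only: neg_equal_0_iff_equal)
    moreover have "(\<Sum>i<d. \<Sum>j<d. F [i, j] * W [i, j]) \<noteq> 0" using W(2) unfolding sum_words2 .
    ultimately show False by contradiction
  qed
qed

text \<open>The coefficients of degree 1 and 2 vanish on \<open>S_(3)\<close>, so
  \<open>part\<close> is constant on the coset. Together with a member \<open>y\<close> of the coset
  this makes the image a singleton, as \<open>the_elem\<close> requires.\<close>

lemma magnus_graded_coset:
  assumes s: "s \<in> carrier S" and y: "y \<in> zassenhaus CARD('p) S TS 3 #>\<^bsub>S\<^esub> s"
  shows "magnus_graded S TS d x 2 (zassenhaus CARD('p) S TS 3 #>\<^bsub>S\<^esub> s) = part s"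
proof -
  have "part u = part s" if u: "u \<in> zassenhaus CARD('p) S TS 3 #>\<^bsub>S\<^esub> s" for u
  proof -
    obtain z where z: "z \<in> zassenhaus CARD('p) S TS 3" "u = z \<otimes>\<^bsub>S\<^esub> s" using u by (auto simp: r_coset_def)
    have zc: "z \<in> carrier S" using z(1) zassenhaus_subset_carrier[OF M.topspace_eq] by blast
    have a: "M.a i z = 0" for i by (rule M.a_vanishes_on_zassenhaus[OF _ z(1)]) simp
    have b: "M.b i j z = 0" for i j by (rule M.b_vanishes_on_zassenhaus[OF _ z(1)]) simp
    show ?thesis unfolding z(2) by (rule part_eqI) (use s zc in \<open>simp_all add: M.b_mult a b\<close>)
  qed
  then have "part ` (zassenhaus CARD('p) S TS 3 #>\<^bsub>S\<^esub> s) = (\<lambda>_. part s) ` (zassenhaus CARD('p) S TS 3 #>\<^bsub>S\<^esub> s)"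
    by (rule image_cong[OF refl])
  also have "\<dots> = {part s}" using y by (rule image_constant)
  finally show ?thesis by (simp add: magnus_graded_def part_def[abs_def])
qed

lemma mem_own_coset: "s \<in> carrier S \<Longrightarrow> s \<in> zassenhaus CARD('p) S TS 3 #>\<^bsub>S\<^esub> s"
  using one_in_zassenhaus[OF M.group_axioms M.topspace_eq, of "CARD('p)" 3] M.l_one[of s]
  unfolding r_coset_def by force

text \<open>A coset in \<open>R S_(3) / S_(3)\<close> has a representative \<open>r z\<close> with
  \<open>r\<close> in \<open>R\<close> and \<open>z\<close> in \<open>S_(3)\<close>, and the factor
  \<open>z\<close> does not change \<open>part\<close>.\<close>

lemma magnus_graded_image:
  "magnus_graded S TS d x 2 ` carrier (S\<lparr>carrier := R <#>\<^bsub>S\<^esub> zassenhaus CARD('p) S TS 3\<rparr> Mod zassenhaus CARD('p) S TS 3) = part ` R"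
proof -
  have "carrier (S\<lparr>carrier := R <#>\<^bsub>S\<^esub> zassenhaus CARD('p) S TS 3\<rparr> Mod zassenhaus CARD('p) S TS 3) = (\<lambda>y. zassenhaus CARD('p) S TS 3 #>\<^bsub>S\<^esub> y) ` (R <#>\<^bsub>S\<^esub> zassenhaus CARD('p) S TS 3)"
    by (auto simp: FactGroup_def RCOSETS_def r_coset_def)
  also have "magnus_graded S TS d x 2 ` \<dots> = part ` (R <#>\<^bsub>S\<^esub> zassenhaus CARD('p) S TS 3)"
    unfolding image_image
  proof (intro image_cong refl)
    fix y assume "y \<in> R <#>\<^bsub>S\<^esub> zassenhaus CARD('p) S TS 3"
    then obtain r z where "r \<in> R" "z \<in> zassenhaus CARD('p) S TS 3" "y = r \<otimes>\<^bsub>S\<^esub> z"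
      by (auto simp: set_mult_def)
    then have "y \<in> carrier S"
      using R_carrier subsetD[OF zassenhaus_subset_carrier[OF M.topspace_eq]] by (simp only: M.m_closed)
    then show "magnus_graded S TS d x 2 (zassenhaus CARD('p) S TS 3 #>\<^bsub>S\<^esub> y) = part y"
      using magnus_graded_coset mem_own_coset by blast
  qed
  also have "\<dots> = part ` R"
  proof (intro equalityI subsetI)
    fix F assume "F \<in> part ` (R <#>\<^bsub>S\<^esub> zassenhaus CARD('p) S TS 3)"
    then obtain r z where rz: "r \<in> R" "z \<in> zassenhaus CARD('p) S TS 3" "F = part (r \<otimes>\<^bsub>S\<^esub> z)" by (auto simp: set_mult_def)
    have zc: "z \<in> carrier S" using rz(2) zassenhaus_subset_carrier[OF M.topspace_eq] by blast
    have "M.b i j z = 0" for i j by (rule M.b_vanishes_on_zassenhaus[OF _ rz(2)]) simp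
    then have "part (r \<otimes>\<^bsub>S\<^esub> z) = part r"
      using R_carrier[OF rz(1)] zc a_R[OF rz(1)] by (intro part_eqI) (simp_all add: M.b_mult)
    then show "F \<in> part ` R" using rz by simp
  next
    fix F assume "F \<in> part ` R"
    then obtain r where r: "r \<in> R" "F = part r" by blast
    have "r \<otimes>\<^bsub>S\<^esub> \<one>\<^bsub>S\<^esub> \<in> R <#>\<^bsub>S\<^esub> zassenhaus CARD('p) S TS 3"
      using r(1) one_in_zassenhaus[OF M.group_axioms M.topspace_eq] unfolding set_mult_def by blast
    then show "F \<in> part ` (R <#>\<^bsub>S\<^esub> zassenhaus CARD('p) S TS 3)" using r R_carrier[OF r(1)] by simp
  qed
  finally show ?thesis .
qed

end

section \<open>Defining relations\<close>

context quadratic_presentation_setup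
begin

text \<open>The cocycle \<open>z\<close> represents the transgression of \<open>f\<close>.\<close>

lemma invariant_function_eq_beta:
  fixes h f :: "'s \<Rightarrow> 'p mod_ring"
  assumes h: "continuous_map TS discrete h"
    and hr: "\<And>s r. s \<in> carrier S \<Longrightarrow> r \<in> R \<Longrightarrow> h (s \<otimes>\<^bsub>S\<^esub> r) = h s + f r"
    and f_mult: "\<And>r r'. r \<in> R \<Longrightarrow> r' \<in> R \<Longrightarrow> f (r \<otimes>\<^bsub>S\<^esub> r') = f r + f r'"
    and f_conj: "\<And>s r. s \<in> carrier S \<Longrightarrow> r \<in> R \<Longrightarrow> f (s \<otimes>\<^bsub>S\<^esub> r \<otimes>\<^bsub>S\<^esub> inv\<^bsub>S\<^esub> s) = f r"
  obtains F where "\<And>r. r \<in> R \<Longrightarrow> f r + M.beta F r = 0"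
proof -
  \<comment> \<open>Moving \<open>r\<close> to the right past \<open>t\<close> replaces it by a
    conjugate, on which the invariant function \<open>f\<close> has the same value. So changing the
    lifts \<open>s\<close> and \<open>t\<close> by elements of \<open>R\<close> alters
    \<open>h\<close> only by \<open>f r + f r'\<close>.\<close>
  have hR: "h (s \<otimes>\<^bsub>S\<^esub> r \<otimes>\<^bsub>S\<^esub> (t \<otimes>\<^bsub>S\<^esub> r')) = h (s \<otimes>\<^bsub>S\<^esub> t) + f r + f r'"
    if s: "s \<in> carrier S" "t \<in> carrier S" and r: "r \<in> R" "r' \<in> R" for s t r r'
  proof -
    let ?q = "inv\<^bsub>S\<^esub> t \<otimes>\<^bsub>S\<^esub> r \<otimes>\<^bsub>S\<^esub> t"
    note c = s R_carrier[OF r(1)] R_carrier[OF r(2)]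
    have q: "?q \<in> R" "f ?q = f r"
      using R_conj[of "inv\<^bsub>S\<^esub> t" r] f_conj[of "inv\<^bsub>S\<^esub> t" r] s(2) r(1) by simp_all
    have "t \<otimes>\<^bsub>S\<^esub> ?q = r \<otimes>\<^bsub>S\<^esub> t" using c by (simp add: M.m_assoc[symmetric])
    then have "s \<otimes>\<^bsub>S\<^esub> r \<otimes>\<^bsub>S\<^esub> (t \<otimes>\<^bsub>S\<^esub> r') = s \<otimes>\<^bsub>S\<^esub> (t \<otimes>\<^bsub>S\<^esub> ?q) \<otimes>\<^bsub>S\<^esub> r'"
      using c by (simp only: M.m_assoc M.m_closed)
    also have "\<dots> = s \<otimes>\<^bsub>S\<^esub> t \<otimes>\<^bsub>S\<^esub> (?q \<otimes>\<^bsub>S\<^esub> r')"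
      using c by (simp add: M.m_assoc)
    finally show ?thesis
      using hr[OF M.m_closed[OF s] R_mult[OF q(1) r(2)]] f_mult[OF q(1) r(2)] q(2) by (simp add: add.assoc)
  qed
  \<comment> \<open>The coboundary of \<open>h\<close> on \<open>S\<close>, evaluated at chosen
    lifts. By \<open>hR\<close> the contributions of \<open>R\<close> cancel, so any other lifts
    give the same value.\<close>
  define z where "z g g' = h (\<sigma> g) + h (\<sigma> g') - h (\<sigma> g \<otimes>\<^bsub>S\<^esub> \<sigma> g')" for g g'
  have z: "z (\<pi> s) (\<pi> t) = h s + h t - h (s \<otimes>\<^bsub>S\<^esub> t)" if s: "s \<in> carrier S" "t \<in> carrier S" for s t
  proof -
    obtain r where r: "r \<in> R" "\<sigma> (\<pi> s) = s \<otimes>\<^bsub>S\<^esub> r"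
      using fibre[OF s(1) \<sigma>(1)[OF s(1)] \<sigma>(2)[OF s(1), symmetric]] by blast
    obtain r' where r': "r' \<in> R" "\<sigma> (\<pi> t) = t \<otimes>\<^bsub>S\<^esub> r'"
      using fibre[OF s(2) \<sigma>(1)[OF s(2)] \<sigma>(2)[OF s(2), symmetric]] by blast
    show ?thesis
      unfolding z_def r(2) r'(2) by (simp add: hR s r r' hr)
  qed
  have lift: "\<exists>s\<in>carrier S. \<pi> s = g" if "g \<in> carrier G" for g
  proof -
    have "g \<in> \<pi> ` carrier S" using that \<pi>(2) by simp
    then show ?thesis by auto
  qed
  have c1: "continuous_map (prod_topology TS TS) discrete (\<lambda>p. h (fst p))"
    using continuous_map_compose[OF continuous_map_fst h] by (simp add: o_def)
  have c2: "continuous_map (prod_topology TS TS) discrete (\<lambda>p. h (snd p))"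
    using continuous_map_compose[OF continuous_map_snd h] by (simp add: o_def)
  have c3: "continuous_map (prod_topology TS TS) discrete (\<lambda>p. h (fst p \<otimes>\<^bsub>S\<^esub> snd p))"
    using continuous_map_compose[OF topological_groupD(3)[OF pro_p_groupD(1)[OF M.pro_p]] h]
    by (simp add: o_def case_prod_unfold)
  have c12: "continuous_map (prod_topology TS TS) discrete (\<lambda>p. h (fst p) + h (snd p))"
    by (rule continuous_map_discrete_binop[OF c1 c2])
  have "continuous_map (prod_topology TS TS) discrete (\<lambda>p. h (fst p) + h (snd p) - h (fst p \<otimes>\<^bsub>S\<^esub> snd p))"
    by (rule continuous_map_discrete_binop[OF c12 c3])
  then have "continuous_map (prod_topology TS TS) discrete ((\<lambda>(g, g'). z g g') \<circ> (\<lambda>(s, t). (\<pi> s, \<pi> t)))"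
    by (rule continuous_map_eq) (auto simp: M.topspace_eq z)
  then have cz: "continuous_map (prod_topology TG TG) discrete (\<lambda>(g, g'). z g g')"
    by (rule continuous_compose_quotient_map[OF quotient_map_\<pi>_prod])
  have cocycle: "z g' k - z (g \<otimes>\<^bsub>G\<^esub> g') k + z g (g' \<otimes>\<^bsub>G\<^esub> k) - z g g' = 0"
    if g: "g \<in> carrier G" "g' \<in> carrier G" "k \<in> carrier G" for g g' k
  proof -
    obtain s where s: "s \<in> carrier S" "g = \<pi> s" using lift[OF g(1)] by blast
    obtain t where t: "t \<in> carrier S" "g' = \<pi> t" using lift[OF g(2)] by blast
    obtain u where u: "u \<in> carrier S" "k = \<pi> u" using lift[OF g(3)] by blast
    show ?thesis
      unfolding s(2) t(2) u(2) \<pi>_mult[OF s(1) t(1), symmetric] \<pi>_mult[OF t(1) u(1), symmetric]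
      using s(1) t(1) u(1) by (simp add: z M.m_assoc)
  qed
  obtain F c where c: "continuous_map TG discrete c"
    and eq: "\<And>g g'. g \<in> carrier G \<Longrightarrow> g' \<in> carrier G \<Longrightarrow> z g g' = Q.cup F g g' + Q.d1 c g g'"
  proof (rule Q.cocycle_eq_cup[OF cz])
    show "z g' k - z (g \<otimes>\<^bsub>G\<^esub> g') k + z g (g' \<otimes>\<^bsub>G\<^esub> k) - z g g' = 0"
      if "g \<in> carrier G" "g' \<in> carrier G" "k \<in> carrier G" for g g' k
      using that by (rule cocycle)
  qed (rule that)
  \<comment> \<open>The coboundary of \<open>h\<close> is the pullback of
    \<open>cup F + d1 c\<close>, and that of \<open>\<beta>_F\<close> is minus the pullback of
    \<open>cup F\<close>. Thus \<open>?k\<close> has zero coboundary, that is, it is a homomorphism;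
    it vanishes on \<open>R\<close>, where \<open>h\<close> is \<open>f\<close> up to a constant and
    \<open>c \<circ> \<pi>\<close> is constant.\<close>
  let ?k = "\<lambda>s. h s + M.beta F s - c (\<pi> s)"
  have hb: "continuous_map TS discrete (\<lambda>s. h s + M.beta F s)"
    by (rule continuous_map_discrete_binop[OF h M.continuous_beta])
  have c\<pi>: "continuous_map TS discrete (\<lambda>s. c (\<pi> s))"
    using continuous_map_compose[OF \<pi>_continuous c] by (simp add: o_def)
  have k: "continuous_map TS discrete ?k"
    by (rule continuous_map_discrete_binop[OF hb c\<pi>])
  have k_mult: "?k (s \<otimes>\<^bsub>S\<^esub> t) = ?k s + ?k t" if s: "s \<in> carrier S" "t \<in> carrier S" for s t
  proof -
    have "h s + h t - h (s \<otimes>\<^bsub>S\<^esub> t) = Q.cup F (\<pi> s) (\<pi> t) + (c (\<pi> t) - c (\<pi> (s \<otimes>\<^bsub>S\<^esub> t)) + c (\<pi> s))"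
      using eq[OF \<pi>_closed[OF s(1)] \<pi>_closed[OF s(2)]] by (simp add: z s Q.d1_def \<pi>_mult)
    then have "h (s \<otimes>\<^bsub>S\<^esub> t) = h s + h t - (Q.cup F (\<pi> s) (\<pi> t) + (c (\<pi> t) - c (\<pi> (s \<otimes>\<^bsub>S\<^esub> t)) + c (\<pi> s)))"
      by (simp add: algebra_simps)
    then show ?thesis by (simp add: beta_mult[OF s])
  qed
  have k0: "?k r = 0" if "r \<in> R" for r
    by (rule hom_vanishes_on_R[where h = ?k, OF k k_mult that])
  show ?thesis
  proof (rule that[of F])
    fix r assume r: "r \<in> R"
    have "h r = h \<one>\<^bsub>S\<^esub> + f r" using hr[OF M.one_closed r] R_carrier[OF r] by simp
    moreover have "h \<one>\<^bsub>S\<^esub> - c \<one>\<^bsub>G\<^esub> = 0" using k0[OF one_in_R] by (simp add: beta_one \<pi>_one)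
    moreover have "h r + M.beta F r - c \<one>\<^bsub>G\<^esub> = 0" using k0[OF r] r by (simp add: R_iff)
    ultimately show "f r + M.beta F r = 0" by (simp add: algebra_simps)
  qed
qed

lemma defining_relations_part_nonzero:
  assumes Rel: "defining_relations S TS R Rel" and r: "r \<in> Rel"
  shows "part r \<noteq> (\<lambda>_. 0)"
proof
  assume part0: "part r = (\<lambda>_. 0)"
  let ?p = "CARD('p)"
  have RelR: "Rel \<subseteq> R" and ncl: "closed_normal_closure S TS Rel = R"
    and min: "\<And>A. A \<subset> Rel \<Longrightarrow> closed_normal_closure S TS A \<noteq> R"
    using Rel by (auto simp: defining_relations_def)
  have RelS: "Rel \<subseteq> carrier S" using RelR R_carrier by blast
  define N where "N = closed_normal_closure S TS (Rel - {r})"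
  have sub: "Rel - {r} \<subseteq> carrier S" using RelS by blast
  note cl = closed_normal_closure[OF M.group_axioms M.topspace_eq sub, folded N_def]
  have "N \<subseteq> R" using RelR by (intro cl(4) R_normal R_closedin) blast
  moreover have "N \<noteq> R" unfolding N_def using r by (intro min) blast
  ultimately obtain r0 where r0: "r0 \<in> R" "r0 \<notin> N" by blast
  have r0c: "r0 \<in> carrier S" by (rule R_carrier[OF r0(1)])
  interpret N: normal N S by (rule cl(1))
  \<comment> \<open>Since \<open>N\<close> is closed and misses \<open>r0\<close>, some open normal
    \<open>U\<close> has \<open>r0 U\<close> disjoint from \<open>N\<close>. In the finite
    \<open>p\<close>-group \<open>S / U\<close> the image of \<open>r0\<close> then stays outside
    the image of \<open>N\<close>, so \<open>p_group_invariant_function\<close> applies to the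
    images of \<open>N\<close> and \<open>R\<close>.\<close>
  let ?V = "{s \<in> carrier S. r0 \<otimes>\<^bsub>S\<^esub> s \<in> carrier S - N}"
  have "openin TS (carrier S - N)"
    using openin_diff[OF openin_topspace cl(2)] by (simp only: M.topspace_eq)
  then have V: "openin TS ?V"
    by (rule openin_left_translate[OF pro_p_groupD(1)[OF M.pro_p] r0c])
  have "\<one>\<^bsub>S\<^esub> \<in> ?V" using r0 r0c by simp
  then obtain U k where U: "U \<lhd> S" "openin TS U" "U \<subseteq> ?V" and ord: "order (S Mod U) = ?p ^ k"
    by (rule pro_p_group_nhd[OF M.pro_p V])
  interpret U: normal U S by (rule U(1))
  interpret K: group "S Mod U" by (rule U.factorgroup_is_group)
  let ?c = "\<lambda>s. U #>\<^bsub>S\<^esub> s"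
  interpret c: group_hom S "S Mod U" ?c by unfold_locales (rule U.r_coset_hom_Mod)
  have surj: "?c ` carrier S = carrier (S Mod U)" by (auto simp: FactGroup_def RCOSETS_def)
  have cN: "?c ` N \<lhd> S Mod U" by (rule N.surj_hom_normal_subgroup[OF c.group_hom_axioms surj])
  have cR: "?c ` R \<lhd> S Mod U" by (rule normal.surj_hom_normal_subgroup[OF R_normal c.group_hom_axioms surj])
  have "?c r0 \<notin> ?c ` N"
  proof
    assume "?c r0 \<in> ?c ` N"
    then obtain n where n: "n \<in> N" "?c r0 = ?c n" by blast
    have nc: "n \<in> carrier S" using n(1) by (rule N.mem_carrier)
    have "n \<in> ?c r0" using M.rcos_self[OF nc U.subgroup_axioms] n(2) by simp
    then obtain u where u: "u \<in> U" "n = u \<otimes>\<^bsub>S\<^esub> r0" by (auto simp: r_coset_def)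
    let ?u = "inv\<^bsub>S\<^esub> r0 \<otimes>\<^bsub>S\<^esub> u \<otimes>\<^bsub>S\<^esub> r0"
    have uc: "u \<in> carrier S" using u(1) by (rule U.mem_carrier)
    have "?u \<in> U" by (rule U.inv_op_closed1[OF r0c u(1)])
    then have "r0 \<otimes>\<^bsub>S\<^esub> ?u \<notin> N" using U(3) by blast
    moreover have "r0 \<otimes>\<^bsub>S\<^esub> ?u = n" using r0c uc u(2) by (simp add: M.m_assoc[symmetric])
    ultimately show False using n(1) by simp
  qed
  then have "\<not> ?c ` R \<subseteq> ?c ` N" using r0(1) by blast
  then obtain h f :: "'s set \<Rightarrow> 'p mod_ring" where
    h: "\<And>s y. s \<in> carrier (S Mod U) \<Longrightarrow> y \<in> ?c ` R \<Longrightarrow> h (s \<otimes>\<^bsub>S Mod U\<^esub> y) = h s + f y"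
    and f_mult: "\<And>y z. y \<in> ?c ` R \<Longrightarrow> z \<in> ?c ` R \<Longrightarrow> f (y \<otimes>\<^bsub>S Mod U\<^esub> z) = f y + f z"
    and f_conj: "\<And>s y. s \<in> carrier (S Mod U) \<Longrightarrow> y \<in> ?c ` R \<Longrightarrow>
      f (s \<otimes>\<^bsub>S Mod U\<^esub> y \<otimes>\<^bsub>S Mod U\<^esub> inv\<^bsub>S Mod U\<^esub> s) = f y"
    and f_N: "\<And>y. y \<in> ?c ` N \<inter> ?c ` R \<Longrightarrow> f y = 0"
    and f_nz: "\<exists>y\<in>?c ` R. f y \<noteq> 0"
    by (rule K.p_group_invariant_function[OF ord cN cR]) (rule that)
  have hc: "continuous_map TS discrete (\<lambda>s. h (?c s))"
  proof (rule continuous_map_discrete_local)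
    fix s assume "s \<in> topspace TS"
    then have s: "s \<in> carrier S" by (simp add: M.topspace_eq)
    let ?W = "{t \<in> topspace TS. t \<otimes>\<^bsub>S\<^esub> inv\<^bsub>S\<^esub> s \<in> U}"
    have "openin TS ?W"
      by (rule openin_continuous_map_preimage[OF continuous_map_right_translation[OF pro_p_groupD(1)[OF M.pro_p]] U(2)])
        (use s in simp)
    moreover have "s \<in> ?W" using s U.one_closed by (simp add: M.topspace_eq)
    moreover have "?c t = ?c s" if "t \<in> ?W" for t
    proof -
      have t: "t \<in> carrier S" "t \<otimes>\<^bsub>S\<^esub> inv\<^bsub>S\<^esub> s \<in> U" using that by (simp_all add: M.topspace_eq)
      have "t \<in> ?c s" by (rule U.rcos_module_rev[OF M.group_axioms s t])
      from M.repr_independence[OF this s U.subgroup_axioms] show ?thesis by (rule sym)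
    qed
    ultimately show "\<exists>W. openin TS W \<and> s \<in> W \<and> (\<forall>t\<in>W. h (?c t) = h (?c s))" by metis
  qed
  obtain F where F: "\<And>r. r \<in> R \<Longrightarrow> f (?c r) + M.beta F r = 0"
  proof (rule invariant_function_eq_beta[where h = "\<lambda>s. h (?c s)" and f = "\<lambda>s. f (?c s)", OF hc])
    fix s y assume s: "s \<in> carrier S" and y: "y \<in> R"
    note yc = R_carrier[OF y]
    show "h (?c (s \<otimes>\<^bsub>S\<^esub> y)) = h (?c s) + f (?c y)"
      unfolding c.hom_mult[OF s yc] by (rule h[OF c.hom_closed[OF s] imageI[OF y]])
    show "f (?c (s \<otimes>\<^bsub>S\<^esub> y \<otimes>\<^bsub>S\<^esub> inv\<^bsub>S\<^esub> s)) = f (?c y)"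
      unfolding c.hom_mult[OF M.m_closed[OF s yc] M.inv_closed[OF s]] c.hom_mult[OF s yc] c.hom_inv[OF s]
      by (rule f_conj[OF c.hom_closed[OF s] imageI[OF y]])
  next
    fix y z assume y: "y \<in> R" and z: "z \<in> R"
    show "f (?c (y \<otimes>\<^bsub>S\<^esub> z)) = f (?c y) + f (?c z)"
      unfolding c.hom_mult[OF R_carrier[OF y] R_carrier[OF z]] by (rule f_mult[OF imageI[OF y] imageI[OF z]])
  qed (rule that)
  \<comment> \<open>On \<open>R\<close> the function \<open>\<beta>_F\<close> is minus the pullback
    of \<open>f\<close>, so it vanishes at the other relations, which lie in \<open>N\<close>; it
    vanishes at \<open>r\<close> because \<open>part r\<close> is 0. Being closed and normal,
    \<open>?K\<close> is therefore all of \<open>R\<close>, and \<open>f\<close> would be zero on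
    the image of \<open>R\<close>.\<close>
  let ?K = "{s \<in> carrier S. s \<in> R \<and> M.beta F s = 0}"
  have beta_inv: "M.beta F (inv\<^bsub>S\<^esub> s) = - M.beta F s" if "s \<in> R" for s
    using beta_mult_R[OF M.inv_closed[OF R_carrier[OF that]] that, of F] R_carrier[OF that]
    by (simp add: beta_one eq_neg_iff_add_eq_0)
  have beta_conj: "M.beta F (s \<otimes>\<^bsub>S\<^esub> y \<otimes>\<^bsub>S\<^esub> inv\<^bsub>S\<^esub> s) = M.beta F y" if "s \<in> carrier S" "y \<in> R" for s y
  proof -
    have "M.b i j (s \<otimes>\<^bsub>S\<^esub> y \<otimes>\<^bsub>S\<^esub> inv\<^bsub>S\<^esub> s) = M.b i j y" for i j
      unfolding part_word[symmetric] part_conj[OF that] ..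
    then show ?thesis by (simp add: M.beta_def)
  qed
  have "subgroup ?K S"
  proof (rule M.subgroupI)
    show "?K \<noteq> {}" using one_in_R beta_one by (auto intro!: exI[of _ "\<one>\<^bsub>S\<^esub>"])
    show "inv\<^bsub>S\<^esub> s \<in> ?K" if "s \<in> ?K" for s
      using that beta_inv subgroup.m_inv_closed[OF normal_imp_subgroup[OF R_normal]] by simp
    show "s \<otimes>\<^bsub>S\<^esub> t \<in> ?K" if "s \<in> ?K" "t \<in> ?K" for s t
      using that beta_mult_R R_mult by simp
  qed blast
  then have "?K \<lhd> S"
  proof (rule M.normal_invI)
    fix s y assume "s \<in> carrier S" "y \<in> ?K"
    then show "s \<otimes>\<^bsub>S\<^esub> y \<otimes>\<^bsub>S\<^esub> inv\<^bsub>S\<^esub> s \<in> ?K"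
      using R_conj[of s y] beta_conj[of s y] R_carrier by simp
  qed
  moreover have "closedin TS ?K"
  proof -
    have eq: "?K = R \<inter> {s \<in> topspace TS. M.beta F s \<in> {0}}" using R_carrier by (auto simp: M.topspace_eq)
    show ?thesis
      unfolding eq by (rule closedin_Int[OF R_closedin closedin_discrete_vimage[OF M.continuous_beta]])
  qed
  moreover have "Rel \<subseteq> ?K"
  proof
    fix y assume y: "y \<in> Rel"
    have yR: "y \<in> R" using y RelR by blast
    have "M.beta F y = 0"
    proof (cases "y = r")
      case True
      have "M.b i j r = 0" for i j unfolding part_word[symmetric] part0 ..
      then show ?thesis by (simp add: True M.beta_def)
    next
      case False
      then have "y \<in> N" using cl(3) y by blast
      then have "f (?c y) = 0" using yR by (intro f_N) blast
      then show ?thesis using F[OF yR] by simp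
    qed
    then show "y \<in> ?K" using yR R_carrier by blast
  qed
  ultimately have "closed_normal_closure S TS Rel \<subseteq> ?K"
    by (rule closed_normal_closure(4)[OF M.group_axioms M.topspace_eq RelS])
  then have "M.beta F y = 0" if "y \<in> R" for y using that ncl by blast
  then have "f (?c y) = 0" if "y \<in> R" for y using F[OF that] that by simp
  then show False using f_nz by blast
qed

text \<open>A relation lies in \<open>S_(2)\<close>, and its nonzero degree 2 part keeps it out of
  \<open>S_(n)\<close> for all \<open>n \<ge> 3\<close>. So the greatest index exists and equals
  2.\<close>

lemma initial_form_eq:
  assumes Rel: "defining_relations S TS R Rel" and r: "r \<in> Rel"
  shows "initial_form S TS d x r = part r"
proof -
  have rR: "r \<in> R" using assms by (auto simp: defining_relations_def)
  have rc: "r \<in> carrier S" by (rule R_carrier[OF rR])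
  have "(GREATEST n. r \<in> zassenhaus CARD('p) S TS n) = 2"
  proof (rule Greatest_equality)
    show "r \<in> zassenhaus CARD('p) S TS 2" using minimal rR by blast
    fix n assume n: "r \<in> zassenhaus CARD('p) S TS n"
    show "n \<le> 2"
    proof (rule ccontr)
      assume "\<not> n \<le> 2"
      then have n3: "n \<ge> 3" by simp
      have "part r = part \<one>\<^bsub>S\<^esub>"
        by (rule part_eqI[OF rc M.one_closed]) (simp add: M.b_vanishes_on_zassenhaus[OF n3 n] M.b_one)
      then show False using defining_relations_part_nonzero[OF assms] by (simp add: part_one)
    qed
  qed
  then show ?thesis
    using magnus_graded_coset[OF rc mem_own_coset[OF rc]] by (simp add: initial_form_def Let_def)
qed

text \<open>The relations generate \<open>R\<close> only as a closed normal subgroup. The elements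
  of \<open>R\<close> whose \<open>part\<close> lies in the ideal of the relations still form such a
  subgroup: \<open>part\<close> is additive on \<open>R\<close>, invariant under conjugation and
  locally constant. Containing the relations, it is all of \<open>R\<close>.\<close>

lemma ideal_initial_forms:
  assumes Rel: "defining_relations S TS R Rel"
  shows "Idl\<^bsub>ncpoly d\<^esub> (initial_form S TS d x ` Rel) = Idl\<^bsub>ncpoly d\<^esub> (annihilator d \<Omega>)"
proof -
  interpret P: ring "ncpoly d :: (nat list \<Rightarrow> 'p mod_ring) ring" by (rule ring_ncpoly)
  have RelR: "Rel \<subseteq> R" and ncl: "closed_normal_closure S TS Rel = R"
    using Rel by (auto simp: defining_relations_def)
  have RelS: "Rel \<subseteq> carrier S" using RelR R_carrier by blast
  have forms: "initial_form S TS d x ` Rel = part ` Rel"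
    by (rule image_cong[OF refl]) (rule initial_form_eq[OF Rel])
  have carr: "part ` R \<subseteq> carrier (ncpoly d)"
    using part_in_ncpoly_deg R_carrier unfolding ncpoly_deg_def by blast
  let ?J = "Idl\<^bsub>ncpoly d\<^esub> (part ` Rel)"
  have carr': "part ` Rel \<subseteq> carrier (ncpoly d)" using carr RelR by blast
  interpret J: ideal ?J "ncpoly d" by (rule P.genideal_ideal[OF carr'])
  let ?K = "{s \<in> carrier S. s \<in> R \<and> part s \<in> ?J}"
  have part_R_mult: "part (s \<otimes>\<^bsub>S\<^esub> t) = (\<lambda>w. part s w + part t w)" if "s \<in> R" "t \<in> R" for s t
    using that a_R R_carrier by (intro part_mult) simp_all
  have J_add: "(\<lambda>w. u w + v w) \<in> ?J" if "u \<in> ?J" "v \<in> ?J" for u v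
    using J.a_closed[OF that] by (simp only: ncpoly_simps)
  have J_uminus: "(\<lambda>w. - u w) \<in> ?J" if u: "u \<in> ?J" for u
  proof -
    have "(\<lambda>_. 0) \<in> ?J" using J.zero_closed by (simp only: ncpoly_simps)
    then have "(\<lambda>w. - 1 * u w) \<in> ?J" by (rule additive_closed_mod_ring[OF _ J_add u])
    then show ?thesis by (simp only: mult_minus1)
  qed
  have "subgroup ?K S"
  proof (rule M.subgroupI)
    have "part \<one>\<^bsub>S\<^esub> \<in> ?J" using J.zero_closed by (simp only: part_one ncpoly_simps)
    then have "\<one>\<^bsub>S\<^esub> \<in> ?K" using one_in_R by blast
    then show "?K \<noteq> {}" by blast
    show "inv\<^bsub>S\<^esub> s \<in> ?K" if "s \<in> ?K" for s
    proof -
      have s: "s \<in> R" "part s \<in> ?J" using that by blast+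
      have "inv\<^bsub>S\<^esub> s \<in> R" by (rule subgroup.m_inv_closed[OF normal_imp_subgroup[OF R_normal] s(1)])
      moreover have "part (inv\<^bsub>S\<^esub> s) \<in> ?J" unfolding part_inv[OF s(1)] by (rule J_uminus[OF s(2)])
      ultimately show ?thesis using R_carrier by blast
    qed
    show "s \<otimes>\<^bsub>S\<^esub> t \<in> ?K" if st: "s \<in> ?K" "t \<in> ?K" for s t
    proof -
      have s: "s \<in> R" "part s \<in> ?J" and t: "t \<in> R" "part t \<in> ?J" using st by blast+
      have "part (s \<otimes>\<^bsub>S\<^esub> t) \<in> ?J" unfolding part_R_mult[OF s(1) t(1)] by (rule J_add[OF s(2) t(2)])
      then show ?thesis using R_mult[OF s(1) t(1)] R_carrier by blast
    qed
  qed blast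
  then have "?K \<lhd> S"
  proof (rule M.normal_invI)
    fix s y assume s: "s \<in> carrier S" and "y \<in> ?K"
    then have y: "y \<in> R" "part y \<in> ?J" by blast+
    have "part (s \<otimes>\<^bsub>S\<^esub> y \<otimes>\<^bsub>S\<^esub> inv\<^bsub>S\<^esub> s) \<in> ?J" unfolding part_conj[OF s y(1)] by (rule y(2))
    then show "s \<otimes>\<^bsub>S\<^esub> y \<otimes>\<^bsub>S\<^esub> inv\<^bsub>S\<^esub> s \<in> ?K"
      using R_conj[OF s y(1)] R_carrier by blast
  qed
  moreover have "closedin TS ?K"
  proof -
    have eq: "?K = R \<inter> {s \<in> topspace TS. part s \<in> ?J}" using R_carrier by (auto simp: M.topspace_eq)
    show ?thesis
      unfolding eq by (rule closedin_Int[OF R_closedin closedin_discrete_vimage[OF continuous_part]])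
  qed
  moreover have "Rel \<subseteq> ?K"
    using RelR RelS P.genideal_self[OF carr'] by blast
  ultimately have "closed_normal_closure S TS Rel \<subseteq> ?K"
    by (rule closed_normal_closure(4)[OF M.group_axioms M.topspace_eq RelS])
  then have sub: "part ` R \<subseteq> ?J" using ncl by blast
  have "Idl\<^bsub>ncpoly d\<^esub> (part ` R) \<subseteq> ?J"
    by (rule P.genideal_minimal[OF J.ideal_axioms sub])
  moreover have "?J \<subseteq> Idl\<^bsub>ncpoly d\<^esub> (part ` R)"
    by (rule P.genideal_minimal[OF P.genideal_ideal[OF carr]]) (use P.genideal_self[OF carr] RelR in blast)
  ultimately show ?thesis unfolding forms annihilator_eq by blast
qed

end

text \<open>Suffices for the second claim of the theorem: after rewriting with
  \<open>ideal_initial_forms\<close>, both quotient rings and their gradings are the same.\<close>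

lemma graded_ring_iso_refl: "graded_ring_iso A gr A gr \<noteq> {}"
proof -
  have "(\<lambda>a. a) \<in> graded_ring_iso A gr A gr"
    unfolding graded_ring_iso_def ring_iso_def Ring.ring_hom_def by (simp add: bij_betw_def)
  then show ?thesis by blast
qed

theorem theorem7p7:
  fixes G :: "'g monoid" and TG :: "'g topology"
    and S :: "'s monoid" and TS :: "'s topology"
    and d :: nat and x :: "nat \<Rightarrow> 's" and \<pi> :: "'s \<Rightarrow> 'g" and R :: "'s set"
    and chi :: "nat \<Rightarrow> 'g list \<Rightarrow> 'p::prime_card mod_ring"
    and \<Omega> :: "(nat list \<Rightarrow> 'p mod_ring) set"
  assumes G: "pro_p_group CARD('p) G TG" "topologically_fg G TG"
    and S: "free_pro_p_group CARD('p) S TS d x"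
    and presentation: "\<pi> \<in> continuous_hom S TS G TG" "\<pi> ` carrier S = carrier G"
      "kernel S G \<pi> = R"
    and minimal: "R \<subseteq> zassenhaus CARD('p) S TS 2"
    and dual_basis: "\<And>i. i < d \<Longrightarrow> chi i \<in> cocycles G TG \<inter> homogeneous 1"
      "\<And>i j. i < d \<Longrightarrow> j < d \<Longrightarrow> chi i [\<pi> (x j)] = (if i = j then 1 else 0)"
    and quadratic:
      "quadratic_presentation (cohomology_ring G TG) d (\<lambda>i. cohomology_class G TG (chi i)) \<Omega>"
  shows "annihilator d \<Omega> =
           magnus_graded S TS d x 2 `
             carrier (S\<lparr>carrier := R <#>\<^bsub>S\<^esub> zassenhaus CARD('p) S TS 3\<rparr> Mod zassenhaus CARD('p) S TS 3) \<and>
         (\<forall>Rel. defining_relations S TS R Rel \<longrightarrow>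
           (let \<R> = Idl\<^bsub>ncpoly d\<^esub> (initial_form S TS d x ` Rel :: (nat list \<Rightarrow> 'p mod_ring) set)
            in graded_ring_iso (quadratic_dual d \<Omega>) (quadratic_dual_deg d \<Omega>)
                 (ncpoly d Quot \<R>) (ncpoly_quot_deg d \<R>) \<noteq> {}))"
proof -
  note q = quadratic[unfolded quadratic_presentation_def]
  note \<Omega> = conjunct1[OF q] conjunct1[OF conjunct2[OF q]]
  obtain \<phi> where \<phi>1: "\<phi> \<in> Ring.ring_hom (ncpoly d) (cohomology_ring G TG)"
    and \<phi>2: "(\<forall>i<d. \<phi> (ncvar i) = cohomology_class G TG (chi i)) \<and>
      \<phi> ` carrier (ncpoly d) = carrier (cohomology_ring G TG) \<and>
      a_kernel (ncpoly d) (cohomology_ring G TG) \<phi> = Idl\<^bsub>ncpoly d\<^esub> \<Omega>"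
    by (rule bexE[OF conjunct2[OF conjunct2[OF q]]])
  have \<phi>_var: "\<phi> (ncvar i) = cohomology_class G TG (chi i)" if "i < d" for i
    using \<phi>2 that by blast
  note facts = S G(1) presentation minimal dual_basis \<Omega> \<phi>1 \<phi>_var
    conjunct1[OF conjunct2[OF \<phi>2]] conjunct2[OF conjunct2[OF \<phi>2]] pro_p_groupD(4,5)[OF G(1)]
  interpret quadratic_presentation_setup S TS d x "magnus S TS d x :: 's \<Rightarrow> nat list \<Rightarrow> 'p mod_ring"
      G TG chi \<Omega> \<phi> \<pi> R
    by (intro quadratic_presentation_setup.intro magnus_coefficients.intro quadratic_cohomology.intro
        quadratic_presentation_setup_axioms.intro) (fact facts)+
  show ?thesis
  proof (intro conjI allI impI)
    show "annihilator d \<Omega> = magnus_graded S TS d x 2 `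
        carrier (S\<lparr>carrier := R <#>\<^bsub>S\<^esub> zassenhaus CARD('p) S TS 3\<rparr> Mod zassenhaus CARD('p) S TS 3)"
      unfolding magnus_graded_image by (rule annihilator_eq)
    fix Rel assume Rel: "defining_relations S TS R Rel"
    show "let \<R> = Idl\<^bsub>ncpoly d\<^esub> (initial_form S TS d x ` Rel :: (nat list \<Rightarrow> 'p mod_ring) set)
        in graded_ring_iso (quadratic_dual d \<Omega>) (quadratic_dual_deg d \<Omega>)
             (ncpoly d Quot \<R>) (ncpoly_quot_deg d \<R>) \<noteq> {}"
      unfolding Let_def ideal_initial_forms[OF Rel] quadratic_dual_def quadratic_dual_deg_def
      by (rule graded_ring_iso_refl)
  qed
qed

end
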